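(* Let $m\ge2$ be an integer, let the kernel $f:(S^1)^m\to\mathbb{R}\cup\{+\infty\}$ satisfy conditions A1–A6 (minimum version) and let the random points $U_1,U_2,\dots$ on $S^1$ satisfy conditions B1–B3 (minimum version) listed in the context. For $n\ge m$ let $$H_n=\min_{1\le i_1<\dots<i_m\le n} f(U_{i_1},\dots,U_{i_m}).$$ Then for every $t>0$ $$\lim_{n\to\infty}\mathbb{P}\left\{n^{\frac{2m}{m-1}}(H_n-\mu)\le t\right\}=1-\exp\left(-\frac{t^{\frac{m-1}{2}}K}{m!}\right),$$ where $$K=\frac{(2\pi)^{\frac{m-1}{2}}}{\Gamma\left(\frac{m+1}{2}\right)}\sum_{i=1}^k\left(\frac{1}{\sqrt{\det(G_i)}}\int_0^{2\pi}p(x)\prod_{l=1}^{m-1}p(x+V_i^l)\,dx\right).$$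
   Context: $S^1$ is the unit circle with center $O$ at the origin; points of $S^1$ are identified with their polar angles modulo $2\pi$, and sums and differences of angles are taken modulo $2\pi$. For $U_1,\dots,U_m\in S^1$ let $\beta_i\in[0,2\pi)$ be the counterclockwise angle from $OU_1$ to $OU_{i+1}$, $i=1,\dots,m-1$. Conditions on the kernel $f$ (minimum version): A1. $f$ is rotation invariant, i.e. $f(U_1,\dots,U_m)=h(\beta_1,\dots,\beta_{m-1})$ for a function $h:[0,2\pi)^{m-1}\to\mathbb{R}\cup\{+\infty\}$. A2. $f$ is invariant under all permutations of $U_1,\dots,U_m$. A3. $h$ is continuous and extends continuously to $[0,2\pi]^{m-1}$. A4. $h$ attains its minimal value $\mu$ at only finitely many points $V_1,\dots,V_k\in[0,2\pi]^{m-1}$ (the list of all minimum points), and $V_i^j\in(0,2\pi)$ for all $i,j$, where $V_i^j$ is the $j$-th component of $V_i$. A5. There is $\delta>0$ such that $h$ is three times continuously differentiable in the $\delta$-neighborhood of every $V_i$. A6. For every $i$, the Hessian matrix $G_i=\left(\frac{\partial^2 h(V_i)}{\partial x_s\partial x_l}\right)_{s,l=1}^{m-1}$ satisfies $\det(G_i)\ne0$. Conditions on the points: B1. $U_1,U_2,\dots$ are independent and identically distributed on $S^1$ with probability density $p$ (with respect to the angle). B2. $p$ is continuous, i.e. is regarded as a non-negative continuous $2\pi$-periodic function on $\mathbb{R}$ with $\int_0^{2\pi}p(x)\,dx=1$. B3. There is at least one minimum point $V_*\in\{V_1,\dots,V_k\}$ with $\int_0^{2\pi}p(x)\prod_{l=1}^{m-1}p(x+V_*^l)\,dx\ne0$.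 *)

theory Defs
  imports "HOL-Probability.Probability" "HOL-Library.Option_ord"
begin

text \<open>
  The \<open>m - 1\<close> angular coordinates are indexed by a finite linearly ordered type \<open>'n\<close>, and the \<open>m\<close>
  points of the circle by \<open>'n option\<close>: the first point has index \<^term>\<open>None\<close>, and the point
  following it in position \<open>i\<close> has index \<^term>\<open>Some i\<close>. The order on \<open>'n option\<close> puts \<^term>\<open>None\<close>
  first, so an increasing tuple of indices is a strictly monotone function on \<open>'n option\<close>.
  Points of the circle are complex numbers of norm 1.
\<close>

definition rel_angles :: "('n option \<Rightarrow> complex) \<Rightarrow> real ^ 'n" where
  "rel_angles u = (\<chi> i. Arg2pi (u (Some i) / u None))"

definition angle_cube :: "(real ^ 'n) set" where
  "angle_cube = cbox 0 (\<chi> i. 2 * pi)"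

definition partial_deriv :: "'n \<Rightarrow> (real ^ 'n \<Rightarrow> real) \<Rightarrow> real ^ 'n \<Rightarrow> real" where
  "partial_deriv i g x = deriv (\<lambda>t. g (x + t *\<^sub>R axis i 1)) 0"

text \<open>\<open>k\<close> times continuously differentiable; meant for open \<open>S\<close>.\<close>

primrec cont_diff_on :: "nat \<Rightarrow> (real ^ 'n \<Rightarrow> real) \<Rightarrow> (real ^ 'n) set \<Rightarrow> bool" where
  "cont_diff_on 0 g S \<longleftrightarrow> continuous_on S g"
| "cont_diff_on (Suc k) g S \<longleftrightarrow>
     g differentiable_on S \<and> (\<forall>i. cont_diff_on k (partial_deriv i g) S)"

definition hessian :: "(real ^ 'n \<Rightarrow> real) \<Rightarrow> real ^ 'n \<Rightarrow> real ^ 'n ^ 'n" where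
  "hessian g x = (\<chi> s l. partial_deriv s (partial_deriv l g) x)"

text \<open>Only meaningful when \<open>n\<close> is at least the number of arguments of \<open>f\<close>; otherwise the set is empty.\<close>

definition min_U_stat ::
  "(('n::linorder option \<Rightarrow> complex) \<Rightarrow> ereal) \<Rightarrow> (nat \<Rightarrow> complex) \<Rightarrow> nat \<Rightarrow> ereal" where
  "min_U_stat f u n = Min {f (u \<circ> j) | j. strict_mono j \<and> range j \<subseteq> {1..n}}"

definition shifted_integral :: "(real \<Rightarrow> real) \<Rightarrow> real ^ 'n \<Rightarrow> real" where
  "shifted_integral p v = (LBINT x:{0..2 * pi}. p x * (\<Prod>l\<in>UNIV. p (x + v $ l)))"

end

theory Submission
  imports Defs
begin

text \<open>
  Let \<open>W\<close> be the number of \<open>m\<close>-subsets of the sample whose kernel value is at most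
  \<open>\<mu> + e\<close>, where \<open>e = t n powr (- 2 m / (m - 1))\<close>. By symmetry of the kernel the event in question
  is \<open>W > 0\<close>, and \<open>W\<close> is approximately Poisson. The generating function \<open>G(s) = E(s ^ W)\<close>
  satisfies \<open>G' = E(W) G\<close> up to an error controlled by the pairs of overlapping subsets, so
  \<open>P(W = 0) = G(0)\<close> is close to \<open>exp (- E(W))\<close>.

  The mean is \<open>n choose m\<close> times the probability that the relative angles of \<open>m\<close> points fall into
  the sublevel set of \<open>h\<close>. These angles have density \<open>shifted_integral p\<close>, and by the second-order
  expansion of \<open>h\<close> the sublevel set is a union of approximate ellipsoids
  \<open>v + sqrt e {z. z \<bullet> (G *v z) \<le> 2}\<close> around the minimum points, which gives the constant \<open>K\<close>.

  For overlapping subsets \<open>a \<noteq> b\<close>, given \<open>a\<close> each of the \<open>k\<close> points of \<open>b - a\<close> must lie within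
  \<open>O(sqrt e)\<close> of finitely many positions relative to a common point. This costs a factor
  \<open>O(sqrt e ^ k)\<close>, whereas there are only \<open>O(n ^ k)\<close> such \<open>b\<close>, and \<open>n sqrt e\<close> tends to \<open>0\<close>.
\<close>

section \<open>Poisson approximation of void probabilities\<close>

text \<open>The exponent \<open>2 m / (m - 1)\<close> is the one that keeps the mean bounded: a
  sublevel set of height \<open>e\<close> has volume of order \<open>e powr ((m - 1) / 2)\<close>,
  and \<open>n ^ m * e powr ((m - 1) / 2)\<close> equals \<open>t powr ((m - 1) / 2)\<close> for
  every positive \<open>n\<close>. For the same \<open>e\<close>, the quantity
  \<open>n * sqrt e\<close> is \<open>sqrt t * n powr (- 1 / (m - 1))\<close>. Overlapping subsets
  are the obstacle: their events are dependent, and the angles of each are measured from its own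
  first point, which need not be shared. Symmetry of the kernel removes both difficulties of
  bookkeeping: events can be indexed by sets instead of increasing tuples, and any shared point can
  be made the origin of the angles. The cut of the circle at angle 0 does no harm: the minimum
  points lie inside the open cube, and its faces carry no mass. Infinite kernel values enter only
  through inequalities \<open>h x \<le> \<mu> + e\<close>, so they need no separate
  treatment.\<close>

lemma approx_exponential_bound:
  fixes G G' :: "real \<Rightarrow> real"
  assumes deriv: "\<And>s. s \<in> {0..1} \<Longrightarrow> (G has_real_derivative G' s) (at s)"
    and bound: "\<And>s. s \<in> {0..1} \<Longrightarrow> \<bar>G' s - l * G s\<bar> \<le> c"
    and "l \<ge> 0" and "G 1 = 1"
  shows "\<bar>G 0 - exp (- l)\<bar> \<le> c"
proof -
  \<comment> \<open>An integrating factor: \<open>G s * exp (- l * s)\<close> has derivative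
    \<open>exp (- l * s) * (G' s - l * G s)\<close>, and the mean value theorem compares its values
    at 0 and 1. Since \<open>l \<ge> 0\<close>, the exponential at \<open>z\<close> is at most
    1.\<close>
  have "\<exists>z::real. z > 0 \<and> z < 1 \<and>
      G 1 * exp (- l * 1) - G 0 * exp (- l * 0) = (1 - 0) * (exp (- l * z) * (G' z - l * G z))"
    by (rule MVT2) (auto intro!: derivative_eq_intros deriv simp: algebra_simps)
  then obtain z where z: "z > 0" "z < 1"
    and eq: "exp (- l) - G 0 = exp (- l * z) * (G' z - l * G z)"
    using assms(4) by auto
  have "\<bar>G 0 - exp (- l)\<bar> = exp (- l * z) * \<bar>G' z - l * G z\<bar>"
    using eq by (metis abs_exp_cancel abs_minus_commute abs_mult)
  also have "\<dots> \<le> 1 * c"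
    using z assms(3) bound[of z] by (intro mult_mono) auto
  finally show ?thesis by simp
qed

text \<open>Bernoulli's inequality for \<open>s ^ k\<close>. It prices a change of the counting
  variable: \<open>k\<close> additional events move \<open>s ^ W\<close> by at most
  \<open>k\<close>, uniformly in \<open>s\<close> down to \<open>s = 0\<close>.\<close>

lemma abs_power_diff_le:
  fixes s :: real
  assumes "0 \<le> s" "s \<le> 1"
  shows "\<bar>s ^ (i + k) - s ^ i\<bar> \<le> real k"
proof -
  have "s ^ k \<ge> 1 - real k * (1 - s)"
    using Bernoulli_inequality[of "s - 1" k] assms by (simp add: algebra_simps)
  moreover have "real k * (1 - s) \<le> real k" using assms by (simp add: mult_left_le)
  moreover have "0 \<le> s ^ k" "s ^ k \<le> 1" using assms by (auto simp: power_le_one)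
  ultimately have "\<bar>s ^ k - 1\<bar> \<le> real k" by auto
  moreover have "0 \<le> s ^ i" "s ^ i \<le> 1" using assms by (auto simp: power_le_one)
  moreover have "s ^ (i + k) - s ^ i = s ^ i * (s ^ k - 1)" by (simp add: power_add algebra_simps)
  ultimately show ?thesis
    by (metis abs_ge_zero abs_mult abs_of_nonneg mult_left_le_one_le order_trans)
qed

context prob_space
begin

text \<open>\<open>N a\<close> is the dependency neighbourhood of \<open>a\<close>. The derivative
  of \<open>E(s ^ W)\<close> is the sum over \<open>a\<close> of the expectations of
  \<open>s ^ (W - 1)\<close> on \<open>E a\<close>. Deleting the events of \<open>N a - {a}\<close>
  from the exponent costs the joint probabilities of the second sum. What is left is independent of
  \<open>E a\<close>, and restoring the events of \<open>N a\<close> in the other factor costs the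
  products of the first sum. These are the two error sums familiar from the Chen-Stein
  method.\<close>

lemma poisson_void_bound:
  fixes E :: "'i \<Rightarrow> 'a set" and N :: "'i \<Rightarrow> 'i set"
  assumes fin: "finite A"
    and meas [measurable]: "\<And>a. a \<in> A \<Longrightarrow> E a \<in> events"
    and N: "\<And>a. a \<in> A \<Longrightarrow> a \<in> N a" "\<And>a. a \<in> A \<Longrightarrow> N a \<subseteq> A"
    and ind: "\<And>a. a \<in> A \<Longrightarrow> indep_var borel (indicat_real (E a))
               borel (\<lambda>\<omega>. \<Sum>b\<in>A - N a. indicat_real (E b) \<omega>)"
  shows "\<bar>prob {\<omega> \<in> space M. \<forall>a\<in>A. \<omega> \<notin> E a} - exp (- (\<Sum>a\<in>A. prob (E a)))\<bar>
    \<le> (\<Sum>a\<in>A. \<Sum>b\<in>N a. prob (E a) * prob (E b)) + (\<Sum>a\<in>A. \<Sum>b\<in>N a - {a}. prob (E a \<inter> E b))"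
proof -
  define X :: "'i \<Rightarrow> 'a \<Rightarrow> nat" where "X = (\<lambda>a. indicator (E a))"
  define W where "W = (\<lambda>B \<omega>. \<Sum>b\<in>B. X b \<omega>)"
  define l where "l = (\<Sum>a\<in>A. prob (E a))"
  have finB: "finite B" if "B \<subseteq> A" for B using that fin finite_subset by auto
  have W_meas [measurable]: "W B \<in> measurable M (count_space UNIV)" if "B \<subseteq> A" for B
  proof -
    have "W B \<in> borel_measurable M"
      unfolding W_def X_def using that
      by (intro borel_measurable_sum borel_measurable_indicator meas) auto
    then show ?thesis
      using measurable_cong_sets[OF refl sets_borel_eq_count_space] by blast
  qed
  have pow_meas [measurable]: "(\<lambda>\<omega>. s ^ W B \<omega>) \<in> borel_measurable M" if "B \<subseteq> A" for B and s :: real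
    using that by measurable
  have W_le: "W B \<omega> \<le> card A" if "B \<subseteq> A" for B \<omega>
  proof -
    have "W B \<omega> \<le> (\<Sum>b\<in>B. 1)" unfolding W_def X_def by (intro sum_mono) (auto simp: indicator_def)
    also have "\<dots> \<le> card A" using that fin by (simp add: card_mono)
    finally show ?thesis .
  qed
  have int_pow: "integrable M (\<lambda>\<omega>. s ^ W B \<omega>)" if "B \<subseteq> A" "0 \<le> s" "s \<le> 1" for B and s :: real
    using that by (intro integrable_const_bound[where B = 1]) (auto simp: power_le_one)
  have int_bdd: "integrable M (\<lambda>\<omega>. indicat_real (E a) \<omega> * s ^ W B \<omega>)"
    if "B \<subseteq> A" "a \<in> A" "0 \<le> s" "s \<le> 1" for a B and s :: real
    using that by (intro integrable_const_bound[where B = 1])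
      (auto simp: power_le_one indicator_def)
  have X_real: "real (W B \<omega>) = (\<Sum>b\<in>B. indicat_real (E b) \<omega>)" for B \<omega>
    unfolding W_def X_def by (auto intro!: sum.cong simp: indicator_def)
  have W_split: "W A \<omega> = W (A - B) \<omega> + W B \<omega>" if "B \<subseteq> A" for B \<omega>
    unfolding W_def using that fin by (simp add: sum.subset_diff)
  define G where "G = (\<lambda>s::real. expectation (\<lambda>\<omega>. s ^ W A \<omega>))"
  define P where "P = (\<lambda>k. prob {\<omega> \<in> space M. W A \<omega> = k})"
  \<comment> \<open>\<open>W A\<close> is bounded by \<open>card A\<close>, so the expectation of
    any function of it is a finite sum. Hence \<open>G\<close> is a polynomial and can be
    differentiated term by term.\<close>
  have expand: "expectation (\<lambda>\<omega>. f (W A \<omega>)) = (\<Sum>k\<le>card A. P k * f k)" for f :: "nat \<Rightarrow> real"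
  proof -
    have "expectation (\<lambda>\<omega>. f (W A \<omega>))
        = expectation (\<lambda>\<omega>. \<Sum>k\<le>card A. indicator {\<omega> \<in> space M. W A \<omega> = k} \<omega> * f k)"
    proof (rule Bochner_Integration.integral_cong)
      fix \<omega> assume "\<omega> \<in> space M"
      then have "(\<Sum>k\<le>card A. indicator {\<omega> \<in> space M. W A \<omega> = k} \<omega> * f k)
          = (\<Sum>k\<le>card A. if W A \<omega> = k then f k else 0)"
        by (auto intro!: sum.cong simp: indicator_def)
      also have "\<dots> = f (W A \<omega>)" using W_le[of A \<omega>] by (simp add: sum.delta')
      finally show "f (W A \<omega>) = (\<Sum>k\<le>card A. indicator {\<omega> \<in> space M. W A \<omega> = k} \<omega> * f k)" by simp
    qed simp
    also have "\<dots> = (\<Sum>k\<le>card A. P k * f k)"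
      unfolding P_def
      by (subst Bochner_Integration.integral_sum)
        (auto intro!: integrable_mult_left integrable_real_indicator simp: emeasure_eq_measure)
    finally show ?thesis .
  qed
  have deriv: "(G has_real_derivative expectation (\<lambda>\<omega>. real (W A \<omega>) * s ^ (W A \<omega> - 1))) (at s)" for s
  proof -
    have "G = (\<lambda>s. \<Sum>k\<le>card A. P k * s ^ k)" unfolding G_def using expand by auto
    then show ?thesis
      unfolding expand[of "\<lambda>k. real k * s ^ (k - 1)"]
      by (auto intro!: derivative_eq_intros sum.cong)
  qed
  have "\<bar>G 0 - exp (- l)\<bar> \<le> (\<Sum>a\<in>A. \<Sum>b\<in>N a. prob (E a) * prob (E b)) + (\<Sum>a\<in>A. \<Sum>b\<in>N a - {a}. prob (E a \<inter> E b))"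
  proof (rule approx_exponential_bound[OF deriv])
    fix s :: real assume "s \<in> {0..1}"
    then have s: "0 \<le> s" "s \<le> 1" by auto
    have *: "expectation (\<lambda>\<omega>. real (W A \<omega>) * s ^ (W A \<omega> - 1))
        = (\<Sum>a\<in>A. expectation (\<lambda>\<omega>. indicator (E a) \<omega> * s ^ W (A - {a}) \<omega>))"
    proof -
      have "expectation (\<lambda>\<omega>. real (W A \<omega>) * s ^ (W A \<omega> - 1))
        = expectation (\<lambda>\<omega>. \<Sum>a\<in>A. indicator (E a) \<omega> * s ^ W (A - {a}) \<omega>)"
      proof (rule Bochner_Integration.integral_cong)
        fix \<omega>
        have "W A \<omega> - 1 = W (A - {a}) \<omega>" if "a \<in> A" "\<omega> \<in> E a" for a
          using W_split[of "{a}" \<omega>] that by (simp add: W_def X_def)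
        then have "indicat_real (E a) \<omega> * s ^ (W A \<omega> - 1) = indicat_real (E a) \<omega> * s ^ W (A - {a}) \<omega>"
          if "a \<in> A" for a using that by (auto simp: indicator_def)
        then show "real (W A \<omega>) * s ^ (W A \<omega> - 1) = (\<Sum>a\<in>A. indicator (E a) \<omega> * s ^ W (A - {a}) \<omega>)"
          unfolding X_real sum_distrib_right by (intro sum.cong) auto
      qed simp
      also have "\<dots> = (\<Sum>a\<in>A. expectation (\<lambda>\<omega>. indicator (E a) \<omega> * s ^ W (A - {a}) \<omega>))"
        using s by (intro Bochner_Integration.integral_sum int_bdd) auto
      finally show ?thesis .
    qed
    have main: "\<bar>expectation (\<lambda>\<omega>. indicator (E a) \<omega> * s ^ W (A - {a}) \<omega>) - prob (E a) * G s\<bar>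
      \<le> (\<Sum>b\<in>N a. prob (E a) * prob (E b)) + (\<Sum>b\<in>N a - {a}. prob (E a \<inter> E b))" if a: "a \<in> A" for a
    proof -
      have Na: "N a \<subseteq> A" "N a - {a} \<subseteq> A" "a \<in> N a" using N a by auto
      \<comment> \<open>The hypothesis concerns a real-valued count;
        \<open>nat \<lfloor>x\<rfloor>\<close> recovers the natural exponent from it.\<close>
      have "indep_var borel (id \<circ> indicat_real (E a))
          borel ((\<lambda>x. s ^ nat \<lfloor>x\<rfloor>) \<circ> (\<lambda>\<omega>. \<Sum>b\<in>A - N a. indicat_real (E b) \<omega>))"
        by (rule indep_var_compose[OF ind[OF a]]) measurable
      then have i: "indep_var borel (indicat_real (E a)) borel (\<lambda>\<omega>. s ^ W (A - N a) \<omega>)"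
        unfolding X_real[symmetric] by (simp add: comp_def)
      have i': "expectation (\<lambda>\<omega>. indicat_real (E a) \<omega> * s ^ W (A - N a) \<omega>)
          = prob (E a) * expectation (\<lambda>\<omega>. s ^ W (A - N a) \<omega>)"
        using a s by (subst indep_var_lebesgue_integral[OF i])
          (auto intro!: int_pow integrable_real_indicator simp: emeasure_eq_measure)
      have le1: "\<bar>G s - expectation (\<lambda>\<omega>. s ^ W (A - N a) \<omega>)\<bar> \<le> (\<Sum>b\<in>N a. prob (E b))"
      proof -
        have "\<bar>G s - expectation (\<lambda>\<omega>. s ^ W (A - N a) \<omega>)\<bar>
            = \<bar>expectation (\<lambda>\<omega>. s ^ W A \<omega> - s ^ W (A - N a) \<omega>)\<bar>"
          unfolding G_def using s by (subst Bochner_Integration.integral_diff) (auto intro!: int_pow)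
        also have "\<dots> \<le> expectation (\<lambda>\<omega>. \<Sum>b\<in>N a. indicat_real (E b) \<omega>)"
        proof (rule integral_abs_bound[THEN order_trans], rule integral_mono)
          show "integrable M (\<lambda>\<omega>. \<bar>s ^ W A \<omega> - s ^ W (A - N a) \<omega>\<bar>)"
            using s by (intro integrable_abs Bochner_Integration.integrable_diff int_pow) auto
          show "integrable M (\<lambda>\<omega>. \<Sum>b\<in>N a. indicat_real (E b) \<omega>)"
            using Na by (intro Bochner_Integration.integrable_sum integrable_real_indicator)
              (auto simp: emeasure_eq_measure)
          show "\<bar>s ^ W A \<omega> - s ^ W (A - N a) \<omega>\<bar> \<le> (\<Sum>b\<in>N a. indicat_real (E b) \<omega>)" for \<omega>
            unfolding W_split[OF Na(1)] X_real[symmetric] by (rule abs_power_diff_le[OF s])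
        qed
        also have "\<dots> = (\<Sum>b\<in>N a. prob (E b))"
          using Na by (subst Bochner_Integration.integral_sum)
            (auto intro!: integrable_real_indicator sum.cong simp: emeasure_eq_measure subset_iff)
        finally show ?thesis .
      qed
      have le2: "\<bar>expectation (\<lambda>\<omega>. indicator (E a) \<omega> * s ^ W (A - {a}) \<omega>)
          - expectation (\<lambda>\<omega>. indicat_real (E a) \<omega> * s ^ W (A - N a) \<omega>)\<bar> \<le> (\<Sum>b\<in>N a - {a}. prob (E a \<inter> E b))"
      proof -
        have eq: "W (A - {a}) \<omega> = W (A - N a) \<omega> + W (N a - {a}) \<omega>" for \<omega>
        proof -
          have "A - {a} = (A - N a) \<union> (N a - {a})" using Na by auto
          then show ?thesis unfolding W_def
            using sum.union_disjoint[OF finB[of "A - N a"] finB[OF Na(2)]] by auto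
        qed
        have "\<bar>expectation (\<lambda>\<omega>. indicator (E a) \<omega> * s ^ W (A - {a}) \<omega>)
          - expectation (\<lambda>\<omega>. indicat_real (E a) \<omega> * s ^ W (A - N a) \<omega>)\<bar>
          = \<bar>expectation (\<lambda>\<omega>. indicator (E a) \<omega> * s ^ W (A - {a}) \<omega> - indicat_real (E a) \<omega> * s ^ W (A - N a) \<omega>)\<bar>"
          using s a by (subst Bochner_Integration.integral_diff) (auto intro!: int_bdd)
        also have "\<dots> \<le> expectation (\<lambda>\<omega>. \<Sum>b\<in>N a - {a}. indicat_real (E a \<inter> E b) \<omega>)"
        proof (rule integral_abs_bound[THEN order_trans], rule integral_mono)
          show "integrable M (\<lambda>\<omega>. \<bar>indicator (E a) \<omega> * s ^ W (A - {a}) \<omega> - indicat_real (E a) \<omega> * s ^ W (A - N a) \<omega>\<bar>)"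
            using s a by (intro integrable_abs Bochner_Integration.integrable_diff int_bdd) auto
          show "integrable M (\<lambda>\<omega>. \<Sum>b\<in>N a - {a}. indicat_real (E a \<inter> E b) \<omega>)"
            using Na a by (intro Bochner_Integration.integrable_sum integrable_real_indicator)
              (auto simp: emeasure_eq_measure)
          show "\<bar>indicator (E a) \<omega> * s ^ W (A - {a}) \<omega> - indicat_real (E a) \<omega> * s ^ W (A - N a) \<omega>\<bar>
            \<le> (\<Sum>b\<in>N a - {a}. indicat_real (E a \<inter> E b) \<omega>)" for \<omega>
          proof (cases "\<omega> \<in> E a")
            case True
            then have "(\<Sum>b\<in>N a - {a}. indicat_real (E a \<inter> E b) \<omega>) = real (W (N a - {a}) \<omega>)"
              unfolding X_real by (intro sum.cong) (auto simp: indicator_def)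
            with True show ?thesis using abs_power_diff_le[OF s] by (simp add: eq)
          qed (simp add: sum_nonneg)
        qed
        also have "\<dots> = (\<Sum>b\<in>N a - {a}. prob (E a \<inter> E b))"
          using Na a by (subst Bochner_Integration.integral_sum)
            (auto intro!: integrable_real_indicator sum.cong simp: emeasure_eq_measure subset_iff)
        finally show ?thesis .
      qed
      have "\<bar>prob (E a) * expectation (\<lambda>\<omega>. s ^ W (A - N a) \<omega>) - prob (E a) * G s\<bar> 
          \<le> prob (E a) * (\<Sum>b\<in>N a. prob (E b))"
        using le1 by (simp add: right_diff_distrib[symmetric] abs_mult mult_left_mono abs_minus_commute)
      then show ?thesis using le2 i' by (simp add: sum_distrib_left)
    qed
    have "\<bar>(\<Sum>a\<in>A. expectation (\<lambda>\<omega>. indicator (E a) \<omega> * s ^ W (A - {a}) \<omega>)) - l * G s\<bar>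
      \<le> (\<Sum>a\<in>A. \<bar>expectation (\<lambda>\<omega>. indicator (E a) \<omega> * s ^ W (A - {a}) \<omega>) - prob (E a) * G s\<bar>)"
      unfolding l_def sum_distrib_right sum_subtractf[symmetric] by (rule sum_abs)
    also have "\<dots> \<le> (\<Sum>a\<in>A. (\<Sum>b\<in>N a. prob (E a) * prob (E b)) + (\<Sum>b\<in>N a - {a}. prob (E a \<inter> E b)))"
      by (intro sum_mono main)
    finally show "\<bar>expectation (\<lambda>\<omega>. real (W A \<omega>) * s ^ (W A \<omega> - 1)) - l * G s\<bar>
      \<le> (\<Sum>a\<in>A. \<Sum>b\<in>N a. prob (E a) * prob (E b)) + (\<Sum>a\<in>A. \<Sum>b\<in>N a - {a}. prob (E a \<inter> E b))"
      unfolding * by (simp add: sum.distrib)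
  qed (auto simp: l_def G_def sum_nonneg prob_space)
  \<comment> \<open>Because \<open>0 ^ 0 = 1\<close>, the variable \<open>0 ^ W A\<close> is the
    indicator of the outcome that no event occurs.\<close>
  moreover have "G 0 = prob {\<omega> \<in> space M. \<forall>a\<in>A. \<omega> \<notin> E a}"
  proof -
    have "G 0 = expectation (indicator {\<omega> \<in> space M. \<forall>a\<in>A. \<omega> \<notin> E a})"
      unfolding G_def
    proof (rule Bochner_Integration.integral_cong)
      fix \<omega> assume "\<omega> \<in> space M"
      then show "0 ^ W A \<omega> = indicat_real {\<omega> \<in> space M. \<forall>a\<in>A. \<omega> \<notin> E a} \<omega>"
        using fin by (auto simp: W_def X_def indicator_def power_0_left split: if_splits)
    qed simp
    then show ?thesis using fin by simp
  qed
  ultimately show ?thesis unfolding l_def by simp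
qed

end

section \<open>Quadratic forms and ellipsoids\<close>

lemma symmetric_matrix_inner:
  fixes G :: "real^'n^'n"
  assumes "transpose G = G"
  shows "x \<bullet> (G *v y) = y \<bullet> (G *v x)"
  by (metis assms dot_lmul_matrix inner_commute transpose_matrix_vector)

text \<open>A semidefinite form that vanishes at \<open>y\<close> is minimal there, so its gradient,
  a multiple of \<open>G *v y\<close>, must vanish, against nonsingularity. The computation makes
  this explicit by moving from \<open>y\<close> along \<open>z = G *v y\<close>.\<close>

lemma psd_nonsingular_pos:
  fixes G :: "real^'n^'n"
  assumes sym: "transpose G = G" and psd: "\<And>y. 0 \<le> y \<bullet> (G *v y)"
    and det: "det G \<noteq> 0" and "y \<noteq> 0"
  shows "0 < y \<bullet> (G *v y)"
proof (rule ccontr)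
  assume "\<not> 0 < y \<bullet> (G *v y)"
  with psd[of y] have y0: "y \<bullet> (G *v y) = 0" by simp
  define z a b where "z = G *v y" and "a = z \<bullet> z" and "b = z \<bullet> (G *v z)"
  have "invertible G" using det by (simp add: invertible_det_nz)
  then have "z \<noteq> 0" using \<open>y \<noteq> 0\<close> unfolding z_def
    by (metis invertible_def matrix_vector_mul_assoc matrix_vector_mul_lid matrix_vector_mult_0_right)
  then have a: "a > 0" by (simp add: a_def)
  have b: "b \<ge> 0" using psd by (simp add: b_def)
  \<comment> \<open>Any small negative multiple of \<open>z\<close> makes the linear term win;
    \<open>b + 1\<close> instead of \<open>b\<close> keeps the denominator positive when
    \<open>b = 0\<close>.\<close>
  define s where "s = - a / (b + 1)"
  have "0 \<le> (y + s *\<^sub>R z) \<bullet> (G *v (y + s *\<^sub>R z))" by (rule psd)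
  also have "\<dots> = 2 * s * a + s\<^sup>2 * b"
    using y0 symmetric_matrix_inner[OF sym, of y z]
    by (simp add: matrix_vector_right_distrib matrix_vector_mult_scaleR inner_add_left inner_add_right
        a_def b_def power2_eq_square algebra_simps flip: z_def)
  also have "\<dots> = (a\<^sup>2 / (b + 1)\<^sup>2) * (- b - 2)"
    using b by (simp add: s_def power2_eq_square divide_simps) (simp add: algebra_simps)
  also have "\<dots> < 0" using a b by (intro mult_pos_neg) auto
  finally show False by simp
qed

text \<open>Gram-Schmidt for the inner product \<open>x \<bullet> (G *v y)\<close>. Fewer than
  \<open>CARD('n)\<close> vectors do not span, so some vector lies outside their span, and
  subtracting its components along \<open>S\<close> leaves a nonzero remainder to normalise.\<close>

lemma ex_form_orthonormal_set:
  fixes G :: "real^'n^'n"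
  assumes sym: "transpose G = G" and pos: "\<And>y. y \<noteq> 0 \<Longrightarrow> 0 < y \<bullet> (G *v y)"
  assumes "k \<le> CARD('n)"
  shows "\<exists>S. finite S \<and> card S = k \<and>
    (\<forall>x\<in>S. \<forall>y\<in>S. x \<bullet> (G *v y) = (if x = y then 1 else 0))"
  using assms(3)
proof (induction k)
  case 0
  then show ?case by (intro exI[of _ "{}"]) auto
next
  case (Suc k)
  then obtain S where S: "finite S" "card S = k"
    and orth: "\<And>x y. x \<in> S \<Longrightarrow> y \<in> S \<Longrightarrow> x \<bullet> (G *v y) = (if x = y then 1 else 0)"
    by auto
  have "dim (span S) < CARD('n)"
    using Suc.prems S dim_le_card'[OF S(1)] by simp
  moreover have "dim (UNIV :: (real^'n) set) = CARD('n)" by simp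
  ultimately have "dim (span S) \<noteq> dim (UNIV :: (real^'n) set)" by linarith
  then have "span S \<noteq> UNIV" by (metis (no_types))
  then obtain x where x: "x \<notin> span S" by auto
  define y where "y = x - (\<Sum>b\<in>S. (b \<bullet> (G *v x)) *\<^sub>R b)"
  have "(\<Sum>b\<in>S. (b \<bullet> (G *v x)) *\<^sub>R b) \<in> span S" by (intro span_sum span_mul span_base)
  then have "y \<noteq> 0" using x by (metis eq_iff_diff_eq_0 y_def)
  have by0: "b \<bullet> (G *v y) = 0" if "b \<in> S" for b
  proof -
    have "b \<bullet> (G *v y) = b \<bullet> (G *v x) - (\<Sum>c\<in>S. (c \<bullet> (G *v x)) * (b \<bullet> (G *v c)))"
      unfolding y_def by (simp add: matrix_vector_mult_diff_distrib inner_diff_right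
          linear_sum[OF matrix_vector_mul_linear] matrix_vector_mult_scaleR inner_sum_right)
    also have "(\<Sum>c\<in>S. (c \<bullet> (G *v x)) * (b \<bullet> (G *v c))) = (\<Sum>c\<in>S. if c = b then b \<bullet> (G *v x) else 0)"
      using that by (intro sum.cong) (auto simp: orth)
    finally show ?thesis using S that by simp
  qed
  define z where "z = (1 / sqrt (y \<bullet> (G *v y))) *\<^sub>R y"
  have zz: "z \<bullet> (G *v z) = 1"
    using pos[OF \<open>y \<noteq> 0\<close>] by (simp add: z_def matrix_vector_mult_scaleR)
  have bz: "b \<bullet> (G *v z) = 0" "z \<bullet> (G *v b) = 0" if "b \<in> S" for b
  proof -
    show "b \<bullet> (G *v z) = 0" using by0[OF that] by (simp add: z_def matrix_vector_mult_scaleR)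
    then show "z \<bullet> (G *v b) = 0" using symmetric_matrix_inner[OF sym] by metis
  qed
  then have "z \<notin> S" using zz by auto
  then show ?case using S zz bz orth by (intro exI[of _ "insert z S"]) auto
qed

text \<open>The columns of \<open>M\<close> form a basis orthonormal for the form, and the entries
  of the triple product are the inner products of these columns.\<close>

lemma ex_congruence_to_identity:
  fixes G :: "real^'n^'n"
  assumes sym: "transpose G = G" and pos: "\<And>y. y \<noteq> 0 \<Longrightarrow> 0 < y \<bullet> (G *v y)"
  obtains M :: "real^'n^'n" where "transpose M ** G ** M = mat 1"
proof -
  obtain S where S: "finite S" "card S = CARD('n)"
    and orth: "\<And>x y. x \<in> S \<Longrightarrow> y \<in> S \<Longrightarrow> x \<bullet> (G *v y) = (if x = y then 1 else 0)"
    using ex_form_orthonormal_set[OF assms, of "CARD('n)"] by auto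
  obtain e where e: "bij_betw e (UNIV :: 'n set) S"
    using S by (metis finite_same_card_bij finite_code)
  define M :: "real^'n^'n" where "M = (\<chi> i j. e j $ i)"
  have col: "column j M = e j" for j by (simp add: M_def column_def vec_eq_iff)
  have "(transpose M ** G ** M) $ i $ j = e i \<bullet> (G *v e j)" for i j
  proof -
    have "(transpose M ** G ** M) $ i $ j = (transpose M ** (G ** M)) $ i $ j"
      by (simp add: matrix_mul_assoc)
    also have "\<dots> = row i (transpose M) \<bullet> column j (G ** M)"
      by (simp add: matrix_matrix_mult_def row_def column_def inner_vec_def)
    also have "column j (G ** M) = G *v column j M"
      by (simp add: column_def matrix_matrix_mult_def matrix_vector_mult_def)
    finally show ?thesis by (simp add: row_transpose col)
  qed
  moreover have "e i \<bullet> (G *v e j) = (if i = j then 1 else 0)" for i j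
    using orth[of "e i" "e j"] e by (simp add: bij_betw_apply inj_eq bij_betw_def)
  ultimately have "transpose M ** G ** M = mat 1"
    by (auto simp: vec_eq_iff mat_def)
  then show thesis by (rule that)
qed

text \<open>The library states this only for index types of class \<open>wellorder\<close>.\<close>

proposition
  fixes f :: "real^'n \<Rightarrow> real^'n"
  assumes "linear f" "S \<in> lmeasurable"
  shows lmeasurable_linear_image: "f ` S \<in> lmeasurable"
    and measure_lebesgue_linear_image: "measure lebesgue (f ` S) = \<bar>det (matrix f)\<bar> * measure lebesgue S"
proof -
  define P :: "(real^'n \<Rightarrow> real^'n) \<Rightarrow> bool" where "P = (\<lambda>f. \<forall>S\<in>lmeasurable. f ` S \<in> lmeasurable \<and>
    measure lebesgue (f ` S) = \<bar>det (matrix f)\<bar> * measure lebesgue S)"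
  have preserve: "P h" if lin: "linear h" and det: "\<bar>det (matrix h)\<bar> = 1"
    and box: "\<And>a b. measure lebesgue (h ` cbox a b) = measure lebesgue (cbox a b)" for h
    unfolding P_def det mult_1
  proof
    fix S :: "(real^'n) set" assume S: "S \<in> lmeasurable"
    have "measure lebesgue (h ` cbox a b) = 1 * measure lebesgue (cbox a b)" for a b
      by (simp only: box mult_1)
    from measure_linear_sufficient[OF lin S this]
    show "h ` S \<in> lmeasurable \<and> measure lebesgue (h ` S) = measure lebesgue S"
      by (simp only: mult_1 simp_thms)
  qed
  \<comment> \<open>Every linear map is composed of maps with a vanishing coordinate, diagonal
    scalings, coordinate swaps and shears. The volume formula is stable under composition because
    determinants multiply.\<close>
  have "P f"
  proof (rule induct_linear_elementary[OF assms(1)])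
    fix f g assume lin: "linear f" "linear g" and "P f" "P g"
    then show "P (f \<circ> g)"
      unfolding P_def image_comp[symmetric] matrix_compose[OF lin(2,1)] det_mul by (auto simp: abs_mult)
  next
    fix f :: "real^'n \<Rightarrow> real^'n" and i
    assume lin: "linear f" and 0: "\<And>x. f x $ i = 0"
    have "f x \<noteq> axis i 1" for x using 0[of x] by auto
    then have "\<not> surj f" by (metis surjE)
    then have ninj: "\<not> inj f" using lin linear_injective_imp_surjective by blast
    then have "det (matrix f) = 0" using det_nz_iff_inj[OF lin] by blast
    moreover have "negligible (f ` S)" for S
      by (rule negligible_linear_singular_image[OF lin ninj])
    ultimately show "P f" by (simp add: P_def negligible_iff_measure)
  next
    fix c :: "'n \<Rightarrow> real"
    have "matrix (\<lambda>x. \<chi> i. c i * x $ i) = (\<chi> i j. if i = j then c i else 0)"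
      by (simp add: matrix_def axis_def vec_eq_iff)
    then have "det (matrix (\<lambda>x. \<chi> i. c i * x $ i)) = prod c UNIV" by (simp add: det_diagonal)
    then show "P (\<lambda>x. \<chi> i. c i * x $ i)"
      by (simp add: P_def measurable_stretch measure_stretch)
  next
    fix m n :: 'n assume "m \<noteq> n"
    define h where "h = (\<lambda>x :: real^'n. \<chi> i. x $ Transposition.transpose m n i)"
    have lin: "linear h" by (rule linearI) (simp_all add: h_def vec_eq_iff)
    have hh: "h (h x) = x" for x by (simp add: h_def vec_eq_iff)
    then have "matrix h ** matrix h = mat 1"
      using matrix_compose[OF lin lin] by (simp add: comp_def matrix_id_mat_1[unfolded id_def])
    then have "det (matrix h) * det (matrix h) = 1" by (metis det_I det_mul)
    then have "\<bar>det (matrix h)\<bar> = 1" by (metis abs_mult_self_eq abs_square_eq_1 power2_eq_square)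
    moreover have "measure lebesgue (h ` cbox a b) = measure lebesgue (cbox a b)" for a b
    proof -
      have bij: "bij (Transposition.transpose m n)" by simp
      have "h ` cbox a b = {x. h x \<in> cbox a b}" using hh by (auto simp: image_iff) metis
      also have "\<dots> = cbox (h a) (h b)"
      proof (intro set_eqI iffI; simp add: mem_box_cart h_def; intro allI)
        fix x i assume *: "\<forall>i. a $ i \<le> x $ Transposition.transpose m n i \<and> x $ Transposition.transpose m n i \<le> b $ i"
        show "a $ Transposition.transpose m n i \<le> x $ i \<and> x $ i \<le> b $ Transposition.transpose m n i"
          using *[rule_format, of "Transposition.transpose m n i"] by simp
      next
        fix x i assume *: "\<forall>i. a $ Transposition.transpose m n i \<le> x $ i \<and> x $ i \<le> b $ Transposition.transpose m n i"
        show "a $ i \<le> x $ Transposition.transpose m n i \<and> x $ Transposition.transpose m n i \<le> b $ i"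
          using *[rule_format, of "Transposition.transpose m n i"] by simp
      qed
      finally have eq: "h ` cbox a b = cbox (h a) (h b)" .
      show ?thesis
      proof (cases "cbox a b = {}")
        case False
        then have "cbox (h a) (h b) \<noteq> {}" by (simp add: eq[symmetric])
        with False show ?thesis
          unfolding eq using prod.reindex_bij_betw[OF bij, of "\<lambda>i. b $ i - a $ i"]
          by (simp add: content_cbox_cart h_def)
      qed simp
    qed
    ultimately have "P h" using lin by (intro preserve)
    then show "P (\<lambda>x. \<chi> i. x $ Transposition.transpose m n i)" by (simp add: h_def)
  next
    fix m n :: 'n assume mn: "m \<noteq> n"
    define h where "h = (\<lambda>x :: real^'n. \<chi> i. if i = m then x $ m + x $ n else x $ i)"
    have lin: "linear h" by (rule linearI) (auto simp: h_def vec_eq_iff algebra_simps)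
    have "matrix h = (\<chi> k. if k = m then row m (mat 1) + 1 *s row n (mat 1) else row k (mat 1))"
      by (auto simp: matrix_def h_def vec_eq_iff row_def mat_def axis_def)
    then have "det (matrix h) = 1" using det_row_operation[OF mn, of "mat 1" 1] by simp
    moreover have "measure lebesgue (h ` cbox a b) = measure lebesgue (cbox a b)" for a b
    proof (cases "cbox a b = {}")
      case False
      \<comment> \<open>\<open>measure_shear_interval\<close> wants a box whose lower
        \<open>n\<close>-th coordinate is nonnegative. Translating by \<open>w\<close> makes it 0,
        and by linearity the image is merely translated as well.\<close>
      define w where "w = a $ n *\<^sub>R axis n (1::real)"
      have cb: "cbox a b = (+) w ` cbox (a - w) (b - w)"
        using cbox_translation[of w "a - w" "b - w"] by simp
      then have ne: "cbox (a - w) (b - w) \<noteq> {}" using False by auto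
      have "h ` cbox a b = (+) (h w) ` (h ` cbox (a - w) (b - w))"
        unfolding cb image_image by (simp add: linear_add[OF lin])
      then have "measure lebesgue (h ` cbox a b) = measure lebesgue (h ` cbox (a - w) (b - w))"
        by (simp add: measure_translation)
      also have "\<dots> = measure lebesgue (cbox (a - w) (b - w))"
        unfolding h_def by (rule measure_shear_interval[OF mn ne]) (simp add: w_def)
      also have "\<dots> = measure lebesgue (cbox a b)"
        unfolding cb by (simp only: measure_translation)
      finally show ?thesis .
    qed simp
    ultimately have "P h" using lin by (intro preserve) auto
    then show "P (\<lambda>x. \<chi> i. if i = m then x $ m + x $ n else x $ i)" by (simp add: h_def)
  qed
  with assms(2) show "f ` S \<in> lmeasurable"
    "measure lebesgue (f ` S) = \<bar>det (matrix f)\<bar> * measure lebesgue S"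
    by (auto simp: P_def)
qed

text \<open>The ellipsoid is the image of a ball under the matrix that turns the form into the
  identity.\<close>

lemma
  fixes G :: "real^'n^'n"
  assumes sym: "transpose G = G" and pos: "\<And>y. y \<noteq> 0 \<Longrightarrow> 0 < y \<bullet> (G *v y)"
  shows measure_ellipsoid: "measure lborel {z. z \<bullet> (G *v z) \<le> 2}
      = (2 * pi) powr (CARD('n) / 2) / Gamma (CARD('n) / 2 + 1) / sqrt (det G)"
    and emeasure_ellipsoid_boundary: "emeasure lborel {z. z \<bullet> (G *v z) = 2} = 0"
proof -
  obtain M :: "real^'n^'n" where M: "transpose M ** G ** M = mat 1"
    using ex_congruence_to_identity[OF assms] .
  have "det (transpose M ** G ** M) = 1" by (simp add: M)
  \<comment> \<open>This identity yields both \<open>det G > 0\<close> and the value of the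
    Jacobian, \<open>1 / sqrt (det G)\<close>.\<close>
  then have detM: "(det M)\<^sup>2 * det G = 1" by (simp add: det_mul det_transpose power2_eq_square mult_ac)
  then have "det M \<noteq> 0" by auto
  then have detG: "det G > 0"
    by (metis detM zero_less_mult_pos zero_less_one zero_less_power2)
  have "\<bar>det M\<bar> * sqrt (det G) = sqrt ((det M)\<^sup>2 * det G)" by (simp add: real_sqrt_mult)
  then have "\<bar>det M\<bar> * sqrt (det G) = 1" by (simp add: detM)
  then have absM: "\<bar>det M\<bar> = 1 / sqrt (det G)"
    using detG by (simp add: field_simps)
  have form: "(M *v w) \<bullet> (G *v (M *v w)) = w \<bullet> w" for w
  proof -
    have "(M *v w) \<bullet> (G *v (M *v w)) = w \<bullet> ((transpose M ** G ** M) *v w)"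
      by (metis dot_lmul_matrix matrix_vector_mul_assoc transpose_matrix_vector transpose_transpose)
    then show ?thesis by (simp add: M)
  qed
  have "invertible M" using \<open>det M \<noteq> 0\<close> by (simp add: invertible_det_nz)
  then have surj: "\<exists>w. z = M *v w" for z
    by (metis invertible_def matrix_vector_mul_assoc matrix_vector_mul_lid)
  have ell: "{z. P (z \<bullet> (G *v z))} = (*v) M ` {w. P (w \<bullet> w)}" for P
    using surj form by (auto simp: image_iff) metis
  have cont: "continuous_on UNIV (\<lambda>z. z \<bullet> (G *v z))"
    by (intro continuous_on_inner continuous_on_id matrix_vector_mult_linear_continuous_on)
  have meas_ell: "{z. z \<bullet> (G *v z) \<le> 2} \<in> sets borel" "{z. z \<bullet> (G *v z) = 2} \<in> sets borel"
    by (intro borel_closed closed_Collect_le closed_Collect_eq cont continuous_on_const)+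
  \<comment> \<open>In the new coordinates the form is \<open>w \<bullet> w\<close>. The level 2
    reflects the factor 1/2 of the Taylor expansion, and the resulting radius \<open>sqrt 2\<close>
    turns the \<open>pi\<close> of the ball volume into the \<open>2 * pi\<close> of the
    constant.\<close>
  have cb: "{w :: real^'n. w \<bullet> w \<le> 2} = cball 0 (sqrt 2)"
    and sp: "{w :: real^'n. w \<bullet> w = 2} = sphere 0 (sqrt 2)"
    by (auto simp: norm_eq_sqrt_inner)
  have "measure lborel {z. z \<bullet> (G *v z) \<le> 2} = measure lebesgue {z. z \<bullet> (G *v z) \<le> 2}"
    using meas_ell(1) by (intro measure_completion[symmetric]) simp
  also have "\<dots> = \<bar>det M\<bar> * measure lebesgue (cball (0::real^'n) (sqrt 2))"
    unfolding ell[of "\<lambda>x. x \<le> 2"] cb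
    by (subst measure_lebesgue_linear_image) (auto simp: matrix_vector_mul_linear)
  also have "measure lebesgue (cball (0::real^'n) (sqrt 2)) = unit_ball_vol CARD('n) * sqrt 2 ^ CARD('n)"
    by (subst measure_completion) (simp_all add: content_cball)
  also have "sqrt 2 ^ CARD('n) = 2 powr (CARD('n) / 2)"
    by (simp add: powr_half_sqrt[symmetric] powr_powr flip: powr_realpow)
  also have "\<bar>det M\<bar> * (unit_ball_vol CARD('n) * 2 powr (CARD('n) / 2))
     = (2 * pi) powr (CARD('n) / 2) / Gamma (CARD('n) / 2 + 1) / sqrt (det G)"
    unfolding absM by (simp add: unit_ball_vol_def powr_mult mult.commute)
  finally show "measure lborel {z. z \<bullet> (G *v z) \<le> 2}
      = (2 * pi) powr (CARD('n) / 2) / Gamma (CARD('n) / 2 + 1) / sqrt (det G)" .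
  \<comment> \<open>A sphere is the frontier of a convex set, hence null, and by the volume formula
    its linear image is null too.\<close>
  have "negligible (sphere (0::real^'n) (sqrt 2))"
    using negligible_convex_frontier[OF convex_cball[of "0::real^'n" "sqrt 2"]] by simp
  then have "sphere (0::real^'n) (sqrt 2) \<in> lmeasurable" "measure lebesgue (sphere (0::real^'n) (sqrt 2)) = 0"
    by (auto simp: negligible_iff_measure)
  then have "{z. z \<bullet> (G *v z) = 2} \<in> lmeasurable" "measure lebesgue {z. z \<bullet> (G *v z) = 2} = 0"
    unfolding ell[of "\<lambda>x. x = 2"] sp
    by (auto simp: lmeasurable_linear_image measure_lebesgue_linear_image matrix_vector_mul_linear)
  then have "negligible {z. z \<bullet> (G *v z) = 2}" by (simp add: negligible_iff_measure)
  then show "emeasure lborel {z. z \<bullet> (G *v z) = 2} = 0"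
    using meas_ell by (auto simp: negligible_iff_null_sets null_sets_def)
qed

section \<open>Second-order expansion at a minimum\<close>

lemma has_derivative_partial_deriv:
  fixes g :: "real^'n \<Rightarrow> real"
  assumes "g differentiable (at x)"
  shows "(g has_derivative (\<lambda>y. \<Sum>i\<in>UNIV. y $ i * partial_deriv i g x)) (at x)"
proof -
  obtain g' where g': "(g has_derivative g') (at x)" using assms by (auto simp: differentiable_def)
  then have lin: "linear g'" using has_derivative_linear by blast
  have partial: "partial_deriv i g x = g' (axis i 1)" for i
  proof -
    have "((\<lambda>t. x + t *\<^sub>R axis i 1) has_derivative (\<lambda>t. t *\<^sub>R axis i 1)) (at 0)"
      by (auto intro!: derivative_eq_intros)
    then have "((\<lambda>t. g (x + t *\<^sub>R axis i 1)) has_derivative (\<lambda>t. g' (t *\<^sub>R axis i 1))) (at 0)"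
      by (rule has_derivative_compose) (simp add: g')
    then have "((\<lambda>t. g (x + t *\<^sub>R axis i 1)) has_real_derivative g' (axis i 1)) (at 0)"
      by (simp add: has_field_derivative_def linear_scale[OF lin] mult_commute_abs)
    then show ?thesis unfolding partial_deriv_def by (rule DERIV_imp_deriv)
  qed
  have "g' y = (\<Sum>i\<in>UNIV. y $ i * partial_deriv i g x)" for y
  proof -
    have "g' y = g' (\<Sum>i\<in>UNIV. y $ i *s axis i 1)" by (simp only: basis_expansion)
    also have "\<dots> = (\<Sum>i\<in>UNIV. y $ i * g' (axis i 1))"
      by (simp add: linear_sum[OF lin] linear_scale[OF lin] scalar_mult_eq_scaleR)
    finally show ?thesis by (simp add: partial)
  qed
  then have "g' = (\<lambda>y. \<Sum>i\<in>UNIV. y $ i * partial_deriv i g x)" by auto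
  with g' show ?thesis by simp
qed

lemma line_has_derivative:
  fixes g :: "real^'n \<Rightarrow> real"
  assumes "g differentiable_on S" "open S" "x + t *\<^sub>R y \<in> S"
  shows "((\<lambda>t. g (x + t *\<^sub>R y)) has_real_derivative
    (\<Sum>i\<in>UNIV. y $ i * partial_deriv i g (x + t *\<^sub>R y))) (at t)"
proof -
  have "g differentiable (at (x + t *\<^sub>R y))"
    using assms by (metis at_within_open differentiable_on_def)
  note D = has_derivative_partial_deriv[OF this]
  have "((\<lambda>t. x + t *\<^sub>R y) has_derivative (\<lambda>t. t *\<^sub>R y)) (at t)"
    by (auto intro!: derivative_eq_intros)
  note has_derivative_compose[OF this D]
  moreover have "(\<lambda>a. \<Sum>i\<in>UNIV. (a *\<^sub>R y) $ i * partial_deriv i g (x + t *\<^sub>R y))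
      = (*) (\<Sum>i\<in>UNIV. y $ i * partial_deriv i g (x + t *\<^sub>R y))"
    by (simp add: fun_eq_iff sum_distrib_left mult_ac)
  ultimately show ?thesis by (simp add: has_field_derivative_def)
qed

lemma axis_line_has_derivative:
  fixes g :: "real^'n \<Rightarrow> real"
  assumes "g differentiable_on S" "open S" "x + t *\<^sub>R axis i 1 \<in> S"
  shows "((\<lambda>t. g (x + t *\<^sub>R axis i 1)) has_real_derivative
    partial_deriv i g (x + t *\<^sub>R axis i 1)) (at t)"
proof -
  have "(\<Sum>k\<in>UNIV. axis i (1::real) $ k * c k) = c i" for c :: "'n \<Rightarrow> real"
    by (simp add: axis_def if_distrib[of "\<lambda>x. x * _"] cong: if_cong)
  then show ?thesis using line_has_derivative[OF assms] by simp
qed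

lemma cont_diff_on_2:
  fixes g :: "real^'n \<Rightarrow> real"
  assumes "cont_diff_on 3 g S"
  shows "g differentiable_on S" "\<And>i. partial_deriv i g differentiable_on S"
    "\<And>i j. continuous_on S (partial_deriv i (partial_deriv j g))"
  using assms by (auto simp: numeral_3_eq_3 intro: differentiable_imp_continuous_on)

text \<open>The mean value theorem applies twice: in direction \<open>i\<close> to the difference
  taken in direction \<open>j\<close>, then in direction \<open>j\<close> to the partial derivative.
  The double difference is symmetric in \<open>i\<close> and \<open>j\<close>, which makes it a
  bridge between the two mixed derivatives.\<close>

lemma double_difference_eq_partial_deriv:
  fixes g :: "real^'n \<Rightarrow> real"
  assumes d1: "g differentiable_on ball v r" and d2: "partial_deriv i g differentiable_on ball v r"
    and s: "0 < s" "2 * s < r"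
  shows "\<exists>x. dist v x < 2 * s \<and>
    g (v + s *\<^sub>R axis i 1 + s *\<^sub>R axis j 1) - g (v + s *\<^sub>R axis i 1) - g (v + s *\<^sub>R axis j 1) + g v
    = s\<^sup>2 * partial_deriv j (partial_deriv i g) x"
proof -
  \<comment> \<open>The displacement has length at most \<open>a + b\<close>, so only the corner
    \<open>a = b = s\<close> can reach distance \<open>2 * s\<close>, and for \<open>i = j\<close>
    it does. The mean value points stay strictly inside.\<close>
  have near: "dist v (v + a *\<^sub>R axis i 1 + b *\<^sub>R axis j 1) < 2 * s \<or> (a = s \<and> b = s)"
    and in_ball: "v + a *\<^sub>R axis i 1 + b *\<^sub>R axis j 1 \<in> ball v r" 
    if "0 \<le> a" "a \<le> s" "0 \<le> b" "b \<le> s" for a b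
  proof -
    have "dist v (v + a *\<^sub>R axis i 1 + b *\<^sub>R axis j 1) \<le> a + b"
      using norm_triangle_ineq[of "a *\<^sub>R axis i (1::real)" "b *\<^sub>R axis j 1"] that
      by (subst dist_commute) (simp add: dist_norm add.assoc norm_axis_1)
    with that s show "dist v (v + a *\<^sub>R axis i 1 + b *\<^sub>R axis j 1) < 2 * s \<or> (a = s \<and> b = s)"
      "v + a *\<^sub>R axis i 1 + b *\<^sub>R axis j 1 \<in> ball v r" by auto
  qed
  have *: "v + a *\<^sub>R axis i 1 + b *\<^sub>R axis j 1 = (v + b *\<^sub>R axis j 1) + a *\<^sub>R axis i 1" for a b
    by simp
  define F where "F = (\<lambda>a. g (v + s *\<^sub>R axis j 1 + a *\<^sub>R axis i 1) - g (v + a *\<^sub>R axis i 1))"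
  have "\<exists>a>0. a < s \<and> F s - F 0 = (s - 0) *
      (partial_deriv i g (v + s *\<^sub>R axis j 1 + a *\<^sub>R axis i 1) - partial_deriv i g (v + a *\<^sub>R axis i 1))"
    unfolding F_def using s in_ball[of _ 0] in_ball[of _ s]
    by (intro MVT2 DERIV_diff axis_line_has_derivative[OF d1]) (simp_all add: *)
  then obtain a where a: "0 < a" "a < s" and eq1: "F s - F 0 = s *
      (partial_deriv i g (v + s *\<^sub>R axis j 1 + a *\<^sub>R axis i 1) - partial_deriv i g (v + a *\<^sub>R axis i 1))"
    by auto
  have "\<exists>b>0. b < s \<and> partial_deriv i g (v + a *\<^sub>R axis i 1 + s *\<^sub>R axis j 1)
      - partial_deriv i g (v + a *\<^sub>R axis i 1 + 0 *\<^sub>R axis j 1)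
    = (s - 0) * partial_deriv j (partial_deriv i g) (v + a *\<^sub>R axis i 1 + b *\<^sub>R axis j 1)"
    using s a in_ball[of a] by (intro MVT2 axis_line_has_derivative[OF d2]) simp_all
  then obtain b where b: "0 < b" "b < s" and eq2: "partial_deriv i g (v + a *\<^sub>R axis i 1 + s *\<^sub>R axis j 1)
      - partial_deriv i g (v + a *\<^sub>R axis i 1)
    = s * partial_deriv j (partial_deriv i g) (v + a *\<^sub>R axis i 1 + b *\<^sub>R axis j 1)"
    by auto
  have "dist v (v + a *\<^sub>R axis i 1 + b *\<^sub>R axis j 1) < 2 * s" using near[of a b] a b by auto
  moreover have "F s - F 0 = s\<^sup>2 * partial_deriv j (partial_deriv i g) (v + a *\<^sub>R axis i 1 + b *\<^sub>R axis j 1)"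
    unfolding eq1 using eq2 by (simp add: * power2_eq_square)
  ultimately show ?thesis
    by (intro exI[of _ "v + a *\<^sub>R axis i 1 + b *\<^sub>R axis j 1"]) (auto simp: F_def algebra_simps)
qed

text \<open>Schwarz's theorem. A double difference over a small square is the squared side times
  either mixed derivative, each taken at some nearby point; so these values coincide, and continuity
  at \<open>v\<close> carries the equality to \<open>v\<close>.\<close>

lemma hessian_symmetric:
  fixes g :: "real^'n \<Rightarrow> real"
  assumes r: "r > 0" and d1: "g differentiable_on ball v r"
    and d2: "\<And>i. partial_deriv i g differentiable_on ball v r"
    and c: "\<And>i j. continuous_on (ball v r) (partial_deriv i (partial_deriv j g))"
  shows "transpose (hessian g v) = hessian g v"
proof -
  have "partial_deriv i (partial_deriv j g) v = partial_deriv j (partial_deriv i g) v" (is "?a = ?b") for i j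
  proof (rule ccontr)
    assume ne: "?a \<noteq> ?b"
    define e where "e = \<bar>?a - ?b\<bar> / 2"
    have e: "e > 0" using ne by (simp add: e_def)
    have ex: "\<exists>d>0. \<forall>x. dist v x < d \<longrightarrow> \<bar>partial_deriv k (partial_deriv l g) x - partial_deriv k (partial_deriv l g) v\<bar> < e"
      for k l
    proof -
      have "continuous (at v) (partial_deriv k (partial_deriv l g))"
        using c r by (simp add: continuous_on_eq_continuous_at)
      then show ?thesis using e unfolding continuous_at_eps_delta by (metis dist_commute dist_real_def)
    qed
    obtain d d' where d: "d > 0" "\<And>x. dist v x < d \<Longrightarrow> \<bar>partial_deriv i (partial_deriv j g) x - ?a\<bar> < e"
      and d': "d' > 0" "\<And>x. dist v x < d' \<Longrightarrow> \<bar>partial_deriv j (partial_deriv i g) x - ?b\<bar> < e"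
      using ex[of i j] ex[of j i] by auto
    \<comment> \<open>Dividing by 3 leaves \<open>2 * s\<close>, the reach of the double difference,
      below every radius.\<close>
    define s where "s = min r (min d d') / 3"
    have s: "0 < s" "2 * s < r" "2 * s < d" "2 * s < d'" using r d d' by (auto simp: s_def)
    obtain x where x: "dist v x < 2 * s" and eqx: "g (v + s *\<^sub>R axis i 1 + s *\<^sub>R axis j 1) - g (v + s *\<^sub>R axis i 1)
        - g (v + s *\<^sub>R axis j 1) + g v = s\<^sup>2 * partial_deriv j (partial_deriv i g) x"
      using double_difference_eq_partial_deriv[OF d1 d2 s(1,2)] by blast
    obtain y where y: "dist v y < 2 * s" and eqy: "g (v + s *\<^sub>R axis j 1 + s *\<^sub>R axis i 1) - g (v + s *\<^sub>R axis j 1)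
        - g (v + s *\<^sub>R axis i 1) + g v = s\<^sup>2 * partial_deriv i (partial_deriv j g) y"
      using double_difference_eq_partial_deriv[OF d1 d2 s(1,2)] by blast
    have swap: "v + s *\<^sub>R axis j 1 + s *\<^sub>R axis i 1 = v + s *\<^sub>R axis i 1 + s *\<^sub>R axis j 1" by simp
    from eqx eqy[unfolded swap] have "s\<^sup>2 * partial_deriv j (partial_deriv i g) x = s\<^sup>2 * partial_deriv i (partial_deriv j g) y"
      by linarith
    then have "partial_deriv j (partial_deriv i g) x = partial_deriv i (partial_deriv j g) y"
      using s(1) by simp
    with d(2)[of y] d'(2)[of x] x y s have "\<bar>?a - ?b\<bar> < 2 * e" by linarith
    then show False by (simp add: e_def)
  qed
  then show ?thesis by (simp add: transpose_def hessian_def vec_eq_iff)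
qed

section \<open>Taylor's formula and quadratic growth\<close>

lemma abs_quadratic_form_le:
  fixes H :: "real^'n^'n"
  assumes "\<And>i j. \<bar>H $ i $ j\<bar> \<le> e"
  shows "\<bar>y \<bullet> (H *v y)\<bar> \<le> (real CARD('n))\<^sup>2 * e * (norm y)\<^sup>2"
proof -
  have e: "e \<ge> 0" using assms[of undefined undefined] by linarith
  have "\<bar>y \<bullet> (H *v y)\<bar> = \<bar>\<Sum>i\<in>UNIV. \<Sum>j\<in>UNIV. y $ i * (H $ i $ j * y $ j)\<bar>"
    by (simp add: inner_vec_def matrix_vector_mult_def sum_distrib_left)
  also have "\<dots> \<le> (\<Sum>i\<in>UNIV. \<Sum>j\<in>UNIV. \<bar>y $ i * (H $ i $ j * y $ j)\<bar>)"
    by (intro order_trans[OF sum_abs] sum_mono sum_abs)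
  also have "\<dots> \<le> (\<Sum>i\<in>(UNIV::'n set). \<Sum>j\<in>(UNIV::'n set). norm y * (e * norm y))"
    unfolding abs_mult using e by (intro sum_mono mult_mono assms component_le_norm_cart) auto
  also have "\<dots> = (real CARD('n))\<^sup>2 * e * (norm y)\<^sup>2" by (simp add: power2_eq_square)
  finally show ?thesis .
qed

lemma partial_deriv_local_min:
  fixes g :: "real^'n \<Rightarrow> real"
  assumes "r > 0" "g differentiable_on ball v r" "\<And>x. x \<in> ball v r \<Longrightarrow> g v \<le> g x"
  shows "partial_deriv i g v = 0"
proof (rule DERIV_local_min)
  show "((\<lambda>t. g (v + t *\<^sub>R axis i 1)) has_real_derivative partial_deriv i g v) (at 0)"
    using axis_line_has_derivative[OF assms(2), of v 0 i] assms(1) by simp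
  show "\<forall>y. \<bar>0 - y\<bar> < r \<longrightarrow> g (v + 0 *\<^sub>R axis i 1) \<le> g (v + y *\<^sub>R axis i 1)"
    using assms(3) by (auto simp: dist_norm norm_axis_1)
qed (rule assms)

text \<open>Taylor's formula along the segment from \<open>v\<close> to \<open>v + y\<close>: the
  first-order term vanishes at a minimum, and the Lagrange remainder is the second-derivative form
  at an intermediate point. Continuity brings its entries close to those at \<open>v\<close>, so the
  error is uniform in the direction of \<open>y\<close>.\<close>

lemma second_order_expansion_at_min:
  fixes g :: "real^'n \<Rightarrow> real"
  assumes r: "r > 0" and d1: "g differentiable_on ball v r"
    and d2: "\<And>i. partial_deriv i g differentiable_on ball v r"
    and c: "\<And>i j. continuous_on (ball v r) (partial_deriv i (partial_deriv j g))"
    and min: "\<And>x. x \<in> ball v r \<Longrightarrow> g v \<le> g x"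
    and e: "e > 0"
  shows "\<exists>d. 0 < d \<and> d \<le> r \<and> (\<forall>y. norm y < d \<longrightarrow>
    \<bar>g (v + y) - g v - y \<bullet> (hessian g v *v y) / 2\<bar> \<le> e * (norm y)\<^sup>2)"
proof -
  \<comment> \<open>The squared dimension cancels the factor in
    \<open>abs_quadratic_form_le\<close>.\<close>
  define e' where "e' = e / (real CARD('n))\<^sup>2"
  have e': "e' > 0" using e by (simp add: e'_def)
  have "\<forall>\<^sub>F x in at v. \<forall>i j. dist (partial_deriv i (partial_deriv j g) x) (partial_deriv i (partial_deriv j g) v) < e'"
  proof (intro eventually_all_finite)
    fix i j
    have "isCont (partial_deriv i (partial_deriv j g)) v"
      using c r by (simp add: continuous_on_eq_continuous_at)
    then show "\<forall>\<^sub>F x in at v. dist (partial_deriv i (partial_deriv j g) x) (partial_deriv i (partial_deriv j g) v) < e'"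
      unfolding isCont_def using e' by (rule tendstoD)
  qed
  then obtain d0 where d0: "d0 > 0" and close: "\<And>x i j. x \<noteq> v \<Longrightarrow> dist x v < d0 \<Longrightarrow>
      dist (partial_deriv i (partial_deriv j g) x) (partial_deriv i (partial_deriv j g) v) < e'"
    unfolding eventually_at by auto
  define d where "d = min r d0"
  have "\<bar>g (v + y) - g v - y \<bullet> (hessian g v *v y) / 2\<bar> \<le> e * (norm y)\<^sup>2" if y: "norm y < d" for y
  proof -
    have in_ball: "v + t *\<^sub>R y \<in> ball v d" if "0 \<le> t" "t \<le> 1" for t
    proof -
      have "\<bar>t\<bar> * norm y \<le> norm y" using that by (intro mult_left_le_one_le) auto
      then show ?thesis using y by (simp add: dist_norm)
    qed
    then have in_ball': "v + t *\<^sub>R y \<in> ball v r" if "0 \<le> t" "t \<le> 1" for t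
      using that by (force simp: d_def)
    define diff where "diff = (\<lambda>(m::nat) t. if m = 0 then g (v + t *\<^sub>R y)
      else if m = 1 then (\<Sum>i\<in>UNIV. y $ i * partial_deriv i g (v + t *\<^sub>R y))
      else (\<Sum>i\<in>UNIV. y $ i * (\<Sum>j\<in>UNIV. y $ j * partial_deriv j (partial_deriv i g) (v + t *\<^sub>R y))))"
    have "\<exists>t. 0 < t \<and> t < 1 \<and> g (v + 1 *\<^sub>R y) = (\<Sum>m<2. diff m 0 / fact m * 1 ^ m) + diff 2 t / fact 2 * 1 ^ 2"
    proof (rule Maclaurin)
      show "\<forall>m t. m < 2 \<and> 0 \<le> t \<and> t \<le> 1 \<longrightarrow> (diff m has_real_derivative diff (Suc m) t) (at t)"
      proof (intro allI impI; elim conjE)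
        fix m :: nat and t :: real assume "m < 2" and t: "0 \<le> t" "t \<le> 1"
        then consider "m = 0" | "m = 1" by linarith
        then show "(diff m has_real_derivative diff (Suc m) t) (at t)"
        proof cases
          case 1
          then show ?thesis
            using line_has_derivative[OF d1 _ in_ball'[OF t]] by (simp add: diff_def)
        next
          case 2
          have "((\<lambda>t. \<Sum>i\<in>UNIV. y $ i * partial_deriv i g (v + t *\<^sub>R y)) has_real_derivative
            (\<Sum>i\<in>UNIV. y $ i * (\<Sum>j\<in>UNIV. y $ j * partial_deriv j (partial_deriv i g) (v + t *\<^sub>R y)))) (at t)"
            by (intro DERIV_sum DERIV_cmult line_has_derivative[OF d2 _ in_ball'[OF t]]) simp
          with 2 show ?thesis by (simp add: diff_def)
        qed
      qed
    qed (auto simp: diff_def)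
    then obtain t where t: "0 < t" "t < 1"
      and eq: "g (v + y) = diff 0 0 + diff 1 0 + diff 2 t / 2"
      by (auto simp: numeral_2_eq_2)
    define H where "H = (\<chi> i j. partial_deriv j (partial_deriv i g) (v + t *\<^sub>R y)) - hessian g v"
    \<comment> \<open>Differentiating along the line produces partial derivatives in the order
      opposite to that of \<open>hessian\<close>; symmetry reconciles the two.\<close>
    have sym: "hessian g v $ i $ j = partial_deriv j (partial_deriv i g) v" for i j
      using hessian_symmetric[OF r d1 d2 c] by (simp add: hessian_def transpose_def vec_eq_iff)
    have "\<bar>H $ i $ j\<bar> \<le> e'" for i j
    proof (cases "y = 0")
      case True
      then show ?thesis using e' by (simp add: H_def sym)
    next
      case False
      then show ?thesis
        using close[of "v + t *\<^sub>R y" j i] in_ball[of t] t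
        by (simp add: H_def sym dist_real_def d_def dist_commute)
    qed
    then have "\<bar>y \<bullet> (H *v y)\<bar> \<le> (real CARD('n))\<^sup>2 * e' * (norm y)\<^sup>2" by (rule abs_quadratic_form_le)
    also have "\<dots> = e * (norm y)\<^sup>2" by (simp add: e'_def)
    finally have *: "\<bar>y \<bullet> (H *v y)\<bar> \<le> e * (norm y)\<^sup>2" .
    have "diff 2 t = y \<bullet> ((\<chi> i j. partial_deriv j (partial_deriv i g) (v + t *\<^sub>R y)) *v y)"
      by (simp add: diff_def inner_vec_def matrix_vector_mult_def sum_distrib_left mult_ac)
    then have "diff 2 t - y \<bullet> (hessian g v *v y) = y \<bullet> (H *v y)"
      by (simp add: H_def matrix_vector_mult_diff_rdistrib inner_diff_right)
    moreover have "diff 1 0 = 0" "diff 0 0 = g v"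
      using partial_deriv_local_min[OF r d1 min] by (simp_all add: diff_def)
    ultimately have "g (v + y) - g v - y \<bullet> (hessian g v *v y) / 2 = (y \<bullet> (H *v y)) / 2"
      using eq by (simp add: field_simps)
    moreover have "0 \<le> e * (norm y)\<^sup>2" using e by simp
    ultimately show ?thesis using * by linarith
  qed
  moreover have "0 < d" "d \<le> r" using r d0 by (auto simp: d_def)
  ultimately show ?thesis by blast
qed

text \<open>All four facts come from the expansion. Dividing it by the square of \<open>s\<close>
  gives the limit. The quotients are nonnegative for small \<open>s\<close>, so the Hessian is
  semidefinite, and it is definite once nonsingular. The definite form then has a positive minimum
  \<open>l\<close> on the unit sphere, and an expansion error of \<open>l / 4\<close> leaves growth
  at rate \<open>l / 2 - l / 4\<close>.\<close>

lemma
  fixes g :: "real^'n \<Rightarrow> real"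
  assumes r: "r > 0" and cd: "cont_diff_on 3 g (ball v r)"
    and min: "\<And>x. x \<in> ball v r \<Longrightarrow> g v \<le> g x"
  shows second_order_limit_at_min:
      "((\<lambda>s. (g (v + s *\<^sub>R z) - g v) / s\<^sup>2) \<longlongrightarrow> z \<bullet> (hessian g v *v z) / 2) (at_right 0)"
    and hessian_at_min_symmetric: "transpose (hessian g v) = hessian g v"
    and hessian_at_min_pos: "det (hessian g v) \<noteq> 0 \<Longrightarrow> y \<noteq> 0 \<Longrightarrow> 0 < y \<bullet> (hessian g v *v y)"
    and quadratic_growth_at_min: "det (hessian g v) \<noteq> 0 \<Longrightarrow>
      \<exists>c d. 0 < c \<and> 0 < d \<and> d \<le> r \<and> (\<forall>y. norm y < d \<longrightarrow> c * (norm y)\<^sup>2 \<le> g (v + y) - g v)"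
proof -
  let ?H = "hessian g v"
  have expansion: "\<exists>d. 0 < d \<and> d \<le> r \<and> (\<forall>y. norm y < d \<longrightarrow>
      \<bar>g (v + y) - g v - y \<bullet> (?H *v y) / 2\<bar> \<le> e * (norm y)\<^sup>2)" if "e > 0" for e
    by (rule second_order_expansion_at_min[OF r cont_diff_on_2[OF cd] min that])
  show sym: "transpose ?H = ?H" by (rule hessian_symmetric[OF r cont_diff_on_2[OF cd]])
  show lim: "((\<lambda>s. (g (v + s *\<^sub>R z) - g v) / s\<^sup>2) \<longlongrightarrow> z \<bullet> (?H *v z) / 2) (at_right 0)" for z
  proof (rule tendstoI)
    fix e :: real assume e: "e > 0"
    define e' where "e' = e / (2 * ((norm z)\<^sup>2 + 1))"
    have nz: "0 < (norm z)\<^sup>2 + 1" by (simp add: add_nonneg_pos)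
    have e': "e' > 0" using e nz by (simp add: e'_def)
    obtain d where d: "d > 0" and bd: "\<And>y. norm y < d \<Longrightarrow> \<bar>g (v + y) - g v - y \<bullet> (?H *v y) / 2\<bar> \<le> e' * (norm y)\<^sup>2"
      using expansion[OF e'] by auto
    have "\<forall>\<^sub>F s in at_right 0. s < d / (norm z + 1)"
      using d by (intro order_tendstoD[OF tendsto_ident_at]) (simp add: add_nonneg_pos)
    moreover have "\<forall>\<^sub>F s in at_right (0::real). s > 0" by (simp add: eventually_at_right_less)
    ultimately show "\<forall>\<^sub>F s in at_right 0. dist ((g (v + s *\<^sub>R z) - g v) / s\<^sup>2) (z \<bullet> (?H *v z) / 2) < e"
    proof eventually_elim
      fix s :: real assume s: "s < d / (norm z + 1)" "0 < s"
      have "norm (s *\<^sub>R z) \<le> s * (norm z + 1)" using s by (simp add: mult_left_mono)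
      also have "\<dots> < d" using s by (simp add: pos_less_divide_eq add_nonneg_pos)
      finally have "\<bar>g (v + s *\<^sub>R z) - g v - (s *\<^sub>R z) \<bullet> (?H *v (s *\<^sub>R z)) / 2\<bar> \<le> e' * (norm (s *\<^sub>R z))\<^sup>2"
        by (rule bd)
      also have "(s *\<^sub>R z) \<bullet> (?H *v (s *\<^sub>R z)) = s\<^sup>2 * (z \<bullet> (?H *v z))"
        by (simp add: matrix_vector_mult_scaleR power2_eq_square)
      also have "g (v + s *\<^sub>R z) - g v - s\<^sup>2 * (z \<bullet> (?H *v z)) / 2
          = s\<^sup>2 * ((g (v + s *\<^sub>R z) - g v) / s\<^sup>2 - z \<bullet> (?H *v z) / 2)"
        using s by (simp add: field_simps)
      also have "e' * (norm (s *\<^sub>R z))\<^sup>2 = s\<^sup>2 * (e' * (norm z)\<^sup>2)" by (simp add: power_mult_distrib)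
      finally have "s\<^sup>2 * dist ((g (v + s *\<^sub>R z) - g v) / s\<^sup>2) (z \<bullet> (?H *v z) / 2) \<le> s\<^sup>2 * (e' * (norm z)\<^sup>2)"
        by (simp add: abs_mult dist_real_def)
      then have "dist ((g (v + s *\<^sub>R z) - g v) / s\<^sup>2) (z \<bullet> (?H *v z) / 2) \<le> e' * (norm z)\<^sup>2"
        using s by simp
      also have "\<dots> < e' * (2 * ((norm z)\<^sup>2 + 1))" using e' nz by (intro mult_strict_left_mono) auto
      also have "\<dots> = e" using nz by (simp add: e'_def)
      finally show "dist ((g (v + s *\<^sub>R z) - g v) / s\<^sup>2) (z \<bullet> (?H *v z) / 2) < e" .
    qed
  qed
  have psd: "0 \<le> y \<bullet> (?H *v y)" for y
  proof -
    have "\<forall>\<^sub>F s in at_right 0. s < r / (norm y + 1)"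
      using r by (intro order_tendstoD[OF tendsto_ident_at]) (simp add: add_nonneg_pos)
    moreover have "\<forall>\<^sub>F s in at_right (0::real). s > 0" by (simp add: eventually_at_right_less)
    ultimately have "\<forall>\<^sub>F s in at_right 0. 0 \<le> (g (v + s *\<^sub>R y) - g v) / s\<^sup>2"
    proof eventually_elim
      fix s :: real assume s: "s < r / (norm y + 1)" "0 < s"
      have "norm (s *\<^sub>R y) \<le> s * (norm y + 1)" using s by (simp add: mult_left_mono)
      also have "\<dots> < r" using s by (simp add: pos_less_divide_eq add_nonneg_pos)
      finally show "0 \<le> (g (v + s *\<^sub>R y) - g v) / s\<^sup>2" using min by (simp add: dist_norm)
    qed
    then have "0 \<le> y \<bullet> (?H *v y) / 2"
      by (rule tendsto_lowerbound[OF lim]) simp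
    then show ?thesis by simp
  qed
  assume det: "det ?H \<noteq> 0"
  show pos: "0 < y \<bullet> (?H *v y)" if "y \<noteq> 0" for y
    by (rule psd_nonsingular_pos[OF sym psd det that])
  have "\<exists>x\<in>sphere 0 1. \<forall>y\<in>sphere 0 1. x \<bullet> (?H *v x) \<le> y \<bullet> (?H *v y)"
    by (intro continuous_attains_inf continuous_on_inner continuous_on_id
        matrix_vector_mult_linear_continuous_on) (auto intro!: exI[of _ "axis _ 1"] simp: norm_axis_1)
  then obtain x where x: "norm x = 1" "\<And>y. norm y = 1 \<Longrightarrow> x \<bullet> (?H *v x) \<le> y \<bullet> (?H *v y)" by auto
  define l where "l = x \<bullet> (?H *v x)"
  have l: "l > 0" unfolding l_def using x by (intro pos) auto
  have form_ge: "l * (norm y)\<^sup>2 \<le> y \<bullet> (?H *v y)" for y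
  proof (cases "y = 0")
    case False
    have "l \<le> (y /\<^sub>R norm y) \<bullet> (?H *v (y /\<^sub>R norm y))" unfolding l_def using False by (intro x) simp
    also have "\<dots> = (y \<bullet> (?H *v y)) / (norm y)\<^sup>2"
      by (simp add: matrix_vector_mult_scaleR power2_eq_square divide_simps)
    finally show ?thesis using False by (simp add: pos_le_divide_eq)
  qed simp
  obtain d where d: "d > 0" "d \<le> r" and bd: "\<And>y. norm y < d \<Longrightarrow> \<bar>g (v + y) - g v - y \<bullet> (?H *v y) / 2\<bar> \<le> l / 4 * (norm y)\<^sup>2"
    using expansion[of "l / 4"] l by auto
  have "l / 4 * (norm y)\<^sup>2 \<le> g (v + y) - g v" if "norm y < d" for y
    using bd[OF that] form_ge[of y] by linarith
  then show "\<exists>c d. 0 < c \<and> 0 < d \<and> d \<le> r \<and> (\<forall>y. norm y < d \<longrightarrow> c * (norm y)\<^sup>2 \<le> g (v + y) - g v)"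
    using l d by (intro exI[of _ "l / 4"] exI[of _ d]) auto
qed

section \<open>Sublevel sets of the kernel\<close>

lemma cont_diff_on_subset: "cont_diff_on k g S \<Longrightarrow> T \<subseteq> S \<Longrightarrow> cont_diff_on k g T"
  by (induction k arbitrary: g) (auto intro: continuous_on_subset differentiable_on_subset)

lemma integral_lborel_affine:
  fixes f :: "'a::euclidean_space \<Rightarrow> real"
  assumes [measurable]: "f \<in> borel_measurable borel" and s: "s > 0"
  shows "(\<integral>x. f x \<partial>lborel) = s ^ DIM('a) * (\<integral>z. f (v + s *\<^sub>R z) \<partial>lborel)"
proof -
  have "(\<integral>x. f x \<partial>lborel) = (\<integral>x. f x \<partial>density (distr lborel borel (\<lambda>x. v + s *\<^sub>R x)) (\<lambda>_. \<bar>s\<bar> ^ DIM('a)))"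
    using s by (subst lborel_affine[of s v]) simp_all
  also have "\<dots> = (\<integral>x. \<bar>s\<bar> ^ DIM('a) * f x \<partial>distr lborel borel (\<lambda>x. v + s *\<^sub>R x))"
    using s by (subst integral_density) (auto simp flip: ennreal_power)
  also have "\<dots> = (\<integral>z. \<bar>s\<bar> ^ DIM('a) * f (v + s *\<^sub>R z) \<partial>lborel)"
    by (subst integral_distr) auto
  finally show ?thesis using s by simp
qed

text \<open>The substitution \<open>x = v + sqrt (e n) *\<^sub>R z\<close> cancels the denominator
  \<open>e n powr (CARD('n) / 2)\<close>. The rescaled sublevel sets converge to the ellipsoid of
  level 2 off its boundary, a null set. Quadratic growth confines all of them to the ball of radius
  \<open>1 / sqrt c\<close>, so dominated convergence applies.\<close>

lemma local_sublevel_integral_limit: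
  fixes g q :: "real^'n \<Rightarrow> real" and e :: "nat \<Rightarrow> real"
  assumes d: "d > 0" and cd: "cont_diff_on 3 g (ball v d)"
    and min: "\<And>x. x \<in> ball v d \<Longrightarrow> g v \<le> g x"
    and det: "det (hessian g v) \<noteq> 0"
    and c: "c > 0" and r: "0 < r" "r \<le> d"
    and growth: "\<And>y. norm y < r \<Longrightarrow> c * (norm y)\<^sup>2 \<le> g (v + y) - g v"
    and q: "isCont q v" "\<And>x. \<bar>q x\<bar> \<le> B" and q_meas [measurable]: "q \<in> borel_measurable borel"
    and e: "\<And>n. e n > 0" "e \<longlonglongrightarrow> 0"
  shows "(\<lambda>n. (\<integral>x. q x * indicator {x \<in> ball v r. g x \<le> g v + e n} x \<partial>lborel) / e n powr (CARD('n) / 2))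
    \<longlonglongrightarrow> (2 * pi) powr (CARD('n) / 2) / Gamma (CARD('n) / 2 + 1) * (1 / sqrt (det (hessian g v)) * q v)"
proof -
  let ?H = "hessian g v"
  define A where "A = (\<lambda>n. {x \<in> ball v r. g x \<le> g v + e n})"
  define s where "s = (\<lambda>n. sqrt (e n))"
  have s: "s n > 0" "(s n)\<^sup>2 = e n" for n using e(1)[of n] by (simp_all add: s_def less_imp_le)
  have s_lim: "filterlim s (at_right 0) sequentially"
    using tendsto_real_sqrt[OF e(2)] e(1) by (auto simp: s_def filterlim_at less_imp_neq[THEN not_sym])
  then have s0: "s \<longlonglongrightarrow> 0" by (auto simp: filterlim_at)
  have "g differentiable_on ball v r"
    using cont_diff_on_2(1)[OF cd] r by (meson differentiable_on_subset subset_ball)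
  then have cont: "continuous_on (ball v r) g" by (rule differentiable_imp_continuous_on)
  have A_meas [measurable]: "A n \<in> sets borel" for n
  proof -
    \<comment> \<open>Continuity of \<open>g\<close> is known only on the ball, so measurability is
      obtained for \<open>g\<close> cut off outside it.\<close>
    have "{x. indicator (ball v r) x *\<^sub>R g x \<le> g v + e n} \<in> sets borel"
      using borel_measurable_continuous_on_indicator[OF _ cont] by measurable
    then have "ball v r \<inter> {x. indicator (ball v r) x *\<^sub>R g x \<le> g v + e n} \<in> sets borel" by auto
    also have "ball v r \<inter> {x. indicator (ball v r) x *\<^sub>R g x \<le> g v + e n} = A n" by (auto simp: A_def)
    finally show ?thesis .
  qed
  have pos: "y \<noteq> 0 \<Longrightarrow> 0 < y \<bullet> (?H *v y)" for y by (rule hessian_at_min_pos[OF d cd min det])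
  have sym: "transpose ?H = ?H" by (rule hessian_at_min_symmetric[OF d cd min])
  have ell_meas [measurable]: "{z. z \<bullet> (?H *v z) \<le> 2} \<in> sets borel"
    by (intro borel_closed closed_Collect_le continuous_on_const continuous_on_inner
        continuous_on_id matrix_vector_mult_linear_continuous_on)
  have "(\<lambda>n. \<integral>z. q (v + s n *\<^sub>R z) * indicator (A n) (v + s n *\<^sub>R z) \<partial>lborel)
      \<longlonglongrightarrow> (\<integral>z. q v * indicator {z. z \<bullet> (?H *v z) \<le> 2} z \<partial>lborel)"
  proof (rule integral_dominated_convergence)
    show "integrable lborel (\<lambda>z. B * indicator (cball (0::real^'n) (1 / sqrt c)) z)"
      by (intro integrable_mult_right integrable_real_indicator emeasure_bounded_finite) auto
    show "AE z in lborel. norm (q (v + s n *\<^sub>R z) * indicator (A n) (v + s n *\<^sub>R z))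
        \<le> B * indicator (cball 0 (1 / sqrt c)) z" for n
    proof (rule AE_I2)
      fix z :: "real^'n"
      have B: "B \<ge> 0" using q(2)[of v] by linarith
      show "norm (q (v + s n *\<^sub>R z) * indicator (A n) (v + s n *\<^sub>R z)) \<le> B * indicator (cball 0 (1 / sqrt c)) z"
      proof (cases "v + s n *\<^sub>R z \<in> A n")
        case True
        then have "c * (norm (s n *\<^sub>R z))\<^sup>2 \<le> e n"
          using growth[of "s n *\<^sub>R z"] by (auto simp: A_def dist_norm)
        then have "e n * (c * (norm z)\<^sup>2) \<le> e n * 1"
          using s by (simp add: power_mult_distrib mult_ac)
        then have "c * (norm z)\<^sup>2 \<le> 1" using e(1)[of n] by simp
        then have "(norm z)\<^sup>2 \<le> (1 / sqrt c)\<^sup>2" using c by (simp add: power_divide field_simps)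
        then have "norm z \<le> 1 / sqrt c" by (rule power2_le_imp_le) (use c in simp)
        then show ?thesis using q(2) True by simp
      qed (use B in simp)
    qed
    have "AE z in lborel. z \<notin> {z. z \<bullet> (?H *v z) = 2}"
    proof (rule AE_not_in)
      have "{z. z \<bullet> (?H *v z) = 2} \<in> sets borel"
        by (intro borel_closed closed_Collect_eq continuous_on_const continuous_on_inner
            continuous_on_id matrix_vector_mult_linear_continuous_on)
      then show "{z. z \<bullet> (?H *v z) = 2} \<in> null_sets lborel"
        using emeasure_ellipsoid_boundary[OF sym pos] by (auto simp: null_sets_def)
    qed
    then show "AE z in lborel. (\<lambda>n. q (v + s n *\<^sub>R z) * indicator (A n) (v + s n *\<^sub>R z))
        \<longlonglongrightarrow> q v * indicator {z. z \<bullet> (?H *v z) \<le> 2} z"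
    proof eventually_elim
      fix z assume z: "z \<notin> {z. z \<bullet> (?H *v z) = 2}"
      have arg: "(\<lambda>n. v + s n *\<^sub>R z) \<longlonglongrightarrow> v"
        using tendsto_add[OF tendsto_const tendsto_scaleR[OF s0 tendsto_const]] by (metis add_0_right scale_zero_left)
      have qlim: "(\<lambda>n. q (v + s n *\<^sub>R z)) \<longlonglongrightarrow> q v" by (rule isCont_tendsto_compose[OF q(1) arg])
      have ball: "\<forall>\<^sub>F n in sequentially. v + s n *\<^sub>R z \<in> ball v r"
        using arg r by (intro topological_tendstoD) auto
      have lim: "(\<lambda>n. (g (v + s n *\<^sub>R z) - g v) / (s n)\<^sup>2) \<longlonglongrightarrow> z \<bullet> (?H *v z) / 2"
        using filterlim_compose[OF second_order_limit_at_min[OF d cd min] s_lim] .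
      have iff: "v + s n *\<^sub>R z \<in> A n \<longleftrightarrow> (g (v + s n *\<^sub>R z) - g v) / (s n)\<^sup>2 \<le> 1"
        if "v + s n *\<^sub>R z \<in> ball v r" for n
        using that e(1)[of n] by (auto simp: A_def s divide_le_eq)
      have "\<forall>\<^sub>F n in sequentially. indicat_real (A n) (v + s n *\<^sub>R z) = indicator {z. z \<bullet> (?H *v z) \<le> 2} z"
      \<comment> \<open>A strict inequality for the limit passes to all large \<open>n\<close>; the
        excluded boundary is exactly where neither strict inequality holds.\<close>
      proof (cases "z \<bullet> (?H *v z) / 2 < 1")
        case True
        from order_tendstoD(2)[OF lim True] ball show ?thesis
          by eventually_elim (use True in \<open>simp add: iff\<close>)
      next
        case False
        then have "z \<bullet> (?H *v z) / 2 > 1" using z by auto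
        from order_tendstoD(1)[OF lim this] ball show ?thesis
          by eventually_elim (use False z in \<open>simp add: iff\<close>)
      qed
      then have "(\<lambda>n. indicat_real (A n) (v + s n *\<^sub>R z)) \<longlonglongrightarrow> indicator {z. z \<bullet> (?H *v z) \<le> 2} z"
        by (rule tendsto_eventually)
      with qlim show "(\<lambda>n. q (v + s n *\<^sub>R z) * indicator (A n) (v + s n *\<^sub>R z))
        \<longlonglongrightarrow> q v * indicator {z. z \<bullet> (?H *v z) \<le> 2} z" by (rule tendsto_mult)
    qed
  qed measurable
  also have "(\<integral>z. q v * indicator {z. z \<bullet> (?H *v z) \<le> 2} z \<partial>lborel)
      = (2 * pi) powr (CARD('n) / 2) / Gamma (CARD('n) / 2 + 1) * (1 / sqrt (det ?H) * q v)"
  proof -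
    have "measure lborel {z. z \<bullet> (?H *v z) \<le> 2}
        = (2 * pi) powr (CARD('n) / 2) / Gamma (CARD('n) / 2 + 1) / sqrt (det ?H)"
      by (rule measure_ellipsoid[OF sym pos])
    then show ?thesis by simp
  qed
  also have "(\<lambda>n. \<integral>z. q (v + s n *\<^sub>R z) * indicator (A n) (v + s n *\<^sub>R z) \<partial>lborel)
    = (\<lambda>n. (\<integral>x. q x * indicator (A n) x \<partial>lborel) / e n powr (CARD('n) / 2))"
  proof
    fix n
    have "(s n) ^ CARD('n) = e n powr (CARD('n) / 2)"
      using e(1)[of n] by (simp add: s_def powr_half_sqrt[symmetric] powr_powr flip: powr_realpow)
    then show "(\<integral>z. q (v + s n *\<^sub>R z) * indicator (A n) (v + s n *\<^sub>R z) \<partial>lborel)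
      = (\<integral>x. q x * indicator (A n) x \<partial>lborel) / e n powr (CARD('n) / 2)"
      using integral_lborel_affine[of "\<lambda>x. q x * indicator (A n) x" "s n" v] s(1)[of n] e(1)[of n] by simp
  qed
  finally show ?thesis by (simp add: A_def)
qed

section \<open>Combining the finitely many minimum points\<close>

locale nondegenerate_kernel =
  fixes h :: "real ^ 'n \<Rightarrow> ereal" and \<mu> :: real and V :: "(real ^ 'n) set"
  assumes cont: "continuous_on angle_cube h"
    and min_value: "\<And>x. x \<in> angle_cube \<Longrightarrow> ereal \<mu> \<le> h x"
    and V_def: "V = {x \<in> angle_cube. h x = ereal \<mu>}"
    and finite_V: "finite V"
    and interior: "\<And>v j. v \<in> V \<Longrightarrow> v $ j \<in> {0<..<2 * pi}"
    and smooth: "\<exists>\<delta>>0. \<forall>v\<in>V. (\<forall>x\<in>ball v \<delta>. \<bar>h x\<bar> \<noteq> \<infinity>) \<and>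
               cont_diff_on 3 (\<lambda>x. real_of_ereal (h x)) (ball v \<delta>)"
    and nondegenerate: "\<And>v. v \<in> V \<Longrightarrow> det (hessian (\<lambda>x. real_of_ereal (h x)) v) \<noteq> 0"
begin

definition hess_det :: "real ^ 'n \<Rightarrow> real" where
  "hess_det v = det (hessian (\<lambda>x. real_of_ereal (h x)) v)"

definition sublevel :: "real \<Rightarrow> (real ^ 'n) set" where
  "sublevel e = {x \<in> angle_cube. h x \<le> ereal (\<mu> + e)}"

lemma closed_sublevel: "closed (sublevel e)"
proof -
  have "sublevel e = angle_cube \<inter> h -` {..ereal (\<mu> + e)}" by (auto simp: sublevel_def)
  then show ?thesis
    using continuous_closed_preimage[OF cont] by (simp add: angle_cube_def closed_cbox)
qed

lemma sets_sublevel [measurable]: "sublevel e \<in> sets borel"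
  by (intro borel_closed closed_sublevel)

text \<open>Finitely many positive radii and growth constants have positive minima, so that one pair
  \<open>c\<close>, \<open>r\<close> serves all minimum points.\<close>

lemma ex_good_radius:
  obtains c r where "0 < c" "0 < r"
    "\<And>v. v \<in> V \<Longrightarrow> ball v r \<subseteq> angle_cube"
    "disjoint_family_on (\<lambda>v. ball v r) V"
    "\<And>v x. v \<in> V \<Longrightarrow> x \<in> ball v r \<Longrightarrow> \<bar>h x\<bar> \<noteq> \<infinity>"
    "\<And>v. v \<in> V \<Longrightarrow> cont_diff_on 3 (\<lambda>x. real_of_ereal (h x)) (ball v r)"
    "\<And>v y. v \<in> V \<Longrightarrow> norm y < r \<Longrightarrow> c * (norm y)\<^sup>2 \<le> real_of_ereal (h (v + y)) - \<mu>"
proof -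
  let ?g = "\<lambda>x. real_of_ereal (h x)"
  obtain \<delta> where \<delta>: "\<delta> > 0" and fin: "\<And>v x. v \<in> V \<Longrightarrow> x \<in> ball v \<delta> \<Longrightarrow> \<bar>h x\<bar> \<noteq> \<infinity>"
    and cd: "\<And>v. v \<in> V \<Longrightarrow> cont_diff_on 3 ?g (ball v \<delta>)"
    using smooth by auto
  have gV: "?g v = \<mu>" if "v \<in> V" for v using that V_def by simp
  have "\<exists>c s. 0 < c \<and> 0 < s \<and> s \<le> \<delta> \<and> ball v s \<subseteq> angle_cube \<and>
      (\<forall>y. norm y < s \<longrightarrow> c * (norm y)\<^sup>2 \<le> ?g (v + y) - \<mu>)" if v: "v \<in> V" for v
  proof -
    have "v \<in> box 0 (\<chi> i. 2 * pi)" using interior[OF v] by (simp add: mem_box_cart)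
    then obtain s0 where s0: "s0 > 0" "ball v s0 \<subseteq> box 0 (\<chi> i. 2 * pi)"
      using open_box open_contains_ball by blast
    then have cube: "ball v s0 \<subseteq> angle_cube" using box_subset_cbox unfolding angle_cube_def by blast
    define s1 where "s1 = min s0 \<delta>"
    have s1: "s1 > 0" "s1 \<le> \<delta>" using s0 \<delta> by (auto simp: s1_def)
    have sub: "ball v s1 \<subseteq> angle_cube" "ball v s1 \<subseteq> ball v \<delta>" using cube by (auto simp: s1_def)
    have min: "?g v \<le> ?g x" if "x \<in> ball v s1" for x
    proof -
      have "ereal \<mu> \<le> h x" by (rule min_value[OF subsetD[OF sub(1) that]])
      moreover have "\<bar>h x\<bar> \<noteq> \<infinity>" by (rule fin[OF v subsetD[OF sub(2) that]])
      ultimately have "\<mu> \<le> ?g x" by (cases "h x") auto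
      then show ?thesis by (simp add: gV[OF v])
    qed
    have "\<exists>c d. 0 < c \<and> 0 < d \<and> d \<le> s1 \<and> (\<forall>y. norm y < d \<longrightarrow> c * (norm y)\<^sup>2 \<le> ?g (v + y) - ?g v)"
      by (rule quadratic_growth_at_min[OF s1(1) cont_diff_on_subset[OF cd[OF v] sub(2)] min nondegenerate[OF v]])
    then obtain c s where "0 < c" "0 < s" "s \<le> s1" "\<And>y. norm y < s \<Longrightarrow> c * (norm y)\<^sup>2 \<le> ?g (v + y) - \<mu>"
      unfolding gV[OF v] by auto
    then show ?thesis using sub(1) s1(2) by (intro exI[of _ c] exI[of _ s]) auto
  qed
  then obtain C S where CS: "\<And>v. v \<in> V \<Longrightarrow> 0 < C v \<and> 0 < S v \<and> S v \<le> \<delta> \<and> ball v (S v) \<subseteq> angle_cube \<and>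
      (\<forall>y. norm y < S v \<longrightarrow> C v * (norm y)\<^sup>2 \<le> ?g (v + y) - \<mu>)"
    by metis
  define c where "c = Min (insert 1 (C ` V))"
  have c: "c > 0" "\<And>v. v \<in> V \<Longrightarrow> c \<le> C v"
    using CS finite_V by (auto simp: c_def)
  \<comment> \<open>Half the mutual distances make the balls disjoint;
    \<open>insert \<delta>\<close> also keeps the argument of \<open>Min\<close> nonempty.\<close>
  define r where "r = Min (insert \<delta> (S ` V \<union> (\<lambda>(v, w). dist v w / 2) ` (V \<times> V - Id)))"
  have fin_set: "finite (insert \<delta> (S ` V \<union> (\<lambda>(v, w). dist v w / 2) ` (V \<times> V - Id)))"
    using finite_V by auto
  have r: "r > 0" unfolding r_def using fin_set CS \<delta> by (subst Min_gr_iff) auto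
  have rS: "r \<le> S v" "r \<le> \<delta>" if "v \<in> V" for v
    unfolding r_def using that fin_set by (auto intro!: Min_le)
  have rd: "r \<le> dist v w / 2" if "v \<in> V" "w \<in> V" "v \<noteq> w" for v w
    unfolding r_def using that fin_set by (intro Min_le) (auto intro!: image_eqI[of _ _ "(v, w)"])
  show thesis
  proof (rule that[OF c(1) r])
    show "ball v r \<subseteq> angle_cube" if "v \<in> V" for v
      using CS[OF that] rS[OF that] subset_ball by blast
    show "disjoint_family_on (\<lambda>v. ball v r) V"
      unfolding disjoint_family_on_def
    proof (intro ballI impI)
      fix v w assume "v \<in> V" "w \<in> V" "v \<noteq> w"
      then have "2 * r \<le> dist v w" using rd by fastforce
      then show "ball v r \<inter> ball w r = {}" by (intro disjoint_ballI) simp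
    qed
    show "\<bar>h x\<bar> \<noteq> \<infinity>" if "v \<in> V" "x \<in> ball v r" for v x
      using fin[OF that(1), of x] that rS[OF that(1)] by auto
    show "cont_diff_on 3 ?g (ball v r)" if "v \<in> V" for v
      using cont_diff_on_subset[OF cd[OF that]] rS[OF that] subset_ball by blast
    show "c * (norm y)\<^sup>2 \<le> ?g (v + y) - \<mu>" if "v \<in> V" "norm y < r" for v y
    proof -
      have "c * (norm y)\<^sup>2 \<le> C v * (norm y)\<^sup>2" using c(2)[OF that(1)] by (intro mult_right_mono) auto
      also have "\<dots> \<le> ?g (v + y) - \<mu>" using CS[OF that(1)] rS[OF that(1)] that(2) by auto
      finally show ?thesis .
    qed
  qed
qed

text \<open>The cube without the balls is compact and contains no minimum point, so the minimum of
  \<open>h\<close> over it is strictly larger than \<open>\<mu>\<close>.\<close>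

lemma sublevel_near_minimizers:
  assumes "r > 0"
  obtains e0 where "e0 > 0" "\<And>e. e < e0 \<Longrightarrow> sublevel e \<subseteq> (\<Union>v\<in>V. ball v r)"
proof -
  define S where "S = angle_cube - (\<Union>v\<in>V. ball v r)"
  have "compact S"
    unfolding S_def angle_cube_def by (intro compact_diff compact_cbox open_UN) auto
  have "\<exists>e0>0. \<forall>x\<in>S. ereal (\<mu> + e0) \<le> h x"
  proof (cases "S = {}")
    case False
    have "continuous_on S h" using cont by (rule continuous_on_subset) (auto simp: S_def)
    then obtain x where x: "x \<in> S" "\<And>y. y \<in> S \<Longrightarrow> h x \<le> h y"
      using continuous_attains_inf[OF \<open>compact S\<close> False, of h] by blast
    then have "x \<in> angle_cube" "x \<notin> V" using assms by (auto simp: S_def)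
    then have "ereal \<mu> < h x" using min_value[of x] V_def by auto
    \<comment> \<open>The value \<open>h x\<close> may be infinite, so the gap is measured by a real
      number strictly between it and \<open>\<mu>\<close>.\<close>
    then obtain y where y: "ereal \<mu> < ereal y" "ereal y < h x" using ereal_dense2 by blast
    then show ?thesis using x(2) by (intro exI[of _ "y - \<mu>"]) (auto intro: less_imp_le less_le_trans)
  qed (auto intro: exI[of _ 1])
  then obtain e0 where e0: "e0 > 0" "\<And>x. x \<in> S \<Longrightarrow> ereal (\<mu> + e0) \<le> h x" by auto
  have "sublevel e \<subseteq> (\<Union>v\<in>V. ball v r)" if "e < e0" for e
  proof
    fix x assume x: "x \<in> sublevel e"
    then have "h x < ereal (\<mu> + e0)"
      using that by (auto simp: sublevel_def intro: le_less_trans)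
    then have "x \<notin> S" using e0(2) by (auto simp: not_less[symmetric])
    then show "x \<in> (\<Union>v\<in>V. ball v r)" using x by (auto simp: S_def sublevel_def)
  qed
  with e0(1) show thesis by (rule that)
qed

text \<open>Quadratic growth with constant \<open>c\<close> bounds the distance by
  \<open>sqrt (e / c)\<close>, whence \<open>L = 1 / sqrt c\<close>. This turns a small kernel value
  into closeness of single angles, which is what the estimate for overlapping subsets uses.\<close>

lemma sublevel_dist_minimizers:
  obtains e0 L where "e0 > 0" "L > 0"
    "\<And>e x. 0 \<le> e \<Longrightarrow> e < e0 \<Longrightarrow> x \<in> sublevel e \<Longrightarrow> \<exists>v\<in>V. dist v x \<le> L * sqrt e"
proof -
  obtain c r where c: "0 < c" and r: "0 < r"
    and fin: "\<And>v x. v \<in> V \<Longrightarrow> x \<in> ball v r \<Longrightarrow> \<bar>h x\<bar> \<noteq> \<infinity>"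
    and growth: "\<And>v y. v \<in> V \<Longrightarrow> norm y < r \<Longrightarrow> c * (norm y)\<^sup>2 \<le> real_of_ereal (h (v + y)) - \<mu>"
    by (rule ex_good_radius) blast
  obtain e0 where e0: "e0 > 0" "\<And>e. e < e0 \<Longrightarrow> sublevel e \<subseteq> (\<Union>v\<in>V. ball v r)"
    using sublevel_near_minimizers[OF r] by blast
  show thesis
  proof (rule that[OF e0(1)])
    show "1 / sqrt c > 0" using c by simp
    fix e x assume e: "0 \<le> e" "e < e0" and x: "x \<in> sublevel e"
    then obtain v where v: "v \<in> V" "x \<in> ball v r" using e0(2) by blast
    have "c * (norm (x - v))\<^sup>2 \<le> real_of_ereal (h (v + (x - v))) - \<mu>"
      using v by (intro growth) (auto simp: dist_norm norm_minus_commute)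
    also have "real_of_ereal (h (v + (x - v))) \<le> \<mu> + e"
      using x fin[OF v] by (cases "h x") (auto simp: sublevel_def)
    finally have "(norm (x - v))\<^sup>2 \<le> e / c" using c by (simp add: field_simps)
    then have "norm (x - v) \<le> sqrt (e / c)" by (rule real_le_rsqrt)
    then show "\<exists>v\<in>V. dist v x \<le> 1 / sqrt c * sqrt e"
      using v(1) by (auto simp: real_sqrt_divide dist_norm norm_minus_commute)
  qed
qed

text \<open>For small \<open>e n\<close> the sublevel set splits into disjoint pieces, one in each
  ball, so the local limits add up.\<close>

lemma sublevel_integral_limit:
  fixes q :: "real ^ 'n \<Rightarrow> real"
  assumes q: "\<And>v. v \<in> V \<Longrightarrow> isCont q v" "\<And>x. \<bar>q x\<bar> \<le> B" and [measurable]: "q \<in> borel_measurable borel"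
    and e: "\<And>n. e n > 0" "e \<longlonglongrightarrow> 0"
  shows "(\<lambda>n. (\<integral>x. q x * indicator (sublevel (e n)) x \<partial>lborel) / e n powr (CARD('n) / 2))
    \<longlonglongrightarrow> (2 * pi) powr (CARD('n) / 2) / Gamma (CARD('n) / 2 + 1) * (\<Sum>v\<in>V. 1 / sqrt (hess_det v) * q v)"
proof -
  let ?g = "\<lambda>x. real_of_ereal (h x)"
  obtain c r where c: "0 < c" and r: "0 < r"
    and cube: "\<And>v. v \<in> V \<Longrightarrow> ball v r \<subseteq> angle_cube"
    and disj: "disjoint_family_on (\<lambda>v. ball v r) V"
    and fin: "\<And>v x. v \<in> V \<Longrightarrow> x \<in> ball v r \<Longrightarrow> \<bar>h x\<bar> \<noteq> \<infinity>"
    and cd: "\<And>v. v \<in> V \<Longrightarrow> cont_diff_on 3 ?g (ball v r)"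
    and growth: "\<And>v y. v \<in> V \<Longrightarrow> norm y < r \<Longrightarrow> c * (norm y)\<^sup>2 \<le> ?g (v + y) - \<mu>"
    by (rule ex_good_radius) blast
  obtain e0 where e0: "e0 > 0" "\<And>e. e < e0 \<Longrightarrow> sublevel e \<subseteq> (\<Union>v\<in>V. ball v r)"
    using sublevel_near_minimizers[OF r] by blast
  have [measurable]: "ball v r \<in> sets borel" for v by simp
  have gV: "?g v = \<mu>" if "v \<in> V" for v using that V_def by simp
  have g_min: "?g v \<le> ?g x" if "v \<in> V" "x \<in> ball v r" for v x
    using min_value[of x] fin[OF that] cube[OF that(1)] that gV[OF that(1)] by (cases "h x") auto
  have local: "sublevel e \<inter> ball v r = {x \<in> ball v r. ?g x \<le> ?g v + e}" if v: "v \<in> V" for v e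
  proof -
    have "h x \<le> ereal (\<mu> + e) \<longleftrightarrow> ?g x \<le> \<mu> + e" if "x \<in> ball v r" for x
      using fin[OF v that] by (cases "h x") auto
    then show ?thesis using cube[OF v] by (auto simp: sublevel_def gV[OF v])
  qed
  have "(\<lambda>n. \<Sum>v\<in>V. (\<integral>x. q x * indicator {x \<in> ball v r. ?g x \<le> ?g v + e n} x \<partial>lborel) / e n powr (CARD('n) / 2))
    \<longlonglongrightarrow> (\<Sum>v\<in>V. (2 * pi) powr (CARD('n) / 2) / Gamma (CARD('n) / 2 + 1) * (1 / sqrt (hess_det v) * q v))"
    unfolding hess_det_def
  proof (rule tendsto_sum)
    fix v assume v: "v \<in> V"
    have growth': "c * (norm y)\<^sup>2 \<le> ?g (v + y) - ?g v" if "norm y < r" for y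
      using growth[OF v that] by (simp only: gV[OF v])
    show "(\<lambda>n. (\<integral>x. q x * indicator {x \<in> ball v r. ?g x \<le> ?g v + e n} x \<partial>lborel) / e n powr (CARD('n) / 2))
      \<longlonglongrightarrow> (2 * pi) powr (CARD('n) / 2) / Gamma (CARD('n) / 2 + 1) * (1 / sqrt (det (hessian ?g v)) * q v)"
      by (rule local_sublevel_integral_limit[OF r cd[OF v] g_min[OF v] nondegenerate[OF v] c r order_refl
            growth' q(1)[OF v] q(2) assms(3) e])
  qed
  moreover have "\<forall>\<^sub>F n in sequentially.
      (\<Sum>v\<in>V. (\<integral>x. q x * indicator {x \<in> ball v r. ?g x \<le> ?g v + e n} x \<partial>lborel) / e n powr (CARD('n) / 2))
      = (\<integral>x. q x * indicator (sublevel (e n)) x \<partial>lborel) / e n powr (CARD('n) / 2)"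
    using order_tendstoD(2)[OF e(2) e0(1)]
  proof eventually_elim
    case (elim n)
    have ind: "indicat_real (sublevel (e n)) x = (\<Sum>v\<in>V. indicator (sublevel (e n) \<inter> ball v r) x)" for x
    proof -
      have "disjoint_family_on (\<lambda>v. sublevel (e n) \<inter> ball v r) V"
        using disj by (auto simp: disjoint_family_on_def)
      then have "indicat_real (\<Union>v\<in>V. sublevel (e n) \<inter> ball v r) x = (\<Sum>v\<in>V. indicator (sublevel (e n) \<inter> ball v r) x)"
        by (intro indicator_UN_disjoint finite_V)
      also have "(\<Union>v\<in>V. sublevel (e n) \<inter> ball v r) = sublevel (e n)" using e0(2)[OF elim] by auto
      finally show ?thesis .
    qed
    have int: "integrable lborel (\<lambda>x. q x * indicator (sublevel (e n) \<inter> ball v r) x)" for v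
    proof (rule Bochner_Integration.integrable_bound)
      show "integrable lborel (\<lambda>x. B * indicator (sublevel (e n) \<inter> ball v r) x)"
        by (intro integrable_mult_right integrable_real_indicator emeasure_bounded_finite) (auto intro: bounded_Int)
      show "AE x in lborel. norm (q x * indicator (sublevel (e n) \<inter> ball v r) x)
          \<le> norm (B * indicator (sublevel (e n) \<inter> ball v r) x)"
        using q(2) by (intro AE_I2) (auto simp: indicator_def intro: order_trans abs_ge_self)
    qed measurable
    have "(\<integral>x. q x * indicator (sublevel (e n)) x \<partial>lborel)
        = (\<Sum>v\<in>V. \<integral>x. q x * indicator (sublevel (e n) \<inter> ball v r) x \<partial>lborel)"
      unfolding ind sum_distrib_left by (intro Bochner_Integration.integral_sum int)
    then show ?case by (simp add: local sum_divide_distrib)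
  qed
  ultimately show ?thesis
    unfolding sum_distrib_left by (rule Lim_transform_eventually)
qed

end

section \<open>Relative angles of random points\<close>

lemma borel_measurable_Arg2pi [measurable]: "Arg2pi \<in> borel_measurable borel"
  by (rule borel_measurableI_le) (auto intro: borel_closed closed_Arg2pi2pi_le)

lemma borel_measurable_cis [measurable]: "cis \<in> borel_measurable borel"
  by (intro borel_measurable_continuous_onI continuous_on_cis continuous_on_id)

lemma Arg2pi_cis:
  assumes "0 \<le> b" "b < 2 * pi"
  shows "Arg2pi (cis b) = b"
  using assms by (intro Arg2pi_unique[of 1]) (auto simp: cis_conv_exp)

lemma cis_Arg2pi: "norm z = 1 \<Longrightarrow> cis (Arg2pi z) = z"
  using complex_norm_eq_1_exp[of z] by (simp add: cis_conv_exp)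

text \<open>The part of the shifted window that sticks out beyond \<open>T\<close> is moved back by
  one period.\<close>

lemma nn_integral_periodic_shift:
  fixes F :: "real \<Rightarrow> ennreal"
  assumes [measurable]: "F \<in> borel_measurable borel" and per: "\<And>y. F (y + T) = F y"
    and x: "0 \<le> x" "x \<le> T"
  shows "(\<integral>\<^sup>+y. F y * indicator {0..<T} y \<partial>lborel) = (\<integral>\<^sup>+b. F (x + b) * indicator {0..<T} b \<partial>lborel)"
proof -
  have shift: "(\<integral>\<^sup>+y. G y \<partial>lborel) = (\<integral>\<^sup>+y. G (a + y) \<partial>lborel)"
    if [measurable]: "G \<in> borel_measurable borel" for G :: "real \<Rightarrow> ennreal" and a
    using nn_integral_real_affine[of G 1 a] by simp
  have "(\<integral>\<^sup>+b. F (x + b) * indicator {0..<T} b \<partial>lborel)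
      = (\<integral>\<^sup>+b. F (x + b) * indicator {0..<T} (x + b - x) \<partial>lborel)" by simp
  also have "\<dots> = (\<integral>\<^sup>+y. F y * indicator {0..<T} (y - x) \<partial>lborel)"
    by (rule shift[symmetric]) measurable
  also have "\<dots> = (\<integral>\<^sup>+y. F y * indicator {x..<T} y + F y * indicator {T..<T + x} y \<partial>lborel)"
    using x by (intro nn_integral_cong) (auto simp: indicator_def)
  also have "\<dots> = (\<integral>\<^sup>+y. F y * indicator {x..<T} y \<partial>lborel) + (\<integral>\<^sup>+y. F y * indicator {T..<T + x} y \<partial>lborel)"
    by (intro nn_integral_add) measurable
  also have "(\<integral>\<^sup>+y. F y * indicator {T..<T + x} y \<partial>lborel)
      = (\<integral>\<^sup>+y. F (T + y) * indicator {T..<T + x} (T + y) \<partial>lborel)"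
    by (rule shift) measurable
  also have "\<dots> = (\<integral>\<^sup>+y. F y * indicator {0..<x} y \<partial>lborel)"
    using per by (intro nn_integral_cong) (auto simp: indicator_def add.commute)
  also have "(\<integral>\<^sup>+y. F y * indicator {x..<T} y \<partial>lborel) + (\<integral>\<^sup>+y. F y * indicator {0..<x} y \<partial>lborel)
      = (\<integral>\<^sup>+y. F y * indicator {x..<T} y + F y * indicator {0..<x} y \<partial>lborel)"
    by (intro nn_integral_add[symmetric]) measurable
  also have "\<dots> = (\<integral>\<^sup>+y. F y * indicator {0..<T} y \<partial>lborel)"
    using x by (intro nn_integral_cong) (auto simp: indicator_def)
  finally show ?thesis by simp
qed

lemma borel_measurable_vec_lambda:
  fixes f :: "'a \<Rightarrow> 'n::finite \<Rightarrow> real"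
  assumes "\<And>i. (\<lambda>x. f x i) \<in> borel_measurable M"
  shows "(\<lambda>x. \<chi> i. f x i) \<in> borel_measurable M"
  by (rule borel_measurable_euclidean_space[THEN iffD2])
    (auto simp: Basis_vec_def inner_axis assms)

lemma borel_measurable_vec_nth [measurable]: "(\<lambda>b::real^'n. b $ i) \<in> borel_measurable borel"
  by (intro borel_measurable_continuous_onI continuous_intros)

text \<open>Agreement on boxes characterises \<open>lborel\<close>. The identity links products over
  independent coordinates with Lebesgue measure on vectors, where the sublevel sets live.\<close>

lemma distr_PiM_lborel_vec:
  "distr (PiM UNIV (\<lambda>_::'n::finite. lborel)) borel (\<lambda>f. \<chi> i. f i) = (lborel :: (real^'n) measure)"
proof (rule lborel_eqI[symmetric])
  interpret product_sigma_finite "\<lambda>_::'n. lborel :: real measure"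
    by standard
  have meas [measurable]: "(\<lambda>f. \<chi> i. f i) \<in> borel_measurable (PiM UNIV (\<lambda>_::'n. lborel :: real measure))"
    by (intro borel_measurable_vec_lambda) measurable
  fix l u :: "real^'n" assume le: "\<And>b. b \<in> Basis \<Longrightarrow> l \<bullet> b \<le> u \<bullet> b"
  have le': "l $ i \<le> u $ i" for i using le[of "axis i 1"] by (simp add: inner_axis axis_in_Basis_iff)
  have "emeasure (distr (PiM UNIV (\<lambda>_::'n. lborel)) borel (\<lambda>f. \<chi> i. f i)) (box l u)
      = emeasure (PiM UNIV (\<lambda>_::'n. lborel)) (\<Pi>\<^sub>E i\<in>UNIV. {l $ i<..<u $ i})"
    by (subst emeasure_distr) (auto simp: mem_box_cart space_PiM PiE_UNIV_domain Pi_iff intro!: arg_cong2[where f = emeasure])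
  also have "\<dots> = (\<Prod>i\<in>UNIV. emeasure lborel {l $ i<..<u $ i})"
    by (rule emeasure_PiM) auto
  also have "\<dots> = ennreal (\<Prod>i\<in>UNIV. u $ i - l $ i)"
    using le' by (simp add: prod_ennreal)
  also have "(\<Prod>i\<in>UNIV. u $ i - l $ i) = (\<Prod>b\<in>Basis. (u - l) \<bullet> b)"
  proof -
    have B: "Basis = range (\<lambda>i::'n. axis i (1::real))" by (auto simp: Basis_vec_def)
    have "inj (\<lambda>i::'n. axis i (1::real))" by (auto simp: inj_on_def axis_eq_axis)
    then show ?thesis unfolding B by (subst prod.reindex) (auto simp: inner_axis)
  qed
  finally show "emeasure (distr (PiM UNIV (\<lambda>_::'n. lborel)) borel (\<lambda>f. \<chi> i. f i)) (box l u)
    = (\<Prod>b\<in>Basis. (u - l) \<bullet> b)" .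
qed simp

lemma PiM_density_lborel:
  fixes w :: "real \<Rightarrow> ennreal"
  assumes [measurable]: "w \<in> borel_measurable borel" and "prob_space (density lborel w)" and fin: "finite I"
  shows "PiM I (\<lambda>_. density lborel w) = density (PiM I (\<lambda>_. lborel)) (\<lambda>f. \<Prod>i\<in>I. w (f i))"
proof -
  interpret product_sigma_finite "\<lambda>_. lborel :: real measure"
    by standard
  interpret D: product_prob_space "\<lambda>_. density lborel w"
    by (rule product_prob_spaceI) (rule assms)
  show ?thesis
  proof (rule D.PiM_eqI[symmetric])
  fix A :: "'a \<Rightarrow> real set" assume A: "\<And>i. i \<in> I \<Longrightarrow> A i \<in> sets (density lborel w)"
  then have [measurable]: "Pi\<^sub>E I A \<in> sets (PiM I (\<lambda>_. lborel))" using fin by (intro sets_PiM_I_finite) auto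
  have "emeasure (density (PiM I (\<lambda>_. lborel)) (\<lambda>f. \<Prod>i\<in>I. w (f i))) (Pi\<^sub>E I A)
      = (\<integral>\<^sup>+f. (\<Prod>i\<in>I. w (f i)) * indicator (Pi\<^sub>E I A) f \<partial>PiM I (\<lambda>_. lborel))"
    by (subst emeasure_density) auto
  also have "\<dots> = (\<integral>\<^sup>+f. (\<Prod>i\<in>I. w (f i) * indicator (A i) (f i)) \<partial>PiM I (\<lambda>_. lborel))"
  proof (rule nn_integral_cong)
    fix f assume "f \<in> space (PiM I (\<lambda>_. lborel :: real measure))"
    then have "f \<in> Pi\<^sub>E I A \<longleftrightarrow> (\<forall>i\<in>I. f i \<in> A i)" by (auto simp: space_PiM PiE_def)
    then have "indicator (Pi\<^sub>E I A) f = (\<Prod>i\<in>I. indicator (A i) (f i) :: ennreal)"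
      using fin by (auto simp: indicator_def)
    then show "(\<Prod>i\<in>I. w (f i)) * indicator (Pi\<^sub>E I A) f = (\<Prod>i\<in>I. w (f i) * indicator (A i) (f i))"
      by (simp add: prod.distrib)
  qed
  also have "\<dots> = (\<Prod>i\<in>I. \<integral>\<^sup>+x. w x * indicator (A i) x \<partial>lborel)"
    using A fin by (intro product_nn_integral_prod[where f = "\<lambda>i x. w x * indicator (A i) x"]) auto
  also have "\<dots> = (\<Prod>i\<in>I. emeasure (density lborel w) (A i))"
    using A by (intro prod.cong refl) (auto simp: emeasure_density)
  finally show "emeasure (density (PiM I (\<lambda>_. lborel)) (\<lambda>f. \<Prod>i\<in>I. w (f i))) (Pi\<^sub>E I A)
    = (\<Prod>i\<in>I. emeasure (density lborel w) (A i))" .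
  qed (use fin in \<open>auto intro!: sets_PiM_cong\<close>)
qed

section \<open>Law of one random point and of the relative angles\<close>

locale circle_density =
  fixes p :: "real \<Rightarrow> real"
  assumes p_cont: "continuous_on UNIV p" and p_nonneg: "\<And>x. p x \<ge> 0"
    and p_per: "\<And>x. p (x + 2 * pi) = p x"
    and p_int: "(LBINT x:{0..2 * pi}. p x) = 1"
begin

text \<open>The half-open interval is the range of \<open>Arg2pi\<close>. The normalisation of
  \<open>p\<close> is an integral over the closed interval, which differs from it by a null
  set.\<close>

definition circle_law :: "real measure" where
  "circle_law = density lborel (\<lambda>x. ennreal (p x * indicator {0..<2 * pi} x))"

lemma p_meas [measurable]: "p \<in> borel_measurable borel"
  by (rule borel_measurable_continuous_onI[OF p_cont])

lemma sets_circle_law [simp, measurable_cong]: "sets circle_law = sets borel"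
  by (simp add: circle_law_def)

lemma space_circle_law [simp]: "space circle_law = UNIV"
  by (simp add: circle_law_def)

lemma p_bounded: obtains B where "B > 0" "\<And>x. p x \<le> B"
proof -
  have "compact (p ` {0..2 * pi})"
    by (intro compact_continuous_image continuous_on_subset[OF p_cont]) auto
  then obtain B where B: "\<And>x. x \<in> {0..2 * pi} \<Longrightarrow> \<bar>p x\<bar> \<le> B"
    using compact_imp_bounded bounded_iff by (metis imageI real_norm_def)
  have bd: "p x \<le> B" for x
  proof -
    define k where "k = \<lfloor>x / (2 * pi)\<rfloor>"
    have per: "p (y + real n * (2 * pi)) = p y" for y n
    proof (induction n)
      case (Suc n)
      have "y + real (Suc n) * (2 * pi) = (y + real n * (2 * pi)) + 2 * pi" by (simp add: algebra_simps)
      then show ?case using Suc p_per[of "y + real n * (2 * pi)"] by (simp only:)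
    qed simp
    have per_int: "p (y + of_int k * (2 * pi)) = p y" for y
    proof (cases "k \<ge> 0")
      case True
      then show ?thesis using per[of y "nat k"] by simp
    next
      case False
      then show ?thesis using per[of "y + of_int k * (2 * pi)" "nat (- k)"] by simp
    qed
    have "of_int k \<le> x / (2 * pi)" "x / (2 * pi) < of_int k + 1" by (auto simp: k_def)
    then have "0 \<le> x - of_int k * (2 * pi)" "x - of_int k * (2 * pi) \<le> 2 * pi"
      by (auto simp: field_simps)
    then have "\<bar>p (x - of_int k * (2 * pi))\<bar> \<le> B" by (intro B) auto
    then show ?thesis using per_int[of "x - of_int k * (2 * pi)"] by simp
  qed
  show thesis by (rule that[of "max B 1"]) (use bd in \<open>auto intro: le_max_iff_disj[THEN iffD2]\<close>)
qed

lemma nn_integral_circle_law: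
  assumes [measurable]: "F \<in> borel_measurable borel"
  shows "(\<integral>\<^sup>+x. F x \<partial>circle_law) = (\<integral>\<^sup>+x. ennreal (p x) * F x * indicator {0..<2 * pi} x \<partial>lborel)"
  unfolding circle_law_def
  by (subst nn_integral_density) (auto intro!: nn_integral_cong simp: indicator_def)

lemma p_integrable: "set_integrable lborel {0..2 * pi} p"
  by (intro borel_integrable_atLeastAtMost' continuous_on_subset[OF p_cont]) auto

lemma prob_space_circle_law: "prob_space circle_law"
proof
  have "emeasure circle_law (space circle_law) = (\<integral>\<^sup>+x. ennreal (p x * indicator {0..<2 * pi} x) \<partial>lborel)"
    unfolding circle_law_def by (subst emeasure_density) auto
  also have "\<dots> = (\<integral>\<^sup>+x. ennreal (indicator {0..2 * pi} x *\<^sub>R p x) \<partial>lborel)"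
  proof (rule nn_integral_cong_AE)
    show "AE x in lborel. ennreal (p x * indicator {0..<2 * pi} x) = ennreal (indicator {0..2 * pi} x *\<^sub>R p x)"
      using AE_lborel_singleton[of "2 * pi"] by eventually_elim (auto simp: indicator_def)
  qed
  also have "\<dots> = ennreal (LBINT x:{0..2 * pi}. p x)"
    using p_integrable unfolding set_lebesgue_integral_def set_integrable_def
    by (intro nn_integral_eq_integral) (auto simp: p_nonneg)
  finally show "emeasure circle_law (space circle_law) = 1" by (simp add: p_int)
qed

text \<open>The density of the counterclockwise angle from a point at angle \<open>x\<close> to a
  random point.\<close>

definition shifted_density :: "real \<Rightarrow> real \<Rightarrow> ennreal" where
  "shifted_density x b = ennreal (p (x + b)) * indicator {0..<2 * pi} b"

lemma shifted_density_meas [measurable]: "(\<lambda>(x, b). shifted_density x b) \<in> borel_measurable (borel \<Otimes>\<^sub>M borel)"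
  unfolding shifted_density_def by measurable

lemma shifted_density_meas' [measurable]: "shifted_density x \<in> borel_measurable borel"
  unfolding shifted_density_def by measurable

text \<open>The integrand depends on \<open>y\<close> only through \<open>cis y\<close> and the
  periodic \<open>p\<close>, so the period may be started at \<open>x\<close>, where the angle
  relative to \<open>x\<close> is just \<open>y - x\<close>.\<close>

lemma distr_circle_law_rotate:
  assumes x: "0 \<le> x" "x < 2 * pi"
  shows "distr circle_law borel (\<lambda>y. Arg2pi (cis y / cis x)) = density lborel (shifted_density x)"
proof (rule measure_eqI)
  fix A assume "A \<in> sets (distr circle_law borel (\<lambda>y. Arg2pi (cis y / cis x)))"
  then have [measurable]: "A \<in> sets borel" by simp
  define F where "F = (\<lambda>y. ennreal (p y) * indicator A (Arg2pi (cis y / cis x)))"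
  have [measurable]: "F \<in> borel_measurable borel" unfolding F_def by measurable
  have per: "F (y + 2 * pi) = F y" for y
    by (simp add: F_def p_per cis_mult[symmetric])
  have "emeasure (distr circle_law borel (\<lambda>y. Arg2pi (cis y / cis x))) A
    = (\<integral>\<^sup>+b. indicator A b \<partial>distr circle_law borel (\<lambda>y. Arg2pi (cis y / cis x)))" by simp
  also have "\<dots> = (\<integral>\<^sup>+y. indicator A (Arg2pi (cis y / cis x)) \<partial>circle_law)"
    by (rule nn_integral_distr) measurable
  also have "\<dots> = (\<integral>\<^sup>+y. F y * indicator {0..<2 * pi} y \<partial>lborel)"
    by (subst nn_integral_circle_law) (auto simp: F_def)
  also have "\<dots> = (\<integral>\<^sup>+b. F (x + b) * indicator {0..<2 * pi} b \<partial>lborel)"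
    using x by (intro nn_integral_periodic_shift per) auto
  also have "\<dots> = (\<integral>\<^sup>+b. shifted_density x b * indicator A b \<partial>lborel)"
  proof (rule nn_integral_cong)
    fix b :: real
    have "Arg2pi (cis (x + b) / cis x) = b" if "b \<in> {0..<2 * pi}"
      using that Arg2pi_cis[of b] by (simp add: cis_divide)
    then show "F (x + b) * indicator {0..<2 * pi} b = shifted_density x b * indicator A b"
      by (auto simp: F_def shifted_density_def indicator_def)
  qed
  also have "\<dots> = emeasure (density lborel (shifted_density x)) A" by (simp add: emeasure_density)
  finally show "emeasure (distr circle_law borel (\<lambda>y. Arg2pi (cis y / cis x))) A
    = emeasure (density lborel (shifted_density x)) A" .
qed simp

text \<open>With the first point fixed, the relative angles of the others are independent, each with
  density \<open>shifted_density x\<close>. The rotation acts coordinatewise on the product space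
  before the coordinates are collected in a vector.\<close>

lemma distr_PiM_circle_law_rotate:
  assumes x: "0 \<le> x" "x < 2 * pi"
  shows "distr (PiM UNIV (\<lambda>_::'n::finite. circle_law)) borel (\<lambda>y. \<chi> i. Arg2pi (cis (y i) / cis x))
    = density lborel (\<lambda>b::real^'n. \<Prod>i\<in>UNIV. shifted_density x (b $ i))"
proof -
  let ?rot = "\<lambda>y. Arg2pi (cis y / cis x)"
  have prob: "prob_space (density lborel (shifted_density x))"
    unfolding distr_circle_law_rotate[OF x, symmetric]
    by (intro prob_space.prob_space_distr prob_space_circle_law) measurable
  have "distr (PiM UNIV (\<lambda>_::'n. circle_law)) borel (\<lambda>y. \<chi> i. ?rot (y i))
     = distr (distr (PiM UNIV (\<lambda>_::'n. circle_law)) (PiM UNIV (\<lambda>_::'n. density lborel (shifted_density x)))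
         (compose UNIV ?rot)) borel (\<lambda>f. \<chi> i. f i)"
  proof (subst distr_distr)
    show "compose UNIV ?rot \<in> PiM UNIV (\<lambda>_::'n. circle_law) \<rightarrow>\<^sub>M PiM UNIV (\<lambda>_. density lborel (shifted_density x))"
      unfolding compose_def by measurable
  qed (auto simp: compose_def restrict_def comp_def intro!: borel_measurable_vec_lambda)
  also have "distr (PiM UNIV (\<lambda>_::'n. circle_law)) (PiM UNIV (\<lambda>_::'n. density lborel (shifted_density x)))
         (compose UNIV ?rot) = PiM UNIV (\<lambda>_::'n. distr circle_law (density lborel (shifted_density x)) ?rot)"
    by (rule distr_PiM_finite_prob_space') (auto intro: prob prob_space_circle_law)
  also have "distr circle_law (density lborel (shifted_density x)) ?rot = density lborel (shifted_density x)"
    by (subst distr_circle_law_rotate[OF x, symmetric]) (auto intro!: distr_cong)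
  also have "PiM UNIV (\<lambda>_::'n. density lborel (shifted_density x))
     = density (PiM UNIV (\<lambda>_. lborel)) (\<lambda>f. \<Prod>i\<in>UNIV. shifted_density x (f i))"
    by (rule PiM_density_lborel) (auto intro: prob)
  also have "distr \<dots> borel (\<lambda>f. \<chi> i. f i) = distr (density (PiM UNIV (\<lambda>_. lborel))
      ((\<lambda>b. \<Prod>i\<in>UNIV. shifted_density x (b $ i)) \<circ> (\<lambda>f. \<chi> i. f i))) borel (\<lambda>f. \<chi> i. f i)"
    by (simp add: comp_def)
  also have "\<dots> = density (distr (PiM UNIV (\<lambda>_::'n. lborel)) borel (\<lambda>f. \<chi> i. f i))
      (\<lambda>b. \<Prod>i\<in>UNIV. shifted_density x (b $ i))"
    unfolding comp_def by (rule density_distr[symmetric]) (auto intro!: borel_measurable_vec_lambda)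
  finally show ?thesis by (simp add: distr_PiM_lborel_vec)
qed

lemma AE_circle_law: "AE x in circle_law. 0 \<le> x \<and> x < 2 * pi"
  unfolding circle_law_def by (subst AE_density) (auto simp: indicator_def)

lemma shifted_prod_bounds:
  fixes b :: "real^'n"
  assumes "\<And>x. p x \<le> B" "B > 0"
  shows "0 \<le> p x * (\<Prod>l\<in>UNIV. p (x + b $ l))"
    and "p x * (\<Prod>l\<in>UNIV. p (x + b $ l)) \<le> B * B ^ CARD('n)"
proof -
  have "(\<Prod>l\<in>UNIV. p (x + b $ l)) \<le> (\<Prod>l\<in>(UNIV::'n set). B)"
    by (intro prod_mono) (auto simp: p_nonneg assms)
  then show "p x * (\<Prod>l\<in>UNIV. p (x + b $ l)) \<le> B * B ^ CARD('n)"
    using assms by (intro mult_mono) (auto simp: p_nonneg prod_nonneg)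
qed (simp add: p_nonneg prod_nonneg)

lemma shifted_prod_integrable:
  fixes b :: "real^'n"
  shows "set_integrable lborel {0..2 * pi} (\<lambda>x. p x * (\<Prod>l\<in>UNIV. p (x + b $ l)))"
  by (intro borel_integrable_atLeastAtMost' continuous_intros continuous_on_compose2[OF p_cont]) auto

lemma nn_integral_shifted_prod:
  fixes b :: "real^'n"
  shows "(\<integral>\<^sup>+x. ennreal (p x) * (\<Prod>l\<in>UNIV. ennreal (p (x + b $ l))) * indicator {0..<2 * pi} x \<partial>lborel)
    = ennreal (shifted_integral p b)"
proof -
  let ?F = "\<lambda>x. p x * (\<Prod>l\<in>UNIV. p (x + b $ l))"
  have "(\<integral>\<^sup>+x. ennreal (p x) * (\<Prod>l\<in>UNIV. ennreal (p (x + b $ l))) * indicator {0..<2 * pi} x \<partial>lborel)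
      = (\<integral>\<^sup>+x. ennreal (indicator {0..2 * pi} x *\<^sub>R ?F x) \<partial>lborel)"
  proof (rule nn_integral_cong_AE)
    show "AE x in lborel. ennreal (p x) * (\<Prod>l\<in>UNIV. ennreal (p (x + b $ l))) * indicator {0..<2 * pi} x
        = ennreal (indicator {0..2 * pi} x *\<^sub>R ?F x)"
      using AE_lborel_singleton[of "2 * pi"]
      by eventually_elim (auto simp: indicator_def p_nonneg prod_ennreal ennreal_mult prod_nonneg)
  qed
  also have "\<dots> = ennreal (LBINT x:{0..2 * pi}. ?F x)"
    using shifted_prod_integrable[of b] unfolding set_lebesgue_integral_def set_integrable_def
    by (intro nn_integral_eq_integral) (auto simp: p_nonneg prod_nonneg)
  finally show ?thesis by (simp add: shifted_integral_def)
qed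

lemma shifted_integral_nonneg: "0 \<le> shifted_integral p b"
  unfolding shifted_integral_def set_lebesgue_integral_def
  by (intro Bochner_Integration.integral_nonneg) (simp add: p_nonneg prod_nonneg)

lemma shifted_integral_bounded: obtains C where "\<And>b :: real^'n. \<bar>shifted_integral p b\<bar> \<le> C"
proof -
  obtain B where B: "B > 0" "\<And>x. p x \<le> B" using p_bounded by blast
  have "shifted_integral p b \<le> (LBINT x:{0..2 * pi}. B * B ^ CARD('n))" for b :: "real^'n"
    unfolding shifted_integral_def
    by (intro set_integral_mono shifted_prod_integrable shifted_prod_bounds B)
      (auto intro!: borel_integrable_atLeastAtMost')
  then have "\<bar>shifted_integral p b\<bar> \<le> (LBINT x:{0..2 * pi}. B * B ^ CARD('n))" for b :: "real^'n"
    using shifted_integral_nonneg[of b] by simp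
  then show thesis by (rule that)
qed

lemma shifted_integral_isCont: "isCont (shifted_integral p) (v :: real^'n)"
proof (subst continuous_at_sequentially, intro allI impI)
  fix b :: "nat \<Rightarrow> real^'n" assume b: "b \<longlonglongrightarrow> v"
  obtain B where B: "B > 0" "\<And>x. p x \<le> B" using p_bounded by blast
  have "(\<lambda>k. \<integral>x. indicator {0..2 * pi} x *\<^sub>R (p x * (\<Prod>l\<in>UNIV. p (x + b k $ l))) \<partial>lborel)
    \<longlonglongrightarrow> (\<integral>x. indicator {0..2 * pi} x *\<^sub>R (p x * (\<Prod>l\<in>UNIV. p (x + v $ l))) \<partial>lborel)"
  proof (rule integral_dominated_convergence)
    show "integrable lborel (\<lambda>x. indicator {0..2 * pi} x *\<^sub>R (B * B ^ CARD('n)))"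
      using borel_integrable_atLeastAtMost'[of 0 "2 * pi" "\<lambda>_. B * B ^ CARD('n)"]
      by (simp add: set_integrable_def)
    have "isCont p y" for y using p_cont by (simp add: continuous_on_eq_continuous_at)
    then have "(\<lambda>k. p (x + b k $ l)) \<longlonglongrightarrow> p (x + v $ l)" for x l
      by (rule isCont_tendsto_compose) (intro tendsto_intros b)
    then show "AE x in lborel. (\<lambda>k. indicator {0..2 * pi} x *\<^sub>R (p x * (\<Prod>l\<in>UNIV. p (x + b k $ l))))
      \<longlonglongrightarrow> indicator {0..2 * pi} x *\<^sub>R (p x * (\<Prod>l\<in>UNIV. p (x + v $ l)))"
      by (intro AE_I2 tendsto_intros)
    show "AE x in lborel. norm (indicator {0..2 * pi} x *\<^sub>R (p x * (\<Prod>l\<in>UNIV. p (x + b k $ l))))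
      \<le> indicator {0..2 * pi} x *\<^sub>R (B * B ^ CARD('n))" for k
      using shifted_prod_bounds[OF B(2,1), of _ "b k"] by (intro AE_I2) (auto simp: indicator_def)
  qed measurable
  then show "(shifted_integral p \<circ> b) \<longlonglongrightarrow> shifted_integral p v"
    by (simp add: comp_def shifted_integral_def[abs_def] set_lebesgue_integral_def)
qed

lemma shifted_integral_meas [measurable]: "(shifted_integral p :: real^'n \<Rightarrow> real) \<in> borel_measurable borel"
  by (intro borel_measurable_continuous_onI continuous_at_imp_continuous_on ballI shifted_integral_isCont)

text \<open>For a first point at angle \<open>x\<close> the relative angles have as density the
  product of the \<open>p (x + b $ i)\<close> on the half-open cube. Tonelli's theorem allows
  \<open>x\<close> to be integrated out first, with weight \<open>p x\<close>, and this leaves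
  \<open>shifted_integral p b\<close>.\<close>

lemma rel_angles_circle_law:
  fixes S :: "(real^'n) set"
  assumes [measurable]: "S \<in> sets borel"
  shows "(\<integral>\<^sup>+\<theta>. indicator S (rel_angles (\<lambda>i. cis (\<theta> i))) \<partial>PiM UNIV (\<lambda>_::'n option. circle_law))
    = (\<integral>\<^sup>+b. ennreal (shifted_integral p b) * indicator (S \<inter> {b. \<forall>i. b $ i \<in> {0..<2 * pi}}) b \<partial>lborel)"
proof -
  interpret P: product_prob_space "\<lambda>_. circle_law"
    by (rule product_prob_spaceI) (rule prob_space_circle_law)
  let ?rot = "\<lambda>x y. Arg2pi (cis y / cis x)"
  define f where "f = (\<lambda>\<theta>::'n option \<Rightarrow> real. indicator S (\<chi> i. ?rot (\<theta> None) (\<theta> (Some i))) :: ennreal)"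
  define Q where "Q = (\<lambda>x. \<integral>\<^sup>+b. (\<Prod>i\<in>UNIV. shifted_density x (b $ i)) * indicator S b \<partial>lborel)"
  \<comment> \<open>The first point is split off as the coordinate \<open>None\<close>; the
    remaining ones are reindexed from \<open>range Some\<close> to \<open>'n\<close> below.\<close>
  have U: "UNIV = insert None (range (Some :: 'n \<Rightarrow> _))" by (auto simp: UNIV_option_conv)
  have f_meas [measurable]: "f \<in> borel_measurable (PiM (insert None (range Some)) (\<lambda>_. circle_law))"
    unfolding f_def
    by (intro measurable_compose[OF borel_measurable_vec_lambda borel_measurable_indicator]) measurable
  have [measurable]: "S \<in> sets lborel" by simp
  have Q_meas [measurable]: "Q \<in> borel_measurable borel" unfolding Q_def by measurable
  have inner: "(\<integral>\<^sup>+y. f (y(None := x)) \<partial>PiM (range Some) (\<lambda>_. circle_law)) = Q x"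
    if x: "0 \<le> x \<and> x < 2 * pi" for x
  proof -
    have "(\<integral>\<^sup>+y. f (y(None := x)) \<partial>PiM (range Some) (\<lambda>_. circle_law))
        = (\<integral>\<^sup>+y. indicator S (\<chi> i. ?rot x ((\<lambda>n\<in>UNIV. y (Some n)) i)) \<partial>PiM (range Some) (\<lambda>_. circle_law))"
      by (simp add: f_def)
    also have "\<dots> = (\<integral>\<^sup>+y. indicator S (\<chi> i. ?rot x (y i))
        \<partial>distr (PiM (range Some) (\<lambda>_. circle_law)) (PiM UNIV (\<lambda>_. circle_law)) (\<lambda>\<omega>. \<lambda>n\<in>UNIV. \<omega> (Some n)))"
      by (intro nn_integral_distr[symmetric] measurable_restrict
          measurable_compose[OF borel_measurable_vec_lambda borel_measurable_indicator]) measurable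
    also have "distr (PiM (range Some) (\<lambda>_. circle_law)) (PiM UNIV (\<lambda>_. circle_law)) (\<lambda>\<omega>. \<lambda>n\<in>UNIV. \<omega> (Some n))
        = PiM (UNIV :: 'n set) (\<lambda>_. circle_law)"
      by (rule distr_PiM_reindex) (auto intro: prob_space_circle_law)
    also have "(\<integral>\<^sup>+y. indicator S (\<chi> i. ?rot x (y i)) \<partial>PiM (UNIV :: 'n set) (\<lambda>_. circle_law))
        = (\<integral>\<^sup>+b. indicator S b \<partial>distr (PiM (UNIV :: 'n set) (\<lambda>_. circle_law)) borel (\<lambda>y. \<chi> i. ?rot x (y i)))"
      by (intro nn_integral_distr[symmetric] borel_measurable_vec_lambda borel_measurable_indicator) measurable
    also have "\<dots> = Q x"
      using x unfolding Q_def by (subst distr_PiM_circle_law_rotate) (auto simp: emeasure_density)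
    finally show ?thesis .
  qed
  have "(\<integral>\<^sup>+\<theta>. indicator S (rel_angles (\<lambda>i. cis (\<theta> i))) \<partial>PiM UNIV (\<lambda>_::'n option. circle_law))
      = (\<integral>\<^sup>+\<theta>. f \<theta> \<partial>PiM (insert None (range Some)) (\<lambda>_. circle_law))"
    by (simp add: f_def rel_angles_def U[symmetric])
  also have "\<dots> = (\<integral>\<^sup>+x. (\<integral>\<^sup>+y. f (y(None := x)) \<partial>PiM (range Some) (\<lambda>_. circle_law)) \<partial>circle_law)"
    by (rule P.product_nn_integral_insert_rev) auto
  also have "\<dots> = (\<integral>\<^sup>+x. Q x \<partial>circle_law)"
    using AE_circle_law by (intro nn_integral_cong_AE) (auto simp: inner)
  also have "\<dots> = (\<integral>\<^sup>+x. ennreal (p x) * Q x * indicator {0..<2 * pi} x \<partial>lborel)"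
    by (rule nn_integral_circle_law) measurable
  also have "\<dots> = (\<integral>\<^sup>+x. (\<integral>\<^sup>+b. ennreal (p x) * ((\<Prod>i\<in>UNIV. shifted_density x (b $ i)) * indicator S b)
      * indicator {0..<2 * pi} x \<partial>lborel) \<partial>lborel)"
  proof (rule nn_integral_cong)
    fix x
    have "(\<integral>\<^sup>+b. ennreal (p x) * ((\<Prod>i\<in>UNIV. shifted_density x (b $ i)) * indicator S b) * indicator {0..<2 * pi} x \<partial>lborel)
      = (\<integral>\<^sup>+b. ennreal (p x) * ((\<Prod>i\<in>UNIV. shifted_density x (b $ i)) * indicator S b) \<partial>lborel) * indicator {0..<2 * pi} x"
      by (rule nn_integral_multc) measurable
    also have "(\<integral>\<^sup>+b. ennreal (p x) * ((\<Prod>i\<in>UNIV. shifted_density x (b $ i)) * indicator S b) \<partial>lborel)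
      = ennreal (p x) * Q x"
      unfolding Q_def by (rule nn_integral_cmult) measurable
    finally show "ennreal (p x) * Q x * indicator {0..<2 * pi} x
      = (\<integral>\<^sup>+b. ennreal (p x) * ((\<Prod>i\<in>UNIV. shifted_density x (b $ i)) * indicator S b) * indicator {0..<2 * pi} x \<partial>lborel)"
      by (rule sym)
  qed
  also have "\<dots> = (\<integral>\<^sup>+b. (\<integral>\<^sup>+x. ennreal (p x) * ((\<Prod>i\<in>UNIV. shifted_density x (b $ i)) * indicator S b)
      * indicator {0..<2 * pi} x \<partial>lborel) \<partial>lborel)"
    by (rule lborel_pair.Fubini'[symmetric]) measurable
  also have "\<dots> = (\<integral>\<^sup>+b. ennreal (shifted_integral p b) * indicator (S \<inter> {b. \<forall>i. b $ i \<in> {0..<2 * pi}}) b \<partial>lborel)"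
  proof (rule nn_integral_cong)
    fix b :: "real^'n"
    let ?c = "indicator (S \<inter> {b. \<forall>i. b $ i \<in> {0..<2 * pi}}) b :: ennreal"
    have "(\<Prod>i\<in>UNIV. shifted_density x (b $ i)) * indicator S b = (\<Prod>i\<in>UNIV. ennreal (p (x + b $ i))) * ?c" for x
      by (auto simp: shifted_density_def indicator_def prod.distrib)
    then have "(\<integral>\<^sup>+x. ennreal (p x) * ((\<Prod>i\<in>UNIV. shifted_density x (b $ i)) * indicator S b) * indicator {0..<2 * pi} x \<partial>lborel)
      = (\<integral>\<^sup>+x. ennreal (p x) * (\<Prod>l\<in>UNIV. ennreal (p (x + b $ l))) * indicator {0..<2 * pi} x * ?c \<partial>lborel)"
      by (simp add: mult_ac)
    also have "\<dots> = ennreal (shifted_integral p b) * ?c"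
      unfolding nn_integral_shifted_prod[symmetric] by (rule nn_integral_multc) measurable
    finally show "(\<integral>\<^sup>+x. ennreal (p x) * ((\<Prod>i\<in>UNIV. shifted_density x (b $ i)) * indicator S b) * indicator {0..<2 * pi} x \<partial>lborel)
      = ennreal (shifted_integral p b) * ?c" .
  qed
  finally show ?thesis .
qed

text \<open>Rotation leaves the bound \<open>B\<close> on the density intact, so the estimate is
  uniform in the reference angle \<open>x\<close> and survives when that angle is itself
  random.\<close>

lemma emeasure_rotated_le:
  assumes B: "\<And>x. p x \<le> B" and [measurable]: "N \<in> sets borel"
  shows "(\<integral>\<^sup>+y. indicator N (Arg2pi (cis y / cis x)) \<partial>circle_law) \<le> ennreal B * emeasure lborel N"
proof -
  define x' where "x' = Arg2pi (cis x)"
  have x': "0 \<le> x'" "x' < 2 * pi" "cis x = cis x'"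
    using Arg2pi[of "cis x"] by (auto simp: x'_def cis_Arg2pi)
  have "(\<integral>\<^sup>+y. indicator N (Arg2pi (cis y / cis x)) \<partial>circle_law)
      = (\<integral>\<^sup>+b. indicator N b \<partial>distr circle_law borel (\<lambda>y. Arg2pi (cis y / cis x')))"
    unfolding x' by (subst nn_integral_distr) auto
  also have "\<dots> = (\<integral>\<^sup>+b. shifted_density x' b * indicator N b \<partial>lborel)"
    unfolding distr_circle_law_rotate[OF x'(1,2)] by (subst nn_integral_density) auto
  also have "\<dots> \<le> (\<integral>\<^sup>+b. ennreal B * indicator N b \<partial>lborel)"
    using B by (intro nn_integral_mono) (auto simp: shifted_density_def indicator_def ennreal_leI)
  also have "\<dots> = ennreal B * emeasure lborel N" by (simp add: nn_integral_cmult)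
  finally show ?thesis .
qed

end

text \<open>A sample point is recovered from its angle only for outcomes in \<open>space M\<close>,
  where it lies on the circle. Independence must therefore be transferred between functions that
  agree only there.\<close>

lemma (in prob_space) indep_var_cong_space:
  assumes "indep_var S X T Y" and "\<And>\<omega>. \<omega> \<in> space M \<Longrightarrow> X \<omega> = X' \<omega>" "\<And>\<omega>. \<omega> \<in> space M \<Longrightarrow> Y \<omega> = Y' \<omega>"
  shows "indep_var S X' T Y'"
proof -
  have "distr M S X = distr M S X'" "distr M T Y = distr M T Y'"
    "distr M (S \<Otimes>\<^sub>M T) (\<lambda>\<omega>. (X \<omega>, Y \<omega>)) = distr M (S \<Otimes>\<^sub>M T) (\<lambda>\<omega>. (X' \<omega>, Y' \<omega>))"
    using assms(2,3) by (auto intro!: distr_cong)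
  moreover have "X \<in> measurable M S \<longleftrightarrow> X' \<in> measurable M S" "Y \<in> measurable M T \<longleftrightarrow> Y' \<in> measurable M T"
    using assms(2,3) by (auto intro!: measurable_cong)
  ultimately show ?thesis using assms(1) unfolding indep_var_distribution_eq by simp
qed

section \<open>Independent samples on the circle\<close>

locale circle_sample = circle_density p + prob_space M for p :: "real \<Rightarrow> real" and M :: "'w measure" +
  fixes U :: "nat \<Rightarrow> 'w \<Rightarrow> complex"
  assumes U_circle: "\<And>i \<omega>. i \<ge> 1 \<Longrightarrow> \<omega> \<in> space M \<Longrightarrow> U i \<omega> \<in> sphere 0 1"
    and U_indep: "indep_vars (\<lambda>_. borel) U {1..}"
    and U_density: "\<And>i. i \<ge> 1 \<Longrightarrow> distributed M lborel (\<lambda>\<omega>. Arg2pi (U i \<omega>))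
                               (\<lambda>x. ennreal (p x * indicator {0..<2 * pi} x))"
begin

definition angle :: "nat \<Rightarrow> 'w \<Rightarrow> real" where
  "angle i \<omega> = Arg2pi (U i \<omega>)"

lemma cis_angle: "i \<ge> 1 \<Longrightarrow> \<omega> \<in> space M \<Longrightarrow> cis (angle i \<omega>) = U i \<omega>"
  using U_circle[of i \<omega>] by (simp add: angle_def cis_Arg2pi)

lemma indep_angles: "indep_vars (\<lambda>_. borel) angle {1..}"
  unfolding angle_def[abs_def] by (rule indep_vars_compose2[OF U_indep]) measurable

lemma angle_meas: "i \<ge> 1 \<Longrightarrow> angle i \<in> borel_measurable M"
  using indep_angles by (auto simp: indep_vars_def)

lemma distr_angle: "i \<ge> 1 \<Longrightarrow> distr M borel (angle i) = circle_law"
  using U_density[of i] unfolding distributed_def circle_law_def angle_def[abs_def]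
  by (metis distr_cong sets_lborel)

lemma distr_angles:
  assumes I: "finite I" "I \<noteq> {}" "I \<subseteq> {1..}"
  shows "distr M (PiM I (\<lambda>_. borel)) (\<lambda>\<omega>. \<lambda>i\<in>I. angle i \<omega>) = PiM I (\<lambda>_. circle_law)"
proof -
  have "distr M (PiM I (\<lambda>_. borel)) (\<lambda>\<omega>. \<lambda>i\<in>I. angle i \<omega>) = PiM I (\<lambda>i. distr M borel (angle i))"
    using indep_vars_iff_distr_eq_PiM'[OF I(2), of angle "\<lambda>_. borel"] indep_vars_subset[OF indep_angles I(3)]
      angle_meas I(3) by (auto simp: subset_iff)
  also have "\<dots> = PiM I (\<lambda>_. circle_law)" using I(3) by (intro PiM_cong) (auto simp: distr_angle)
  finally show ?thesis .
qed

lemma angles_meas: "I \<subseteq> {1..} \<Longrightarrow> (\<lambda>\<omega>. \<lambda>i\<in>I. angle i \<omega>) \<in> measurable M (PiM I (\<lambda>_. borel))"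
  by (intro measurable_restrict angle_meas) auto

lemma nn_integral_angles:
  assumes I: "finite I" "I \<noteq> {}" "I \<subseteq> {1..}" and F: "F \<in> borel_measurable (PiM I (\<lambda>_. borel))"
  shows "(\<integral>\<^sup>+\<omega>. F (\<lambda>i\<in>I. angle i \<omega>) \<partial>M) = (\<integral>\<^sup>+\<theta>. F \<theta> \<partial>PiM I (\<lambda>_. circle_law))"
  unfolding distr_angles[OF I, symmetric]
  by (rule nn_integral_distr[OF angles_meas[OF I(3)], symmetric]) (use F in simp)

lemma prob_rel_angles:
  fixes j :: "'n::finite option \<Rightarrow> nat" and S :: "(real^'n) set"
  assumes j: "inj j" "range j \<subseteq> {1..}" and [measurable]: "S \<in> sets borel" and cube: "S \<subseteq> angle_cube"
  shows "{\<omega> \<in> space M. rel_angles (\<lambda>i. U (j i) \<omega>) \<in> S} \<in> events"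
    and "prob {\<omega> \<in> space M. rel_angles (\<lambda>i. U (j i) \<omega>) \<in> S}
      = (\<integral>b. shifted_integral p b * indicator S b \<partial>lborel)"
proof -
  have [measurable]: "U (j i) \<in> borel_measurable M" for i
    using U_indep j(2) by (auto simp: indep_vars_def)
  have "(\<lambda>\<omega>. rel_angles (\<lambda>i. U (j i) \<omega>)) \<in> borel_measurable M"
    unfolding rel_angles_def by (intro borel_measurable_vec_lambda) measurable
  then show ev: "{\<omega> \<in> space M. rel_angles (\<lambda>i. U (j i) \<omega>) \<in> S} \<in> events" by measurable
  let ?I = "range j"
  let ?F = "\<lambda>\<theta>. indicator S (rel_angles (\<lambda>i. cis (\<theta> i))) :: ennreal"
  have F_meas: "?F \<in> borel_measurable (PiM UNIV (\<lambda>_. circle_law))"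
    unfolding rel_angles_def
    by (intro measurable_compose[OF borel_measurable_vec_lambda borel_measurable_indicator]) measurable
  have reidx: "(\<lambda>\<theta>. \<lambda>i\<in>UNIV. \<theta> (j i)) \<in> PiM ?I (\<lambda>_. circle_law) \<rightarrow>\<^sub>M PiM UNIV (\<lambda>_. circle_law)"
    by (intro measurable_restrict) measurable
  have "emeasure M {\<omega> \<in> space M. rel_angles (\<lambda>i. U (j i) \<omega>) \<in> S}
      = (\<integral>\<^sup>+\<omega>. indicator {\<omega> \<in> space M. rel_angles (\<lambda>i. U (j i) \<omega>) \<in> S} \<omega> \<partial>M)"
    using ev by simp
  also have "\<dots> = (\<integral>\<^sup>+\<omega>. ?F (\<lambda>i\<in>UNIV. (\<lambda>k\<in>?I. angle k \<omega>) (j i)) \<partial>M)"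
    using j(2) by (intro nn_integral_cong) (auto simp: indicator_def rel_angles_def cis_angle image_subset_iff)
  also have "\<dots> = (\<integral>\<^sup>+\<theta>. ?F (\<lambda>i\<in>UNIV. \<theta> (j i)) \<partial>PiM ?I (\<lambda>_. circle_law))"
    using measurable_compose[OF reidx F_meas] j(2)
    by (intro nn_integral_angles[where F = "\<lambda>\<theta>. ?F (\<lambda>i\<in>UNIV. \<theta> (j i))"])
      (auto cong: measurable_cong_sets sets_PiM_cong)
  also have "\<dots> = (\<integral>\<^sup>+\<theta>. ?F \<theta> \<partial>distr (PiM ?I (\<lambda>_. circle_law)) (PiM UNIV (\<lambda>_. circle_law)) (\<lambda>\<theta>. \<lambda>i\<in>UNIV. \<theta> (j i)))"
    by (rule nn_integral_distr[OF reidx, symmetric]) (use F_meas in simp)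
  also have "distr (PiM ?I (\<lambda>_. circle_law)) (PiM UNIV (\<lambda>_. circle_law)) (\<lambda>\<theta>. \<lambda>i\<in>UNIV. \<theta> (j i)) = PiM UNIV (\<lambda>_. circle_law)"
    by (rule distr_PiM_reindex) (use j in \<open>auto intro: prob_space_circle_law\<close>)
  also have "(\<integral>\<^sup>+\<theta>. ?F \<theta> \<partial>PiM UNIV (\<lambda>_. circle_law))
     = (\<integral>\<^sup>+b. ennreal (shifted_integral p b) * indicator (S \<inter> {b. \<forall>i. b $ i \<in> {0..<2 * pi}}) b \<partial>lborel)"
    by (rule rel_angles_circle_law) measurable
  also have "\<dots> = (\<integral>\<^sup>+b. ennreal (shifted_integral p b * indicator S b) \<partial>lborel)"
  proof (rule nn_integral_cong_AE)
    \<comment> \<open>Relative angles never equal \<open>2 * pi\<close>, while \<open>S\<close> may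
      meet the faces of the closed cube. The faces form a null set, so the two integrands agree
      almost everywhere.\<close>
    have "AE b in lborel. b \<notin> angle_cube - box 0 (\<chi> i. 2 * pi :: real^'n)"
    proof (rule AE_not_in)
      show "angle_cube - box 0 (\<chi> i. 2 * pi :: real^'n) \<in> null_sets lborel"
        using negligible_frontier_interval[of 0 "\<chi> i. 2 * pi :: real^'n"]
        by (auto simp: negligible_iff_null_sets angle_cube_def null_sets_def)
    qed
    then show "AE b in lborel. ennreal (shifted_integral p b) * indicator (S \<inter> {b. \<forall>i. b $ i \<in> {0..<2 * pi}}) b
        = ennreal (shifted_integral p b * indicator S b)"
    proof eventually_elim
      case (elim b)
      then have "b \<in> S \<Longrightarrow> \<forall>i. b $ i \<in> {0..<2 * pi}"
        using cube by (auto simp: mem_box_cart less_imp_le)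
      then show ?case by (auto simp: indicator_def)
    qed
  qed
  also have "\<dots> = ennreal (\<integral>b. shifted_integral p b * indicator S b \<partial>lborel)"
  proof (rule nn_integral_eq_integral)
    obtain C where C: "\<And>b :: real^'n. \<bar>shifted_integral p b\<bar> \<le> C" by (rule shifted_integral_bounded) blast
    show "integrable lborel (\<lambda>b. shifted_integral p b * indicator S b)"
    proof (rule Bochner_Integration.integrable_bound)
      have "bounded S" using bounded_subset[OF bounded_cbox cube[unfolded angle_cube_def]] .
      then show "integrable lborel (\<lambda>b. C * indicator S b)"
        by (intro integrable_mult_right integrable_real_indicator emeasure_bounded_finite) auto
      show "AE b in lborel. norm (shifted_integral p b * indicator S b) \<le> norm (C * indicator S b)"
        using C by (intro AE_I2) (auto simp: indicator_def intro: order_trans abs_ge_self)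
    qed measurable
  qed (simp add: shifted_integral_nonneg)
  finally show "prob {\<omega> \<in> space M. rel_angles (\<lambda>i. U (j i) \<omega>) \<in> S}
      = (\<integral>b. shifted_integral p b * indicator S b \<partial>lborel)"
    by (simp add: measure_def shifted_integral_nonneg Bochner_Integration.integral_nonneg)
qed

text \<open>Given the angles indexed by \<open>I\<close>, the points indexed by \<open>J\<close> are
  independent, and each falls into the copy of \<open>N\<close> rotated to the point
  \<open>c\<close> with probability at most \<open>B * L\<close>, wherever \<open>c\<close> lies.
  Tonelli's theorem on the product over \<open>I\<close> and \<open>J\<close> takes the place of
  conditioning.\<close>

lemma prob_joint_le:
  assumes I: "finite I" "I \<subseteq> {1..}" "c \<in> I" and J: "finite J" "J \<subseteq> {1..}" "I \<inter> J = {}"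
    and B: "\<And>x. p x \<le> B" "B \<ge> 0" and A: "A \<in> sets (PiM I (\<lambda>_. borel))"
    and [measurable]: "N \<in> sets borel" and N: "emeasure lborel N \<le> ennreal L" "L \<ge> 0"
  shows "prob {\<omega> \<in> space M. (\<lambda>i\<in>I. angle i \<omega>) \<in> A \<and> (\<forall>l\<in>J. Arg2pi (U l \<omega> / U c \<omega>) \<in> N)}
    \<le> prob {\<omega> \<in> space M. (\<lambda>i\<in>I. angle i \<omega>) \<in> A} * (B * L) ^ card J"
proof -
  interpret P: product_prob_space "\<lambda>_. circle_law"
    by (rule product_prob_spaceI) (rule prob_space_circle_law)
  define F where "F = (\<lambda>\<theta>. indicator A (restrict \<theta> I) * (\<Prod>l\<in>J. indicator N (Arg2pi (cis (\<theta> l) / cis (\<theta> c)))) :: ennreal)"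
  have [measurable]: "c \<in> I \<union> J" "\<And>l. l \<in> J \<Longrightarrow> l \<in> I \<union> J" using I by auto
  have A' [measurable]: "A \<in> sets (PiM I (\<lambda>_. circle_law))"
    using A by (simp cong: sets_PiM_cong)
  have "(\<lambda>\<theta>. restrict \<theta> I) \<in> measurable (PiM (I \<union> J) (\<lambda>_. circle_law)) (PiM I (\<lambda>_. circle_law))"
    by (rule measurable_restrict_subset) auto
  note [measurable] = measurable_compose[OF this borel_measurable_indicator[OF A']]
  have F_meas [measurable]: "F \<in> borel_measurable (PiM (I \<union> J) (\<lambda>_. circle_law))"
    unfolding F_def by measurable
  have "emeasure M {\<omega> \<in> space M. (\<lambda>i\<in>I. angle i \<omega>) \<in> A \<and> (\<forall>l\<in>J. Arg2pi (U l \<omega> / U c \<omega>) \<in> N)}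
     \<le> (\<integral>\<^sup>+\<omega>. F (\<lambda>i\<in>I \<union> J. angle i \<omega>) \<partial>M)"
  proof -
    have F_nn: "(\<lambda>\<omega>. F (\<lambda>i\<in>I \<union> J. angle i \<omega>)) \<in> borel_measurable M"
      using measurable_compose[OF angles_meas[of "I \<union> J"], of F borel] F_meas I J
      by (auto cong: measurable_cong_sets sets_PiM_cong)
    have eq: "F (\<lambda>i\<in>I \<union> J. angle i \<omega>)
      = indicator {\<omega> \<in> space M. (\<lambda>i\<in>I. angle i \<omega>) \<in> A \<and> (\<forall>l\<in>J. Arg2pi (U l \<omega> / U c \<omega>) \<in> N)} \<omega>"
      if \<omega>: "\<omega> \<in> space M" for \<omega>
    proof -
      have "restrict (\<lambda>i\<in>I \<union> J. angle i \<omega>) I = (\<lambda>i\<in>I. angle i \<omega>)" by auto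
      moreover have "(\<Prod>l\<in>J. indicator N (Arg2pi (cis ((\<lambda>i\<in>I \<union> J. angle i \<omega>) l) / cis ((\<lambda>i\<in>I \<union> J. angle i \<omega>) c))) :: ennreal)
         = (\<Prod>l\<in>J. indicator N (Arg2pi (U l \<omega> / U c \<omega>)))"
        using I J \<omega> by (intro prod.cong) (auto simp: cis_angle subset_iff)
      moreover have "(\<Prod>l\<in>J. indicator N (Arg2pi (U l \<omega> / U c \<omega>)) :: ennreal)
          = (if \<forall>l\<in>J. Arg2pi (U l \<omega> / U c \<omega>) \<in> N then 1 else 0)"
        using J by (auto simp: indicator_def)
      ultimately show ?thesis using \<omega> by (auto simp: F_def indicator_def)
    qed
    then have "(\<integral>\<^sup>+\<omega>. F (\<lambda>i\<in>I \<union> J. angle i \<omega>) \<partial>M)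
      = (\<integral>\<^sup>+\<omega>. indicator {\<omega> \<in> space M. (\<lambda>i\<in>I. angle i \<omega>) \<in> A \<and> (\<forall>l\<in>J. Arg2pi (U l \<omega> / U c \<omega>) \<in> N)} \<omega> \<partial>M)"
      by (rule nn_integral_cong)
    moreover have "{\<omega> \<in> space M. (\<lambda>i\<in>I. angle i \<omega>) \<in> A \<and> (\<forall>l\<in>J. Arg2pi (U l \<omega> / U c \<omega>) \<in> N)} 
      = {\<omega> \<in> space M. F (\<lambda>i\<in>I \<union> J. angle i \<omega>) = 1}"
      using eq by (auto simp: indicator_def split: if_splits)
    moreover have "{\<omega> \<in> space M. F (\<lambda>i\<in>I \<union> J. angle i \<omega>) = 1} \<in> events" using F_nn by measurable
    ultimately show ?thesis by simp
  qed
  also have "\<dots> = (\<integral>\<^sup>+\<theta>. F \<theta> \<partial>PiM (I \<union> J) (\<lambda>_. circle_law))"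
    using I J F_meas by (intro nn_integral_angles) (auto cong: measurable_cong_sets sets_PiM_cong)
  also have "\<dots> = (\<integral>\<^sup>+x. (\<integral>\<^sup>+y. F (merge I J (x, y)) \<partial>PiM J (\<lambda>_. circle_law)) \<partial>PiM I (\<lambda>_. circle_law))"
    using I J by (intro P.product_nn_integral_fold) auto
  also have "\<dots> \<le> (\<integral>\<^sup>+x. indicator A x * ennreal (B * L) ^ card J \<partial>PiM I (\<lambda>_. circle_law))"
  proof (rule nn_integral_mono)
    fix x assume x: "x \<in> space (PiM I (\<lambda>_. circle_law))"
    then have "restrict (merge I J (x, y)) I = x" for y
      using J by (auto simp: space_PiM restrict_def merge_def PiE_def extensional_def)
    moreover have "merge I J (x, y) c = x c" "\<And>l. l \<in> J \<Longrightarrow> merge I J (x, y) l = y l" for y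
      using I J by (auto simp: merge_def)
    ultimately have "(\<integral>\<^sup>+y. F (merge I J (x, y)) \<partial>PiM J (\<lambda>_. circle_law))
       = (\<integral>\<^sup>+y. indicator A x * (\<Prod>l\<in>J. indicator N (Arg2pi (cis (y l) / cis (x c)))) \<partial>PiM J (\<lambda>_. circle_law))"
      unfolding F_def by simp
    also have "\<dots> = indicator A x * (\<integral>\<^sup>+y. (\<Prod>l\<in>J. indicator N (Arg2pi (cis (y l) / cis (x c)))) \<partial>PiM J (\<lambda>_. circle_law))"
      by (intro nn_integral_cmult) measurable
    also have "(\<integral>\<^sup>+y. (\<Prod>l\<in>J. indicator N (Arg2pi (cis (y l) / cis (x c)))) \<partial>PiM J (\<lambda>_. circle_law))
      = (\<Prod>l\<in>J. \<integral>\<^sup>+y. indicator N (Arg2pi (cis y / cis (x c))) \<partial>circle_law)"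
      using J by (intro P.product_nn_integral_prod[where f = "\<lambda>l y. indicator N (Arg2pi (cis y / cis (x c)))"]) measurable
    also have "\<dots> \<le> (\<Prod>l\<in>J. ennreal (B * L))"
    proof (intro prod_mono_ennreal)
      have "(\<integral>\<^sup>+y. indicator N (Arg2pi (cis y / cis (x c))) \<partial>circle_law) \<le> ennreal B * emeasure lborel N"
        by (rule emeasure_rotated_le[OF B(1)]) measurable
      also have "\<dots> \<le> ennreal (B * L)"
        using N B(2) by (simp add: ennreal_mult mult_left_mono)
      finally show "(\<integral>\<^sup>+y. indicator N (Arg2pi (cis y / cis (x c))) \<partial>circle_law) \<le> ennreal (B * L)" .
    qed
    finally show "(\<integral>\<^sup>+y. F (merge I J (x, y)) \<partial>PiM J (\<lambda>_. circle_law)) \<le> indicator A x * ennreal (B * L) ^ card J"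
      by (simp add: mult_left_mono)
  qed
  also have "\<dots> = emeasure (PiM I (\<lambda>_. circle_law)) A * ennreal (B * L) ^ card J"
    by (simp add: nn_integral_multc)
  also have "emeasure (PiM I (\<lambda>_. circle_law)) A = emeasure M {\<omega> \<in> space M. (\<lambda>i\<in>I. angle i \<omega>) \<in> A}"
    unfolding distr_angles[OF I(1) _ I(2), symmetric, simplified]
    using I(3) A by (subst distr_angles[OF I(1) _ I(2), symmetric])
      (auto simp: emeasure_distr angles_meas[OF I(2)] vimage_def intro!: arg_cong2[where f = emeasure])
  finally have le: "ennreal (prob {\<omega> \<in> space M. (\<lambda>i\<in>I. angle i \<omega>) \<in> A \<and> (\<forall>l\<in>J. Arg2pi (U l \<omega> / U c \<omega>) \<in> N)})
    \<le> ennreal (prob {\<omega> \<in> space M. (\<lambda>i\<in>I. angle i \<omega>) \<in> A}) * ennreal (B * L) ^ card J"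
    unfolding emeasure_eq_measure .
  have "ennreal x * ennreal (B * L) ^ card J = ennreal (x * (B * L) ^ card J)" if "x \<ge> 0" for x
    using that B(2) N(2) by (subst ennreal_power) (simp_all add: ennreal_mult[symmetric])
  from le[unfolded this[OF measure_nonneg]] show ?thesis
    by (rule ennreal_le_iff[THEN iffD1, rotated]) (use B(2) N(2) in simp)
qed

end

section \<open>Poisson limit\<close>

text \<open>An index goes to the element of sorted \<open>A\<close> whose position is the rank of
  that index in its type. Such enumerations connect the minimum over increasing tuples with the sets
  that index the events.\<close>

lemma ex_strict_mono_onto:
  fixes A :: "nat set"
  assumes fin: "finite A" and card: "card A = CARD('a::{finite,linorder})"
  obtains j :: "'a::{finite,linorder} \<Rightarrow> nat" where "strict_mono j" "range j = A"
proof -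
  define r where "r = (\<lambda>x::'a. card {y. y < x})"
  define j where "j = (\<lambda>x. sorted_list_of_set A ! r x)"
  have len: "length (sorted_list_of_set A) = CARD('a)" using card by simp
  have r_less: "r x < CARD('a)" for x unfolding r_def by (rule psubset_card_mono) auto
  have r_mono: "r x < r y" if "x < y" for x y
    unfolding r_def using that by (intro psubset_card_mono) auto
  have j: "strict_mono j"
  proof (rule strict_monoI)
    fix x y :: 'a assume "x < y"
    then have "r x < r y" by (rule r_mono)
    moreover have "r y < length (sorted_list_of_set A)" using r_less[of y] by (simp only: len)
    ultimately show "j x < j y"
      unfolding j_def by (rule sorted_wrt_nth_less[OF strict_sorted_list_of_set])
  qed
  have "j x \<in> A" for x
    using nth_mem[of "r x" "sorted_list_of_set A"] r_less[of x] fin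
    by (simp only: len j_def set_sorted_list_of_set)
  then have "range j \<subseteq> A" by blast
  moreover have "card (range j) = card A"
    using card strict_mono_imp_inj_on[OF j] by (simp add: card_image)
  ultimately have "range j = A" by (rule card_subset_eq[OF fin])
  with j show thesis by (rule that)
qed

text \<open>Passing from \<open>m\<close> to \<open>Suc m\<close> multiplies the quotient by
  \<open>(1 - m / n) / Suc m\<close>, so the factorial builds up in the limit.\<close>

lemma binomial_over_power_limit: "(\<lambda>n. real (n choose m) / real n ^ m) \<longlonglongrightarrow> 1 / fact m"
proof (induction m)
  case 0
  then show ?case by simp
next
  case (Suc m)
  have step: "real (n choose Suc m) = real (n choose m) * (real n - real m) / real (Suc m)" for n
  proof (cases "m \<le> n")
    case True
    have "Suc m * (n choose Suc m) = (n - m) * (n choose m)"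
      by (simp only: binomial_absorption binomial_absorb_comp)
    then have "real (Suc m) * real (n choose Suc m) = (real n - real m) * real (n choose m)"
      using True by (metis of_nat_diff of_nat_mult)
    then show ?thesis by (simp add: field_simps)
  qed (simp add: binomial_eq_0)
  have "(\<lambda>n. (1 - real m / real n) / real (Suc m)) \<longlonglongrightarrow> (1 - 0) / real (Suc m)"
    by (intro tendsto_intros lim_const_over_n) simp
  from tendsto_mult[OF Suc this]
  have "(\<lambda>n. real (n choose m) / real n ^ m * ((1 - real m / real n) / real (Suc m))) \<longlonglongrightarrow> 1 / fact (Suc m)"
    by (simp add: mult_ac)
  moreover have "\<forall>\<^sub>F n in sequentially. real (n choose m) / real n ^ m * ((1 - real m / real n) / real (Suc m))
      = real (n choose Suc m) / real n ^ Suc m"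
    using eventually_gt_at_top[of 0] by eventually_elim (simp add: step field_simps)
  ultimately show ?case by (rule Lim_transform_eventually)
qed

lemma binomial_le_power: "n choose k \<le> n ^ k"
  by (cases "k \<le> n") (auto simp: binomial_le_pow binomial_eq_0)

text \<open>A set \<open>b\<close> is determined by \<open>b \<inter> a\<close>, one of
  \<open>2 ^ m\<close> subsets of \<open>a\<close>, together with \<open>b - a\<close>, for which at
  most \<open>n choose k\<close> choices exist.\<close>

lemma card_subsets_diff_le:
  assumes a: "finite a" "card a = m"
  shows "card {b. b \<subseteq> {1..n} \<and> card (b - a) = k} \<le> 2 ^ m * n ^ k"
proof -
  let ?T = "{T. T \<subseteq> {1..n} \<and> card T = k}"
  have "card {b. b \<subseteq> {1..n} \<and> card (b - a) = k} \<le> card (Pow a \<times> ?T)"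
  proof (rule card_inj_on_le)
    show "inj_on (\<lambda>b. (b \<inter> a, b - a)) {b. b \<subseteq> {1..n} \<and> card (b - a) = k}"
      by (auto simp: inj_on_def)
  qed (use a in auto)
  also have "\<dots> = 2 ^ m * (n choose k)"
    using a n_subsets[of "{1..n}" k] by (simp add: card_cartesian_product card_Pow)
  also have "n choose k \<le> n ^ k" by (rule binomial_le_power)
  finally show ?thesis by simp
qed

section \<open>Events indexed by subsets of the sample\<close>

locale symmetric_kernel_sample = nondegenerate_kernel h \<mu> V + circle_sample p M U
  for h :: "real ^ 'n::finite \<Rightarrow> ereal" and \<mu> V p and M :: "'w measure" and U +
  assumes symmetric: "\<And>u \<pi>. (\<And>i. u i \<in> sphere 0 1) \<Longrightarrow> bij \<pi> \<Longrightarrow>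
    h (rel_angles (u \<circ> \<pi>)) = h (rel_angles u)"
begin

definition tuples :: "nat \<Rightarrow> nat set set" where
  "tuples n = {a. a \<subseteq> {1..n} \<and> card a = Suc CARD('n)}"

text \<open>An arbitrary enumeration; by \<open>near_eq\<close> the event \<open>near e a\<close>
  does not depend on the choice.\<close>

definition enum :: "nat set \<Rightarrow> 'n option \<Rightarrow> nat" where
  "enum a = (SOME j. bij_betw j UNIV a)"

definition near :: "real \<Rightarrow> nat set \<Rightarrow> 'w set" where
  "near e a = {\<omega> \<in> space M. rel_angles (\<lambda>i. U (enum a i) \<omega>) \<in> sublevel e}"

text \<open>The common probability of all the events \<open>near e a\<close>, as
  \<open>near_events\<close> shows.\<close>

definition hit :: "real \<Rightarrow> real" where
  "hit e = (\<integral>b. shifted_integral p b * indicator (sublevel e) b \<partial>lborel)"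

lemma tuplesD:
  assumes "a \<in> tuples n"
  shows "finite a" "a \<subseteq> {1..}" "a \<subseteq> {1..n}" "card a = Suc CARD('n)" "a \<noteq> {}"
  using assms by (auto simp: tuples_def intro: finite_subset)

lemma finite_tuples: "finite (tuples n)" by (simp add: tuples_def)

lemma card_tuples: "card (tuples n) = n choose Suc CARD('n)"
  unfolding tuples_def using n_subsets[of "{1..n}"] by simp

lemma enum_bij:
  assumes "a \<in> tuples n"
  shows "bij_betw (enum a) UNIV a"
proof -
  have "\<exists>j :: 'n option \<Rightarrow> nat. bij_betw j UNIV a"
    using tuplesD[OF assms] by (intro finite_same_card_bij) (auto simp: card_UNIV_option)
  then show ?thesis unfolding enum_def by (rule someI_ex)
qed

lemma rel_angles_in_cube: "rel_angles u \<in> angle_cube"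
  using Arg2pi by (auto simp: rel_angles_def angle_cube_def mem_box_cart less_imp_le)

text \<open>Two enumerations of \<open>a\<close> differ by a permutation of the index type, which
  does not change the kernel. The increasing enumeration serves the minimum, and one starting at a
  prescribed point serves overlapping subsets.\<close>

lemma near_eq:
  fixes j :: "'n option \<Rightarrow> nat"
  assumes a: "a \<in> tuples n" and j: "inj j" "range j = a"
  shows "near e a = {\<omega> \<in> space M. h (rel_angles (\<lambda>i. U (j i) \<omega>)) \<le> ereal (\<mu> + e)}"
proof -
  define \<pi> where "\<pi> = inv_into UNIV (enum a) \<circ> j"
  have bij_j: "bij_betw j UNIV a" using j by (simp add: bij_betw_def)
  have "bij \<pi>" unfolding \<pi>_def
    using bij_j bij_betw_inv_into[OF enum_bij[OF a]] by (rule bij_betw_trans)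
  have "enum a (\<pi> i) = j i" for i
    using enum_bij[OF a] j by (auto simp: \<pi>_def bij_betw_inv_into_right)
  then have eq: "(\<lambda>i. U (j i) \<omega>) = (\<lambda>i. U (enum a i) \<omega>) \<circ> \<pi>" for \<omega>
    by (simp add: fun_eq_iff)
  have "U (enum a i) \<omega> \<in> sphere 0 1" if "\<omega> \<in> space M" for i \<omega>
    using that tuplesD(2)[OF a] enum_bij[OF a] by (intro U_circle) (auto dest: bij_betw_apply)
  then have "h (rel_angles (\<lambda>i. U (j i) \<omega>)) = h (rel_angles (\<lambda>i. U (enum a i) \<omega>))" if "\<omega> \<in> space M" for \<omega>
    unfolding eq using that \<open>bij \<pi>\<close> by (intro symmetric)
  then show ?thesis by (auto simp: near_def sublevel_def rel_angles_in_cube)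
qed

lemma sublevel_subset_cube: "sublevel e \<subseteq> angle_cube" by (auto simp: sublevel_def)

lemma near_events:
  assumes a: "a \<in> tuples n"
  shows "near e a \<in> events" "prob (near e a) = hit e"
proof -
  have j: "inj (enum a)" "range (enum a) \<subseteq> {1..}"
    using enum_bij[OF a] tuplesD(2)[OF a] by (auto simp: bij_betw_def)
  show "near e a \<in> events" "prob (near e a) = hit e"
    unfolding near_def hit_def using prob_rel_angles[OF j sets_sublevel sublevel_subset_cube] by auto
qed

lemma hit_nonneg: "hit e \<ge> 0"
  unfolding hit_def by (intro Bochner_Integration.integral_nonneg) (simp add: shifted_integral_nonneg)

text \<open>The indicator of \<open>near e a\<close> as a function of the angles. It reads only
  coordinates in \<open>a\<close>, so events over disjoint index sets become functions of disjoint
  blocks of independent variables.\<close>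

definition near_ind :: "real \<Rightarrow> nat set \<Rightarrow> (nat \<Rightarrow> real) \<Rightarrow> real" where
  "near_ind e a \<theta> = indicator (sublevel e) (rel_angles (\<lambda>i. cis (\<theta> (enum a i))))"

lemma near_ind_meas:
  assumes a: "a \<in> tuples n" and I: "a \<subseteq> I"
  shows "near_ind e a \<in> borel_measurable (PiM I (\<lambda>_. borel))"
proof -
  have [measurable]: "enum a i \<in> I" for i using enum_bij[OF a] I by (auto dest: bij_betw_apply)
  show ?thesis
    unfolding near_ind_def[abs_def] rel_angles_def
    by (intro measurable_compose[OF borel_measurable_vec_lambda borel_measurable_indicator]) measurable
qed

lemma near_ind_angles:
  assumes a: "a \<in> tuples n" and I: "a \<subseteq> I" and \<omega>: "\<omega> \<in> space M"
  shows "near_ind e a (\<lambda>i\<in>I. angle i \<omega>) = indicator (near e a) \<omega>"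
proof -
  have "enum a i \<in> a" for i using enum_bij[OF a] by (auto dest: bij_betw_apply)
  then have "cis ((\<lambda>i\<in>I. angle i \<omega>) (enum a i)) = U (enum a i) \<omega>" for i
    using I \<omega> tuplesD(2)[OF a] by (auto simp: subset_iff intro!: cis_angle)
  then show ?thesis using \<omega> by (simp add: near_ind_def near_def indicator_def)
qed

lemma indep_near:
  assumes a: "a \<in> tuples n"
  shows "indep_var borel (indicat_real (near e a))
    borel (\<lambda>\<omega>. \<Sum>b\<in>{b \<in> tuples n. b \<inter> a = {}}. indicat_real (near e b) \<omega>)"
proof (rule indep_var_cong_space)
  let ?J = "{1..n} - a" and ?T = "{b \<in> tuples n. b \<inter> a = {}}"
  have sub: "b \<subseteq> ?J" if "b \<in> ?T" for b using that tuplesD(3) by blast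
  show "indep_var borel (near_ind e a \<circ> (\<lambda>\<omega>. \<lambda>i\<in>a. angle i \<omega>))
    borel ((\<lambda>\<theta>. \<Sum>b\<in>?T. near_ind e b \<theta>) \<circ> (\<lambda>\<omega>. \<lambda>i\<in>?J. angle i \<omega>))"
  proof (rule indep_var_compose[OF indep_var_restrict[OF indep_angles]])
    show "(\<lambda>\<theta>. \<Sum>b\<in>?T. near_ind e b \<theta>) \<in> borel_measurable (PiM ?J (\<lambda>_. borel))"
      using sub by (intro borel_measurable_sum near_ind_meas[where n = n]) auto
    show "near_ind e a \<in> borel_measurable (PiM a (\<lambda>_. borel))" by (rule near_ind_meas[OF a]) simp
  qed (use tuplesD[OF a] in auto)
  fix \<omega> assume \<omega>: "\<omega> \<in> space M"
  show "(near_ind e a \<circ> (\<lambda>\<omega>. \<lambda>i\<in>a. angle i \<omega>)) \<omega> = indicat_real (near e a) \<omega>"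
    using near_ind_angles[OF a _ \<omega>] by simp
  show "((\<lambda>\<theta>. \<Sum>b\<in>?T. near_ind e b \<theta>) \<circ> (\<lambda>\<omega>. \<lambda>i\<in>?J. angle i \<omega>)) \<omega>
      = (\<Sum>b\<in>?T. indicat_real (near e b) \<omega>)"
    unfolding comp_def using near_ind_angles[OF _ sub \<omega>] by (intro sum.cong refl) auto
qed

text \<open>Measured from a shared point \<open>c\<close>, every point of \<open>b - a\<close> must
  lie within \<open>L * sqrt e\<close> of a coordinate of some minimum point, while
  \<open>near e a\<close> constrains only the points of \<open>a\<close>. So each point of
  \<open>b - a\<close> contributes one factor.\<close>

lemma joint_near_le:
  obtains e0 C where "e0 > 0" "C > 0"
    "\<And>e n a b. 0 \<le> e \<Longrightarrow> e < e0 \<Longrightarrow> a \<in> tuples n \<Longrightarrow> b \<in> tuples n \<Longrightarrow> a \<inter> b \<noteq> {} \<Longrightarrow>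
      prob (near e a \<inter> near e b) \<le> hit e * (C * sqrt e) ^ card (b - a)"
proof -
  obtain e0 L where e0: "e0 > 0" and L: "L > 0"
    and dist: "\<And>e x. 0 \<le> e \<Longrightarrow> e < e0 \<Longrightarrow> x \<in> sublevel e \<Longrightarrow> \<exists>v\<in>V. dist v x \<le> L * sqrt e"
    using sublevel_dist_minimizers by blast
  obtain B where B: "B > 0" "\<And>x. p x \<le> B" using p_bounded by blast
  \<comment> \<open>\<open>B\<close> bounds the density, and \<open>card V * CARD('n)\<close>
    intervals of length \<open>2 * L * sqrt e\<close> cover the admissible angles. The summand 1
    makes \<open>C\<close> strictly positive.\<close>
  define C where "C = B * (real (card V * CARD('n)) * (2 * L)) + 1"
  have "B * (real (card V * CARD('n)) * (2 * L)) \<ge> 0" using B L by simp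
  then have C: "C > 0" "B * (real (card V * CARD('n)) * (2 * L)) \<le> C" unfolding C_def by linarith+
  have "prob (near e a \<inter> near e b) \<le> hit e * (C * sqrt e) ^ card (b - a)"
    if e: "0 \<le> e" "e < e0" and a: "a \<in> tuples n" and b: "b \<in> tuples n" and ne: "a \<inter> b \<noteq> {}" for e n a b
  proof -
    obtain c where c: "c \<in> a" "c \<in> b" using ne by auto
    obtain i0 where i0: "enum b i0 = c" using c(2) bij_betw_imp_surj_on[OF enum_bij[OF b]] by (metis imageE)
    \<comment> \<open>The transposition makes the shared point \<open>c\<close> the reference point
      \<open>None\<close> in an enumeration of \<open>b\<close>.\<close>
    define j where "j = enum b \<circ> Transposition.transpose i0 None"
    have bij_j: "bij_betw j UNIV b"
      unfolding j_def using bij_betw_trans[OF bij_transpose enum_bij[OF b]] .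
    have j: "inj j" "range j = b" "j None = c"
      using bij_j i0 by (auto simp: bij_betw_def j_def)
    \<comment> \<open>Pooling all minimum points and all coordinates makes one set serve every point
      of \<open>b - a\<close>, whichever minimum point is close and whatever position the point has
      in \<open>b\<close>.\<close>
    define N where "N = (\<Union>(v, i)\<in>V \<times> UNIV. {v $ i - L * sqrt e .. v $ i + L * sqrt e})"
    define Lb where "Lb = real (card V * CARD('n)) * (2 * L) * sqrt e"
    have N_sets [measurable]: "N \<in> sets borel"
      unfolding N_def using finite_V by (intro sets.finite_UN) auto
    have N_le: "emeasure lborel N \<le> ennreal Lb"
    proof -
      have "emeasure lborel N \<le> (\<Sum>(v, i)\<in>V \<times> UNIV. emeasure lborel {v $ i - L * sqrt e .. v $ i + L * sqrt e})"
        unfolding N_def using finite_V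
        by (intro order_trans[OF emeasure_subadditive_finite]) (auto simp: split_beta')
      also have "\<dots> = (\<Sum>(v, i)\<in>V \<times> (UNIV :: 'n set). ennreal (2 * L * sqrt e))"
        using L e by (intro sum.cong) auto
      also have "\<dots> = ennreal Lb"
        using L e by (simp add: Lb_def card_cartesian_product split_beta' ennreal_mult ennreal_of_nat_eq_real_of_nat mult_ac)
      finally show ?thesis .
    qed
    have Lb: "Lb \<ge> 0" using L e by (simp add: Lb_def)
    define A where "A = {\<theta> \<in> space (PiM a (\<lambda>_. borel)). near_ind e a \<theta> = 1}"
    have A: "A \<in> sets (PiM a (\<lambda>_. borel))"
      unfolding A_def using near_ind_meas[OF a order_refl] by measurable
    have mem_A: "(\<lambda>i\<in>a. angle i \<omega>) \<in> A \<longleftrightarrow> \<omega> \<in> near e a" if "\<omega> \<in> space M" for \<omega>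
      using near_ind_angles[OF a order_refl that, of e] by (auto simp: A_def space_PiM indicator_def)
    have "near e a \<inter> near e b \<subseteq> {\<omega> \<in> space M. (\<lambda>i\<in>a. angle i \<omega>) \<in> A \<and> (\<forall>l\<in>b - a. Arg2pi (U l \<omega> / U c \<omega>) \<in> N)}"
    proof
      fix \<omega> assume \<omega>: "\<omega> \<in> near e a \<inter> near e b"
      then have sp: "\<omega> \<in> space M" by (auto simp: near_def)
      define x where "x = rel_angles (\<lambda>i. U (j i) \<omega>)"
      have "x \<in> sublevel e"
        using \<omega> unfolding near_eq[OF b j(1,2)] x_def sublevel_def by (auto simp: rel_angles_in_cube)
      then obtain v where v: "v \<in> V" "dist v x \<le> L * sqrt e" using dist e by blast
      have "Arg2pi (U l \<omega> / U c \<omega>) \<in> N" if l: "l \<in> b - a" for l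
      proof -
        obtain i' where i': "l = j i'" using l j(2) by auto
        have "l \<noteq> c" using l c by auto
        then obtain i where i: "l = j (Some i)" using i' j(3) by (cases i') auto
        have "Arg2pi (U l \<omega> / U c \<omega>) = x $ i" by (simp add: x_def rel_angles_def i j(3))
        moreover have "\<bar>v $ i - x $ i\<bar> \<le> L * sqrt e"
          using order_trans[OF dist_vec_nth_le v(2)] by (simp add: dist_real_def)
        ultimately show ?thesis
          unfolding N_def using v(1) by (intro UN_I[of "(v, i)"]) (auto simp: abs_le_iff)
      qed
      then show "\<omega> \<in> {\<omega> \<in> space M. (\<lambda>i\<in>a. angle i \<omega>) \<in> A \<and> (\<forall>l\<in>b - a. Arg2pi (U l \<omega> / U c \<omega>) \<in> N)}"
        using \<omega> sp mem_A by auto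
    qed
    moreover have "{\<omega> \<in> space M. (\<lambda>i\<in>a. angle i \<omega>) \<in> A \<and> (\<forall>l\<in>b - a. Arg2pi (U l \<omega> / U c \<omega>) \<in> N)} \<in> events"
    proof -
      have [measurable]: "U l \<in> borel_measurable M" if "l \<in> a \<union> b" for l
        using U_indep that tuplesD(2)[OF a] tuplesD(2)[OF b] by (auto simp: indep_vars_def)
      have [measurable]: "U c \<in> borel_measurable M" using c by simp
      have eq: "{\<omega> \<in> space M. (\<lambda>i\<in>a. angle i \<omega>) \<in> A \<and> (\<forall>l\<in>b - a. Arg2pi (U l \<omega> / U c \<omega>) \<in> N)}
        = near e a \<inter> {\<omega> \<in> space M. \<forall>l\<in>b - a. Arg2pi (U l \<omega> / U c \<omega>) \<in> N}"
        using mem_A by (auto simp: near_def)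
      have "{\<omega> \<in> space M. \<forall>l\<in>b - a. Arg2pi (U l \<omega> / U c \<omega>) \<in> N} \<in> events"
        using tuplesD(1)[OF b] by (intro sets.sets_Collect_finite_All) (auto simp: pred_def)
      then show ?thesis unfolding eq using near_events(1)[OF a] by auto
    qed
    ultimately have "prob (near e a \<inter> near e b)
      \<le> prob {\<omega> \<in> space M. (\<lambda>i\<in>a. angle i \<omega>) \<in> A \<and> (\<forall>l\<in>b - a. Arg2pi (U l \<omega> / U c \<omega>) \<in> N)}"
      by (rule finite_measure_mono)
    also have "\<dots> \<le> prob {\<omega> \<in> space M. (\<lambda>i\<in>a. angle i \<omega>) \<in> A} * (B * Lb) ^ card (b - a)"
      using tuplesD[OF a] tuplesD[OF b] c B Lb
      by (intro prob_joint_le[OF _ _ _ _ _ _ _ _ A N_sets N_le]) auto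
    also have "{\<omega> \<in> space M. (\<lambda>i\<in>a. angle i \<omega>) \<in> A} = near e a"
      using mem_A by (auto simp: near_def)
    also have "prob (near e a) * (B * Lb) ^ card (b - a) \<le> hit e * (C * sqrt e) ^ card (b - a)"
    proof -
      have "B * Lb \<le> C * sqrt e"
        using mult_right_mono[OF C(2), of "sqrt e"] e by (simp add: Lb_def mult_ac)
      then show ?thesis
        unfolding near_events(2)[OF a] using B Lb by (intro mult_left_mono power_mono hit_nonneg) auto
    qed
    finally show ?thesis .
  qed
  with e0 C(1) show thesis by (rule that)
qed

text \<open>Neighbours \<open>b\<close> of \<open>a\<close> are grouped by
  \<open>k = card (b - a)\<close>. In the sum of products every group is bounded with the largest
  power of \<open>n\<close>, and there are \<open>Suc CARD('n)\<close> groups. In the sum of joint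
  probabilities the count \<open>n ^ k\<close> merges with \<open>(C * sqrt e) ^ k\<close>.\<close>

lemma poisson_error:
  obtains e0 C where "e0 > 0" "C > 0"
    "\<And>e n. 0 \<le> e \<Longrightarrow> e < e0 \<Longrightarrow> n \<ge> 1 \<Longrightarrow>
      \<bar>prob {\<omega> \<in> space M. \<forall>a\<in>tuples n. \<omega> \<notin> near e a} - exp (- (real (n choose Suc CARD('n)) * hit e))\<bar>
      \<le> real n ^ Suc CARD('n) * hit e * (2 ^ Suc CARD('n) *
          (hit e * real (Suc CARD('n)) * real n ^ CARD('n) + (\<Sum>k=1..CARD('n). (C * (real n * sqrt e)) ^ k)))"
proof -
  let ?m = "Suc CARD('n)"
  obtain e0 C where e0: "e0 > 0" and C: "C > 0"
    and joint: "\<And>e n a b. 0 \<le> e \<Longrightarrow> e < e0 \<Longrightarrow> a \<in> tuples n \<Longrightarrow> b \<in> tuples n \<Longrightarrow> a \<inter> b \<noteq> {} \<Longrightarrow>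
      prob (near e a \<inter> near e b) \<le> hit e * (C * sqrt e) ^ card (b - a)"
    using joint_near_le by blast
  have "\<bar>prob {\<omega> \<in> space M. \<forall>a\<in>tuples n. \<omega> \<notin> near e a} - exp (- (real (n choose ?m) * hit e))\<bar>
      \<le> real n ^ ?m * hit e * (2 ^ ?m *
          (hit e * real ?m * real n ^ CARD('n) + (\<Sum>k=1..CARD('n). (C * (real n * sqrt e)) ^ k)))"
    if e: "0 \<le> e" "e < e0" and n: "n \<ge> 1" for e n
  proof -
    define N where "N = (\<lambda>a. {b \<in> tuples n. b \<inter> a \<noteq> {}})"
    \<comment> \<open>\<open>X\<close> is empty for the sum of products and \<open>{a}\<close> for
      the sum of joint probabilities.\<close>
    have N_sum: "(\<Sum>b\<in>N a - X. g (card (b - a))) \<le> (\<Sum>k\<in>K. 2 ^ ?m * real n ^ k * g k)"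
      if a: "a \<in> tuples n" and K: "finite K" "\<And>b. b \<in> N a - X \<Longrightarrow> card (b - a) \<in> K"
        and g: "\<And>k. g k \<ge> 0" for a X K and g :: "nat \<Rightarrow> real"
    proof -
      have finN: "finite (N a - X)" using finite_tuples by (simp add: N_def)
      have "(\<Sum>b\<in>N a - X. g (card (b - a))) = (\<Sum>k\<in>K. \<Sum>b\<in>{b \<in> N a - X. card (b - a) = k}. g (card (b - a)))"
        using K by (intro sum.group[symmetric] finN) auto
      also have "\<dots> = (\<Sum>k\<in>K. real (card {b \<in> N a - X. card (b - a) = k}) * g k)" by simp
      also have "\<dots> \<le> (\<Sum>k\<in>K. 2 ^ ?m * real n ^ k * g k)"
      proof (intro sum_mono mult_right_mono g)
        fix k
        have "{b \<in> N a - X. card (b - a) = k} \<subseteq> {b. b \<subseteq> {1..n} \<and> card (b - a) = k}"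
          by (auto simp: N_def tuples_def)
        then have "card {b \<in> N a - X. card (b - a) = k} \<le> card {b. b \<subseteq> {1..n} \<and> card (b - a) = k}"
          by (intro card_mono) auto
        also have "\<dots> \<le> 2 ^ ?m * n ^ k"
          using tuplesD[OF a] by (intro card_subsets_diff_le) auto
        finally have "real (card {b \<in> N a - X. card (b - a) = k}) \<le> real (2 ^ ?m * n ^ k)"
          by (simp only: of_nat_le_iff)
        then show "real (card {b \<in> N a - X. card (b - a) = k}) \<le> 2 ^ ?m * real n ^ k" by simp
      qed
      finally show ?thesis .
    qed
    have card_le: "card (b - a) \<le> CARD('n)" if "a \<in> tuples n" "b \<in> N a" for a b
    proof -
      have "b - a \<subset> b" using that by (auto simp: N_def)
      then have "card (b - a) < card b" using that tuplesD(1) by (intro psubset_card_mono) (auto simp: N_def)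
      then show ?thesis using that tuplesD(4) by (auto simp: N_def)
    qed
    \<comment> \<open>The sets have equal size, so \<open>b \<noteq> a\<close> forces a point of
      \<open>b\<close> outside \<open>a\<close>. This removes \<open>k = 0\<close>, the one group
      that would not become small.\<close>
    have card_ge: "1 \<le> card (b - a)" if "a \<in> tuples n" "b \<in> N a - {a}" for a b
    proof -
      have "\<not> b \<subseteq> a"
        using that card_subset_eq[of a b] tuplesD(1,4)[OF that(1)] tuplesD(4)[of b n] by (auto simp: N_def)
      then have "b - a \<noteq> {}" by auto
      then show ?thesis
        using that tuplesD(1)[of b n] by (auto simp: N_def Suc_le_eq card_gt_0_iff)
    qed
    have b1: "(\<Sum>b\<in>N a. prob (near e a) * prob (near e b)) \<le> 2 ^ ?m * (hit e * (hit e * real ?m * real n ^ CARD('n)))"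
      if a: "a \<in> tuples n" for a
    proof -
      have "(\<Sum>b\<in>N a. prob (near e a) * prob (near e b)) = (\<Sum>b\<in>N a - {}. (hit e)\<^sup>2)"
        using near_events(2) a by (intro sum.cong) (auto simp: N_def power2_eq_square)
      also have "\<dots> \<le> (\<Sum>k\<le>CARD('n). 2 ^ ?m * real n ^ k * (hit e)\<^sup>2)"
        using a card_le by (intro N_sum) auto
      also have "\<dots> \<le> (\<Sum>k\<le>CARD('n). 2 ^ ?m * real n ^ CARD('n) * (hit e)\<^sup>2)"
        using n by (intro sum_mono mult_right_mono mult_left_mono power_increasing) auto
      also have "\<dots> = 2 ^ ?m * (hit e * (hit e * real ?m * real n ^ CARD('n)))"
        by (simp add: power2_eq_square mult_ac)
      finally show ?thesis .
    qed
    have b2: "(\<Sum>b\<in>N a - {a}. prob (near e a \<inter> near e b)) \<le> 2 ^ ?m * (hit e * (\<Sum>k=1..CARD('n). (C * (real n * sqrt e)) ^ k))"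
      if a: "a \<in> tuples n" for a
    proof -
      have "(\<Sum>b\<in>N a - {a}. prob (near e a \<inter> near e b)) \<le> (\<Sum>b\<in>N a - {a}. hit e * (C * sqrt e) ^ card (b - a))"
        using a e by (intro sum_mono joint[OF _ _ a]) (auto simp: N_def Int_commute)
      also have "\<dots> \<le> (\<Sum>k\<in>{1..CARD('n)}. 2 ^ ?m * real n ^ k * (hit e * (C * sqrt e) ^ k))"
        using a card_le card_ge C e by (intro N_sum mult_nonneg_nonneg hit_nonneg) auto
      also have "\<dots> = 2 ^ ?m * (hit e * (\<Sum>k=1..CARD('n). (C * (real n * sqrt e)) ^ k))"
        by (simp add: sum_distrib_left power_mult_distrib mult_ac)
      finally show ?thesis .
    qed
    have dist: "r * (P * (g * x)) + r * (P * (g * y)) = r * (g * (P * (x + y)))" for r P g x y :: real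
      by (simp add: algebra_simps)
    have "\<bar>prob {\<omega> \<in> space M. \<forall>a\<in>tuples n. \<omega> \<notin> near e a} - exp (- (\<Sum>a\<in>tuples n. prob (near e a)))\<bar>
      \<le> (\<Sum>a\<in>tuples n. \<Sum>b\<in>N a. prob (near e a) * prob (near e b))
        + (\<Sum>a\<in>tuples n. \<Sum>b\<in>N a - {a}. prob (near e a \<inter> near e b))"
    proof (rule poisson_void_bound)
      fix a assume a: "a \<in> tuples n"
      have "tuples n - N a = {b \<in> tuples n. b \<inter> a = {}}" by (auto simp: N_def)
      then show "indep_var borel (indicat_real (near e a)) borel (\<lambda>\<omega>. \<Sum>b\<in>tuples n - N a. indicat_real (near e b) \<omega>)"
        using indep_near[OF a] by simp
      show "near e a \<in> events" by (rule near_events(1)[OF a])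
      show "a \<in> N a" using a tuplesD(5) by (auto simp: N_def)
    qed (auto simp: N_def finite_tuples)
    also have "\<dots> \<le> (\<Sum>a\<in>tuples n. 2 ^ ?m * (hit e * (hit e * real ?m * real n ^ CARD('n))))
      + (\<Sum>a\<in>tuples n. 2 ^ ?m * (hit e * (\<Sum>k=1..CARD('n). (C * (real n * sqrt e)) ^ k)))"
      by (intro add_mono sum_mono b1 b2)
    also have "\<dots> = real (n choose ?m) * (hit e * (2 ^ ?m *
          (hit e * real ?m * real n ^ CARD('n) + (\<Sum>k=1..CARD('n). (C * (real n * sqrt e)) ^ k))))"
      by (simp only: sum_constant card_tuples dist)
    also have "\<dots> \<le> real n ^ ?m * (hit e * (2 ^ ?m *
          (hit e * real ?m * real n ^ CARD('n) + (\<Sum>k=1..CARD('n). (C * (real n * sqrt e)) ^ k))))"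
    proof (rule mult_right_mono)
      show "real (n choose ?m) \<le> real n ^ ?m"
        using binomial_le_power[of n ?m] by (metis of_nat_le_iff of_nat_power)
      show "0 \<le> hit e * (2 ^ ?m *
          (hit e * real ?m * real n ^ CARD('n) + (\<Sum>k=1..CARD('n). (C * (real n * sqrt e)) ^ k)))"
        using C e by (intro mult_nonneg_nonneg add_nonneg_nonneg sum_nonneg hit_nonneg) auto
    qed
    also have "(\<Sum>a\<in>tuples n. prob (near e a)) = real (n choose ?m) * hit e"
      by (simp add: near_events(2) card_tuples)
    finally show ?thesis by (simp only: mult.assoc)
  qed
  with e0 C show thesis by (rule that)
qed

lemma void_prob_limit:
  assumes t: "t > 0"
  defines "d \<equiv> real CARD('n)"
  defines "e \<equiv> \<lambda>n::nat. t / real n powr (2 * (d + 1) / d)"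
  shows "(\<lambda>n. prob {\<omega> \<in> space M. \<forall>a\<in>tuples n. \<omega> \<notin> near (e n) a}) \<longlonglongrightarrow>
    exp (- (t powr (d / 2) * ((2 * pi) powr (d / 2) / Gamma (d / 2 + 1) *
      (\<Sum>v\<in>V. 1 / sqrt (hess_det v) * shifted_integral p v)) / fact (Suc CARD('n))))"
proof -
  let ?m = "Suc CARD('n)"
  define \<kappa> where "\<kappa> = (2 * pi) powr (d / 2) / Gamma (d / 2 + 1) * (\<Sum>v\<in>V. 1 / sqrt (hess_det v) * shifted_integral p v)"
  have d: "d > 0" by (simp add: d_def)
  \<comment> \<open>At \<open>n = 0\<close> the division by 0 gives \<open>e 0 = 0\<close>, whereas
    the limit lemma wants all terms positive; one altered term does not affect limits.\<close>
  define e' where "e' = (\<lambda>n. if n = 0 then t else e n)"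
  have e'_pos: "e' n > 0" for n using t by (simp add: e'_def e_def)
  have "(\<lambda>n. t * real n powr (- (2 * (d + 1) / d))) \<longlonglongrightarrow> t * 0"
    using d by (intro tendsto_mult_left tendsto_neg_powr filterlim_real_sequentially) auto
  then have e_lim: "e \<longlonglongrightarrow> 0"
    by (simp add: e_def[abs_def] powr_minus divide_inverse)
  have ev: "\<forall>\<^sub>F n in sequentially. e n = e' n"
    using eventually_gt_at_top[of 0] by eventually_elim (simp add: e'_def)
  then have e'_lim: "e' \<longlonglongrightarrow> 0" using e_lim by (rule Lim_transform_eventually[rotated])
  obtain Cb where Cb: "\<And>b :: real^'n. \<bar>shifted_integral p b\<bar> \<le> Cb"
    by (rule shifted_integral_bounded) blast
  have "(\<lambda>n. hit (e' n) / e' n powr (d / 2)) \<longlonglongrightarrow> \<kappa>"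
    unfolding hit_def \<kappa>_def d_def
    by (rule sublevel_integral_limit[OF shifted_integral_isCont Cb shifted_integral_meas e'_pos e'_lim])
  then have "(\<lambda>n. t powr (d / 2) * (hit (e' n) / e' n powr (d / 2))) \<longlonglongrightarrow> t powr (d / 2) * \<kappa>"
    by (rule tendsto_mult_left)
  moreover have "\<forall>\<^sub>F n in sequentially. t powr (d / 2) * (hit (e' n) / e' n powr (d / 2)) = real n ^ ?m * hit (e n)"
    using eventually_gt_at_top[of 0]
  proof eventually_elim
    case (elim n)
    \<comment> \<open>The normalising exponent is made for this cancellation:
      \<open>e n powr (d / 2)\<close> is \<open>t powr (d / 2)\<close> divided by
      \<open>real n ^ ?m\<close>.\<close>
    have "2 * (d + 1) / d * (d / 2) = d + 1" using d by simp
    then have "e n powr (d / 2) = t powr (d / 2) / real n powr (d + 1)"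
      using t by (simp only: e_def powr_divide powr_powr of_nat_0_le_iff less_imp_le powr_ge_zero)
    also have "real n powr (d + 1) = real n ^ ?m"
      using elim by (simp add: d_def powr_add powr_realpow)
    finally show ?case using elim t by (simp add: e'_def)
  qed
  ultimately have L1: "(\<lambda>n. real n ^ ?m * hit (e n)) \<longlonglongrightarrow> t powr (d / 2) * \<kappa>"
    by (rule Lim_transform_eventually)
  \<comment> \<open>Up to a constant this bounds the expected number of sample points close to a
    prescribed position.\<close>
  have L2: "(\<lambda>n. real n * sqrt (e n)) \<longlonglongrightarrow> 0"
  proof -
    have "(\<lambda>n. sqrt t * real n powr (- (1 / d))) \<longlonglongrightarrow> sqrt t * 0"
      using d by (intro tendsto_mult_left tendsto_neg_powr filterlim_real_sequentially) auto
    moreover have "\<forall>\<^sub>F n in sequentially. sqrt t * real n powr (- (1 / d)) = real n * sqrt (e n)"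
      using eventually_gt_at_top[of 0]
    proof eventually_elim
      case (elim n)
      have exponent: "2 * (d + 1) / d * (1 / 2) = (d + 1) / d" using d by (simp add: field_simps)
      have "sqrt (real n powr (2 * (d + 1) / d)) = real n powr (2 * (d + 1) / d * (1 / 2))"
        by (simp only: powr_half_sqrt[symmetric] powr_powr powr_ge_zero)
      then have "sqrt (e n) = sqrt t / real n powr ((d + 1) / d)"
        by (simp only: e_def real_sqrt_divide exponent)
      also have "real n powr ((d + 1) / d) = real n * real n powr (1 / d)"
        using d elim by (simp add: add_divide_distrib powr_add)
      finally show ?case using elim by (simp add: powr_minus field_simps)
    qed
    ultimately show ?thesis using Lim_transform_eventually by fastforce
  qed
  obtain e0 C where e0: "e0 > 0" and "C > 0"
    and err: "\<And>e n. 0 \<le> e \<Longrightarrow> e < e0 \<Longrightarrow> n \<ge> 1 \<Longrightarrow>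
      \<bar>prob {\<omega> \<in> space M. \<forall>a\<in>tuples n. \<omega> \<notin> near e a} - exp (- (real (n choose ?m) * hit e))\<bar>
      \<le> real n ^ ?m * hit e * (2 ^ ?m *
          (hit e * real ?m * real n ^ CARD('n) + (\<Sum>k=1..CARD('n). (C * (real n * sqrt e)) ^ k)))"
    using poisson_error by blast
  define R where "R = (\<lambda>n. real n ^ ?m * hit (e n) * (2 ^ ?m *
          (hit (e n) * real ?m * real n ^ CARD('n) + (\<Sum>k=1..CARD('n). (C * (real n * sqrt (e n))) ^ k))))"
  \<comment> \<open>The first factor converges and the bracket tends to 0: \<open>hit (e n)\<close>
    is of order \<open>n\<close> to the power \<open>- ?m\<close>, which beats
    \<open>n ^ CARD('n)\<close> by one power, and the powers of \<open>n * sqrt (e n)\<close> start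
    at \<open>k = 1\<close>.\<close>
  have R: "R \<longlonglongrightarrow> 0"
  proof -
    have "(\<lambda>n. real n ^ ?m * hit (e n) * real ?m * inverse (real n)) \<longlonglongrightarrow> t powr (d / 2) * \<kappa> * real ?m * 0"
      by (intro tendsto_mult L1 tendsto_const lim_inverse_n)
    moreover have "\<forall>\<^sub>F n in sequentially. real n ^ ?m * hit (e n) * real ?m * inverse (real n)
        = hit (e n) * real ?m * real n ^ CARD('n)"
      using eventually_gt_at_top[of 0] by eventually_elim simp
    ultimately have L3: "(\<lambda>n. hit (e n) * real ?m * real n ^ CARD('n)) \<longlonglongrightarrow> 0"
      using Lim_transform_eventually by fastforce
    have L4: "(\<lambda>n. \<Sum>k=1..CARD('n). (C * (real n * sqrt (e n))) ^ k) \<longlonglongrightarrow> (\<Sum>k=1..CARD('n). (C * 0) ^ k)"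
      by (intro tendsto_intros L2)
    also have "(\<Sum>k=1..CARD('n). (C * 0) ^ k) = 0" by (intro sum.neutral) auto
    finally have "R \<longlonglongrightarrow> t powr (d / 2) * \<kappa> * (2 ^ ?m * (0 + 0))"
      unfolding R_def by (intro tendsto_intros L1 L3)
    then show ?thesis by simp
  qed
  have "\<forall>\<^sub>F n in sequentially. norm (prob {\<omega> \<in> space M. \<forall>a\<in>tuples n. \<omega> \<notin> near (e n) a}
      - exp (- (real (n choose ?m) * hit (e n)))) \<le> R n"
    using order_tendstoD(2)[OF e_lim e0] eventually_ge_at_top[of 1]
  proof eventually_elim
    case (elim n)
    have "0 \<le> e n" using t by (simp add: e_def)
    from err[OF this elim] show ?case by (simp add: R_def)
  qed
  then have diff: "(\<lambda>n. prob {\<omega> \<in> space M. \<forall>a\<in>tuples n. \<omega> \<notin> near (e n) a}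
      - exp (- (real (n choose ?m) * hit (e n)))) \<longlonglongrightarrow> 0"
    by (rule Lim_null_comparison[OF _ R])
  have "(\<lambda>n. real (n choose ?m) / real n ^ ?m * (real n ^ ?m * hit (e n))) \<longlonglongrightarrow> 1 / fact ?m * (t powr (d / 2) * \<kappa>)"
    by (intro tendsto_mult binomial_over_power_limit L1)
  moreover have "\<forall>\<^sub>F n in sequentially. real (n choose ?m) / real n ^ ?m * (real n ^ ?m * hit (e n))
      = real (n choose ?m) * hit (e n)"
    using eventually_gt_at_top[of 0] by eventually_elim simp
  ultimately have "(\<lambda>n. real (n choose ?m) * hit (e n)) \<longlonglongrightarrow> 1 / fact ?m * (t powr (d / 2) * \<kappa>)"
    by (rule Lim_transform_eventually)
  then have "(\<lambda>n. exp (- (real (n choose ?m) * hit (e n)))) \<longlonglongrightarrow> exp (- (1 / fact ?m * (t powr (d / 2) * \<kappa>)))"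
    by (intro tendsto_exp tendsto_minus)
  from tendsto_add[OF diff this] show ?thesis by (simp add: \<kappa>_def mult_ac)
qed

end

text \<open>The minimum runs over a finite set, which is nonempty because the whole index type
  embeds increasingly into \<open>{1..n}\<close>.\<close>

lemma min_U_stat_le_iff:
  fixes f :: "('n::{finite,linorder} option \<Rightarrow> complex) \<Rightarrow> ereal"
  assumes n: "CARD('n option) \<le> n"
  shows "min_U_stat f u n \<le> c \<longleftrightarrow> (\<exists>j. strict_mono j \<and> range j \<subseteq> {1..n} \<and> f (u \<circ> j) \<le> c)"
proof -
  let ?J = "{j :: 'n option \<Rightarrow> nat. strict_mono j \<and> range j \<subseteq> {1..n}}"
  have "?J \<subseteq> PiE UNIV (\<lambda>_. {1..n})" by (auto simp: PiE_UNIV_domain)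
  then have fin: "finite ?J" by (rule finite_subset) (auto intro!: finite_PiE)
  have card: "card {1..CARD('n option)} = CARD('n option)" by simp
  obtain j :: "'n option \<Rightarrow> nat" where "strict_mono j" "range j = {1..CARD('n option)}"
    using ex_strict_mono_onto[OF finite_atLeastAtMost card] by blast
  then have "j \<in> ?J" using n by auto
  then have ne: "?J \<noteq> {}" by blast
  have "min_U_stat f u n = Min ((\<lambda>j. f (u \<circ> j)) ` ?J)"
    by (simp add: min_U_stat_def image_Collect)
  then show ?thesis using fin ne by (auto simp: Min_le_iff)
qed

text \<open>Scaling by a finite positive factor and shifting by a finite \<open>\<mu>\<close> are
  reversible for infinite \<open>x\<close> too. This turns the normalised event into a sublevel
  condition at height \<open>t / c\<close>.\<close>

lemma ereal_scaled_diff_le_iff: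
  fixes x :: ereal
  assumes "c > 0"
  shows "ereal c * (x - ereal \<mu>) \<le> ereal t \<longleftrightarrow> x \<le> ereal (\<mu> + t / c)"
  using assms by (cases x) (auto simp: field_simps)

theorem corollary4p1:
  fixes m :: nat
    and f :: "('n::{finite,linorder} option \<Rightarrow> complex) \<Rightarrow> ereal"
    and h :: "real ^ 'n::{finite,linorder} \<Rightarrow> ereal"
    and \<mu> :: real
    and V :: "(real ^ 'n::{finite,linorder}) set"
    and M :: "'w measure"
    and U :: "nat \<Rightarrow> 'w \<Rightarrow> complex"
    and p :: "real \<Rightarrow> real"
    and t K :: real
  assumes m: "m \<ge> 2" "CARD('n) = m - 1"
    and h_range: "\<And>x. x \<in> angle_cube \<Longrightarrow> h x \<noteq> -\<infinity>"
    and A1: "\<And>u. (\<And>i. u i \<in> sphere 0 1) \<Longrightarrow> f u = h (rel_angles u)"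
    and A2: "\<And>u \<pi>. (\<And>i. u i \<in> sphere 0 1) \<Longrightarrow> bij \<pi> \<Longrightarrow> f (u \<circ> \<pi>) = f u"
    and A3: "continuous_on angle_cube h"
    and A4: "\<And>x. x \<in> angle_cube \<Longrightarrow> ereal \<mu> \<le> h x"
            "V = {x \<in> angle_cube. h x = ereal \<mu>}"
            "finite V" "V \<noteq> {}"
            "\<And>v j. v \<in> V \<Longrightarrow> v $ j \<in> {0<..<2 * pi}"
    and A5: "\<exists>\<delta>>0. \<forall>v\<in>V. (\<forall>x\<in>ball v \<delta>. \<bar>h x\<bar> \<noteq> \<infinity>) \<and>
               cont_diff_on 3 (\<lambda>x. real_of_ereal (h x)) (ball v \<delta>)"
    and A6: "\<And>v. v \<in> V \<Longrightarrow> det (hessian (\<lambda>x. real_of_ereal (h x)) v) \<noteq> 0"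
    and B1: "prob_space M"
            "\<And>i \<omega>. i \<ge> 1 \<Longrightarrow> \<omega> \<in> space M \<Longrightarrow> U i \<omega> \<in> sphere 0 1"
            "prob_space.indep_vars M (\<lambda>_. borel) U {1..}"
            "\<And>i. i \<ge> 1 \<Longrightarrow> distributed M lborel (\<lambda>\<omega>. Arg2pi (U i \<omega>))
                               (\<lambda>x. ennreal (p x * indicator {0..<2 * pi} x))"
    and B2: "continuous_on UNIV p" "\<And>x. p x \<ge> 0" "\<And>x. p (x + 2 * pi) = p x"
            "(LBINT x:{0..2 * pi}. p x) = 1"
    and B3: "\<exists>v\<in>V. shifted_integral p v \<noteq> 0"
    and K: "K = (2 * pi) powr ((real m - 1) / 2) / Gamma ((real m + 1) / 2) *
              (\<Sum>v\<in>V. 1 / sqrt (det (hessian (\<lambda>x. real_of_ereal (h x)) v)) * shifted_integral p v)"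
    and t: "t > 0"
  shows "(\<lambda>n. measure M {\<omega> \<in> space M.
            ereal (real n powr (2 * real m / (real m - 1))) *
              (min_U_stat f (\<lambda>i. U i \<omega>) n - ereal \<mu>) \<le> ereal t})
         \<longlonglongrightarrow> 1 - exp (- (t powr ((real m - 1) / 2) * K / fact m))"
proof -
  \<comment> \<open>Permuted circle points are again circle points, so both sides are values of
    \<open>f\<close>, where A2 applies.\<close>
  have symmetric: "h (rel_angles (u \<circ> \<pi>)) = h (rel_angles u)"
    if u: "\<And>i. u i \<in> sphere 0 1" and "bij \<pi>" for u and \<pi> :: "'n option \<Rightarrow> 'n option"
    using A2[OF that] A1[of u] A1[of "u \<circ> \<pi>"] u by simp
  interpret prob_space M by (rule B1)
  interpret symmetric_kernel_sample h \<mu> V p M U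
  proof
    show "distributed M lborel (\<lambda>\<omega>. Arg2pi (U i \<omega>)) (\<lambda>x. ennreal (p x * indicator {0..<2 * pi} x))"
      if "i \<ge> 1" for i using that by (rule B1)
    show "U i \<omega> \<in> sphere 0 1" if "i \<ge> 1" "\<omega> \<in> space M" for i \<omega> using that by (rule B1)
    show "v $ j \<in> {0<..<2 * pi}" if "v \<in> V" for v j using that by (rule A4)
  qed (use A3 A4(1-3) A5 A6 B1(3) B2 symmetric in auto)
  define d where "d = real CARD('n)"
  define e where "e = (\<lambda>n::nat. t / real n powr (2 * (d + 1) / d))"
  have m_eq: "m = Suc CARD('n)" using m by simp
  have md: "real m = d + 1" by (simp add: m_eq d_def)
  \<comment> \<open>From \<open>n = m\<close> on there are increasing tuples to minimise over. Such
    a tuple yields its range, and a set in \<open>tuples n\<close> yields its increasing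
    enumeration.\<close>
  have hit_event: "{\<omega> \<in> space M. ereal (real n powr (2 * real m / (real m - 1))) *
        (min_U_stat f (\<lambda>i. U i \<omega>) n - ereal \<mu>) \<le> ereal t} = (\<Union>a\<in>tuples n. near (e n) a)"
    if n: "n \<ge> m" for n
  proof -
    have n': "CARD('n option) \<le> n" using n by (simp add: m_eq card_UNIV_option)
    have c: "real n powr (2 * real m / (real m - 1)) > 0" using n m by simp
    have "ereal (real n powr (2 * real m / (real m - 1))) * (min_U_stat f (\<lambda>i. U i \<omega>) n - ereal \<mu>) \<le> ereal t
      \<longleftrightarrow> (\<exists>a\<in>tuples n. \<omega> \<in> near (e n) a)" if \<omega>: "\<omega> \<in> space M" for \<omega>
    proof -
      have f_eq: "f ((\<lambda>i. U i \<omega>) \<circ> j) = h (rel_angles (\<lambda>i. U (j i) \<omega>))" if "range j \<subseteq> {1..n}" for j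
        using U_circle[OF _ \<omega>] that A1[of "(\<lambda>i. U i \<omega>) \<circ> j"] by (auto simp: comp_def image_subset_iff)
      have range_tuples: "range j \<in> tuples n" if "strict_mono j" "range j \<subseteq> {1..n}" for j :: "'n option \<Rightarrow> nat"
        using that strict_mono_imp_inj_on[of j] by (simp add: tuples_def card_image card_UNIV_option)
      have "ereal (real n powr (2 * real m / (real m - 1))) * (min_U_stat f (\<lambda>i. U i \<omega>) n - ereal \<mu>) \<le> ereal t
        \<longleftrightarrow> min_U_stat f (\<lambda>i. U i \<omega>) n \<le> ereal (\<mu> + e n)"
        unfolding ereal_scaled_diff_le_iff[OF c] by (simp add: e_def md)
      also have "\<dots> \<longleftrightarrow> (\<exists>j. strict_mono j \<and> range j \<subseteq> {1..n} \<and> f ((\<lambda>i. U i \<omega>) \<circ> j) \<le> ereal (\<mu> + e n))"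
        by (rule min_U_stat_le_iff[OF n'])
      also have "\<dots> \<longleftrightarrow> (\<exists>a\<in>tuples n. \<omega> \<in> near (e n) a)"
      proof
        assume "\<exists>j. strict_mono j \<and> range j \<subseteq> {1..n} \<and> f ((\<lambda>i. U i \<omega>) \<circ> j) \<le> ereal (\<mu> + e n)"
        then obtain j where j: "strict_mono j" "range j \<subseteq> {1..n}" "f ((\<lambda>i. U i \<omega>) \<circ> j) \<le> ereal (\<mu> + e n)"
          by auto
        have "near (e n) (range j) = {\<omega> \<in> space M. h (rel_angles (\<lambda>i. U (j i) \<omega>)) \<le> ereal (\<mu> + e n)}"
          by (rule near_eq[OF range_tuples[OF j(1,2)] strict_mono_imp_inj_on[OF j(1)] refl])
        then have "\<omega> \<in> near (e n) (range j)" using j \<omega> f_eq by simp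
        then show "\<exists>a\<in>tuples n. \<omega> \<in> near (e n) a" using range_tuples[OF j(1,2)] by blast
      next
        assume "\<exists>a\<in>tuples n. \<omega> \<in> near (e n) a"
        then obtain a where a: "a \<in> tuples n" "\<omega> \<in> near (e n) a" by auto
        have card_a: "card a = CARD('n option)" using tuplesD(4)[OF a(1)] by (simp add: card_UNIV_option)
        obtain j :: "'n option \<Rightarrow> nat" where j: "strict_mono j" "range j = a"
          using ex_strict_mono_onto[OF tuplesD(1)[OF a(1)] card_a] by blast
        have "h (rel_angles (\<lambda>i. U (j i) \<omega>)) \<le> ereal (\<mu> + e n)"
          using a(2) unfolding near_eq[OF a(1) strict_mono_imp_inj_on[OF j(1)] j(2)] by simp
        moreover have "range j \<subseteq> {1..n}" using tuplesD(3)[OF a(1)] j(2) by simp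
        ultimately show "\<exists>j. strict_mono j \<and> range j \<subseteq> {1..n} \<and> f ((\<lambda>i. U i \<omega>) \<circ> j) \<le> ereal (\<mu> + e n)"
          using j(1) f_eq by (intro exI[of _ j]) simp
      qed
      finally show ?thesis .
    qed
    moreover have "near (e n) a \<subseteq> space M" for a by (auto simp: near_def)
    ultimately show ?thesis by blast
  qed
  have compl: "measure M (\<Union>a\<in>tuples n. near (e n) a) = 1 - prob {\<omega> \<in> space M. \<forall>a\<in>tuples n. \<omega> \<notin> near (e n) a}" for n
  proof -
    have "(\<Union>a\<in>tuples n. near (e n) a) \<in> events"
      using finite_tuples near_events(1) by (intro sets.finite_UN) auto
    moreover have "{\<omega> \<in> space M. \<forall>a\<in>tuples n. \<omega> \<notin> near (e n) a} = space M - (\<Union>a\<in>tuples n. near (e n) a)"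
      by auto
    ultimately show ?thesis by (simp add: prob_compl)
  qed
  have ev: "\<forall>\<^sub>F n in sequentially. 1 - prob {\<omega> \<in> space M. \<forall>a\<in>tuples n. \<omega> \<notin> near (e n) a}
    = measure M {\<omega> \<in> space M. ereal (real n powr (2 * real m / (real m - 1))) *
        (min_U_stat f (\<lambda>i. U i \<omega>) n - ereal \<mu>) \<le> ereal t}"
    using eventually_ge_at_top[of m] by (rule eventually_mono) (simp only: hit_event compl)
  \<comment> \<open>With \<open>d = m - 1\<close>, the number of angles, the
    \<open>Gamma (d / 2 + 1)\<close> of the ball volume is the \<open>Gamma ((m + 1) / 2)\<close> of
    \<open>K\<close>.\<close>
  have exponents: "(real m - 1) / 2 = d / 2" "(real m + 1) / 2 = d / 2 + 1"
    by (simp_all add: md field_simps)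
  have "(\<lambda>n. prob {\<omega> \<in> space M. \<forall>a\<in>tuples n. \<omega> \<notin> near (e n) a}) \<longlonglongrightarrow>
      exp (- (t powr (d / 2) * ((2 * pi) powr (d / 2) / Gamma (d / 2 + 1) *
        (\<Sum>v\<in>V. 1 / sqrt (hess_det v) * shifted_integral p v)) / fact (Suc CARD('n))))"
    unfolding d_def e_def by (rule void_prob_limit[OF t])
  then have "(\<lambda>n. prob {\<omega> \<in> space M. \<forall>a\<in>tuples n. \<omega> \<notin> near (e n) a}) \<longlonglongrightarrow>
      exp (- (t powr ((real m - 1) / 2) * K / fact m))"
    by (simp only: K exponents hess_det_def m_eq[symmetric])
  then have "(\<lambda>n. 1 - prob {\<omega> \<in> space M. \<forall>a\<in>tuples n. \<omega> \<notin> near (e n) a}) \<longlonglongrightarrow>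
      1 - exp (- (t powr ((real m - 1) / 2) * K / fact m))"
    by (intro tendsto_diff tendsto_const)
  then show ?thesis using ev by (rule Lim_transform_eventually)
qed

end
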